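(* For every integer $d\ge2$ there is a constant $C_d>0$ depending only on $d$ such that for every $n\ge 2d$, the switch chain $(\Omega^B_n(d),\pi_u,Q_u)$ satisfies the Modified log-Sobolev Inequality with constant $C_d\,n$, i.e. ${\rm Ent}_{\pi_u}(f)\le C_d\,n\,\mathcal E_{\pi_u}(\log f,f)$ for every $f:\Omega^B_n(d)\to(0,\infty)$.
   Context: $\Omega^B_n(d)$ is the set of all simple bipartite $d$-regular graphs on the vertex set $[n^{(\ell)}]\sqcup[n^{(r)}]$ (two disjoint copies of $[n]$, left and right), with $\pi_u$ the uniform distribution. A simple switching of $G$ picks two edges $(i_1,j_1),(i_2,j_2)$ with $i_1\ne i_2$, $j_1\ne j_2$, deletes them and adds $(i_1,j_2),(i_2,j_1)$, provided the result is simple; $\mathcal N(G)$ is the set of graphs in $\Omega^B_n(d)$ obtainable from $G$ in this way. The generator is $Q_u(G_1,G_2)=(nd(nd-1)/2)^{-1}$ if $G_2\in\mathcal N(G_1)$, $Q_u(G_1,G_1)=-|\mathcal N(G_1)|/(nd(nd-1)/2)$, and $0$ otherwise. ${\rm Ent}_\pi(f)=\mathbb E_\pi[f(\log f-\log\mathbb E_\pi f)]$, $\mathcal E_\pi(\log f,f)=\frac12\sum_{G,G'}\pi(G)Q(G,G')(f(G)-f(G'))\log\frac{f(G)}{f(G')}$. *)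

theory Defs
  imports Complex_Main
begin

text \<open>A simple bipartite graph on left vertex set [n] and right vertex set [n]
  (both represented by {0..<n}) is a set of pairs (i, j): i a left vertex, j a right vertex.
  Being a set, it has no multiple edges.\<close>

type_synonym bgraph = "(nat \<times> nat) set"

definition bireg_graphs :: "nat \<Rightarrow> nat \<Rightarrow> bgraph set" where
  "bireg_graphs n d = {G. G \<subseteq> {0..<n} \<times> {0..<n}
      \<and> (\<forall>i<n. card {j. (i, j) \<in> G} = d)
      \<and> (\<forall>j<n. card {i. (i, j) \<in> G} = d)}"

definition switch_nbrs :: "nat \<Rightarrow> nat \<Rightarrow> bgraph \<Rightarrow> bgraph set" where
  "switch_nbrs n d G = {G'. G' \<in> bireg_graphs n d \<and>
      (\<exists>i1 j1 i2 j2. (i1, j1) \<in> G \<and> (i2, j2) \<in> G \<and> i1 \<noteq> i2 \<and> j1 \<noteq> j2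
         \<and> G' = (G - {(i1, j1), (i2, j2)}) \<union> {(i1, j2), (i2, j1)})}"

definition Q_u :: "nat \<Rightarrow> nat \<Rightarrow> bgraph \<Rightarrow> bgraph \<Rightarrow> real" where
  "Q_u n d G1 G2 =
     (if G2 \<in> switch_nbrs n d G1 then 1 / (real (n * d) * (real (n * d) - 1) / 2)
      else if G2 = G1 then - real (card (switch_nbrs n d G1)) / (real (n * d) * (real (n * d) - 1) / 2)
      else 0)"

definition pi_u :: "nat \<Rightarrow> nat \<Rightarrow> bgraph \<Rightarrow> real" where
  "pi_u n d G = (if G \<in> bireg_graphs n d then 1 / real (card (bireg_graphs n d)) else 0)"

definition expect_u :: "nat \<Rightarrow> nat \<Rightarrow> (bgraph \<Rightarrow> real) \<Rightarrow> real" where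
  "expect_u n d f = (\<Sum>G\<in>bireg_graphs n d. pi_u n d G * f G)"

definition Ent_u :: "nat \<Rightarrow> nat \<Rightarrow> (bgraph \<Rightarrow> real) \<Rightarrow> real" where
  "Ent_u n d f = expect_u n d (\<lambda>G. f G * (ln (f G) - ln (expect_u n d f)))"

definition Dirichlet_u :: "nat \<Rightarrow> nat \<Rightarrow> (bgraph \<Rightarrow> real) \<Rightarrow> real" where
  "Dirichlet_u n d f = 1/2 * (\<Sum>G\<in>bireg_graphs n d. \<Sum>G'\<in>bireg_graphs n d.
       pi_u n d G * Q_u n d G G' * (f G - f G') * ln (f G / f G'))"

end

theory Submission
  imports Defs
begin

text \<open>
  The graphs with left degrees \<open>d\<close> on \<open>m\<close> left vertices and arbitrary right degrees at most
  \<open>d\<close> satisfy the inequality with a constant of order \<open>1 / m\<close> (for unnormalised sums), by induction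
  on \<open>m\<close>: split the entropy along the neighbourhood of a left vertex \<open>v\<close>, use the induction
  hypothesis for the graphs without \<open>v\<close>, and average over \<open>v\<close>. It remains to bound the entropy of the
  conditional means by the switches at \<open>v\<close>. The neighbours of \<open>v\<close> are revealed one by one; for two
  candidates \<open>j\<close>, \<open>j'\<close> the graphs through \<open>(v, j)\<close> and through \<open>(v, j')\<close> are coupled by single
  switches. The coupling fails on a part of mass \<open>O(1/m)\<close>, namely where \<open>j\<close> and \<open>j'\<close> have a common
  neighbour; there \<open>(a - b) (ln a - ln b)\<close> has no triangle inequality, but after adding the global
  mean to the function it is at most \<open>O(log m)\<close> times \<open>(sqrt a - sqrt b)^2\<close>, which has one. One more
  random switch then moves the failing part back to a generic position, and its cost is of lower
  order because it is only paid by the vertices \<open>v\<close> near that switch.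
\<close>


section \<open>Subadditive distances between positive numbers\<close>

text \<open>Prescribing the right degrees one by one is what permits the deletion of a left vertex:
  removing \<open>v\<close> with neighbourhood \<open>S\<close> lowers the right degrees on
  \<open>S\<close> by one and leads to a class of the same kind. A switch involves two left vertices
  and survives m - 2 of the m possible deletions. Averaging the induction constant M / (m - 1)
  therefore produces M (m - 2) / (m - 1), which leaves a slack of order M / m. The price of the
  switches at \<open>v\<close> has exactly this order, so their coefficient must carry no logarithm.
  The factor ln m may only multiply switches that have a further factor 1/m, or the entropies
  themselves with coefficients tending to zero. The latter are absorbed on the left once m exceeds a
  threshold depending on \<open>d\<close>; below it, connectivity and a crude bound in terms of the
  number of graphs suffice.\<close>

definition phi :: "real \<Rightarrow> real \<Rightarrow> real" where
  "phi a b = (a - b) * (ln a - ln b)"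

text \<open>The squared Hellinger distance at one point, for unnormalised masses.\<close>

definition hel :: "real \<Rightarrow> real \<Rightarrow> real" where
  "hel a b = (sqrt a - sqrt b)\<^sup>2"

text \<open>Relative entropy density with the correction \<open>- a + u\<close>: it makes each
  single summand nonnegative and cancels in the sum when \<open>u\<close> is the mean.\<close>

definition psi :: "real \<Rightarrow> real \<Rightarrow> real" where
  "psi a u = a * (ln a - ln u) - a + u"

lemma phi_sym: "phi a b = phi b a"
  by (simp add: phi_def algebra_simps)

lemma phi_same [simp]: "phi a a = 0"
  by (simp add: phi_def)

lemma phi_nonneg: "0 < a \<Longrightarrow> 0 < b \<Longrightarrow> 0 \<le> phi a b"
  unfolding phi_def by (cases "a \<le> b") (auto intro: mult_nonneg_nonneg mult_nonpos_nonpos)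

text \<open>The log-sum inequality for two terms; each of the two logarithms is estimated by ln x <=
  x - 1 at the quotient of the ratios.\<close>

lemma log_sum2:
  assumes "0 < a" "0 < b" "0 < c" "0 < (e::real)"
  shows "(a + b) * (ln (a + b) - ln (c + e)) \<le> a * (ln a - ln c) + b * (ln b - ln e)"
proof -
  have *: "a * (ln (a + b) - ln (c + e) - (ln a - ln c)) \<le> c * (a + b) / (c + e) - a"
    if "0 < a" "0 < b" "0 < c" "0 < (e::real)" for a b c e
  proof -
    have "ln (a + b) - ln (c + e) - (ln a - ln c) = ln (c * (a + b) / (a * (c + e)))"
      using that by (simp add: ln_mult ln_div)
    also have "\<dots> \<le> c * (a + b) / (a * (c + e)) - 1"
      using that by (intro ln_le_minus_one) simp
    finally have "a * (ln (a + b) - ln (c + e) - (ln a - ln c)) \<le> a * (c * (a + b) / (a * (c + e)) - 1)"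
      using that by (intro mult_left_mono) auto
    also have "\<dots> = c * (a + b) / (c + e) - a"
    proof -
      have "a * (c * (a + b) / (a * (c + e))) = c * (a + b) / (c + e)"
        using that by simp
      then show ?thesis by (simp add: right_diff_distrib)
    qed
    finally show ?thesis .
  qed
  have "c * (a + b) / (c + e) + e * (b + a) / (e + c) = (c + e) * (a + b) / (c + e)"
    by (simp add: add_divide_distrib algebra_simps)
  also have "\<dots> = a + b" using assms by simp
  finally have "c * (a + b) / (c + e) + e * (b + a) / (e + c) = a + b" .
  then show ?thesis
    using *[OF assms] *[of b a e c] assms by (simp add: algebra_simps)
qed

text \<open>Log-sum inequality in both directions, because \<open>phi a c\<close> is the sum of the
  two relative entropies of \<open>a\<close> and \<open>c\<close>. Together with homogeneity it
  allows masses to be coupled piece by piece.\<close>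

lemma phi_add:
  assumes "0 < a" "0 < b" "0 < c" "0 < e"
  shows "phi (a + b) (c + e) \<le> phi a c + phi b e"
  using log_sum2[OF assms] log_sum2[of c e a b] assms
  by (simp add: phi_def algebra_simps)

lemma phi_add_sum:
  assumes "finite P" "0 < c" "0 < c'" "\<And>p. p \<in> P \<Longrightarrow> 0 < a p" "\<And>p. p \<in> P \<Longrightarrow> 0 < b p"
  shows "phi (c + sum a P) (c' + sum b P) \<le> phi c c' + (\<Sum>p\<in>P. phi (a p) (b p))"
  using assms
proof (induction P rule: finite_induct)
  case empty
  then show ?case by simp
next
  case (insert p P)
  have "phi (a p + (c + sum a P)) (b p + (c' + sum b P))
      \<le> phi (a p) (b p) + phi (c + sum a P) (c' + sum b P)"
    using insert by (intro phi_add add_pos_nonneg sum_nonneg) (auto intro: less_imp_le)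
  then show ?case using insert by (simp add: algebra_simps)
qed

lemma phi_shift: "0 < a \<Longrightarrow> 0 < b \<Longrightarrow> 0 < t \<Longrightarrow> phi (a + t) (b + t) \<le> phi a b"
  using phi_add[of a t b t] by simp

lemma phi_scale: "0 < k \<Longrightarrow> 0 < a \<Longrightarrow> 0 < b \<Longrightarrow> phi (k * a) (k * b) = k * phi a b"
  by (simp add: phi_def ln_mult algebra_simps)

lemma hel_nonneg [simp]: "0 \<le> hel a b"
  by (simp add: hel_def)

lemma hel_same [simp]: "hel a a = 0"
  by (simp add: hel_def)

lemma hel_sym: "hel a b = hel b a"
  by (simp add: hel_def power2_commute)

lemma hel_eq: "0 \<le> a \<Longrightarrow> 0 \<le> b \<Longrightarrow> hel a b = a + b - 2 * sqrt (a * b)"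
  by (simp add: hel_def power2_diff real_sqrt_mult)

lemma hel_triangle: "hel a c \<le> 2 * hel a b + 2 * hel b c"
proof -
  have "2 * hel a b + 2 * hel b c - hel a c = (sqrt a - 2 * sqrt b + sqrt c)\<^sup>2"
    by (simp add: hel_def power2_eq_square algebra_simps)
  then show ?thesis by (smt (verit) zero_le_power2)
qed

lemma hel_scale: "0 \<le> k \<Longrightarrow> hel (k * a) (k * b) = k * hel a b"
  by (simp add: hel_def real_sqrt_mult power_mult_distrib flip: right_diff_distrib)

text \<open>Cauchy-Schwarz: \<open>hel\<close> is the total mass minus twice the geometric mean, and
  geometric means are superadditive.\<close>

lemma hel_add:
  assumes "0 \<le> a" "0 \<le> b" "0 \<le> c" "0 \<le> e"
  shows "hel (a + b) (c + e) \<le> hel a c + hel b e"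
proof -
  have "(sqrt (a * c) + sqrt (b * e))\<^sup>2 \<le> (a + b) * (c + e)"
  proof -
    have "2 * (sqrt (a * e) * sqrt (b * c)) \<le> a * e + b * c"
      using sum_squares_bound[of "sqrt (a * e)" "sqrt (b * c)"] assms by simp
    moreover have "sqrt (a * c) * sqrt (b * e) = sqrt (a * e) * sqrt (b * c)"
      by (simp add: real_sqrt_mult)
    ultimately show ?thesis
      using assms by (simp add: power2_sum algebra_simps)
  qed
  then have "sqrt (a * c) + sqrt (b * e) \<le> sqrt ((a + b) * (c + e))"
    by (intro real_le_rsqrt)
  then show ?thesis using assms by (simp add: hel_eq)
qed

lemma hel_sum:
  assumes "\<And>p. p \<in> P \<Longrightarrow> 0 \<le> a p" "\<And>p. p \<in> P \<Longrightarrow> 0 \<le> b p"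
  shows "hel (sum a P) (sum b P) \<le> (\<Sum>p\<in>P. hel (a p) (b p))"
  using assms
proof (induction P rule: infinite_finite_induct)
  case (insert p P)
  have "hel (a p + sum a P) (b p + sum b P) \<le> hel (a p) (b p) + hel (sum a P) (sum b P)"
    using insert by (intro hel_add sum_nonneg) auto
  then show ?case using insert by simp
qed auto

lemma hel_shift: "0 \<le> a \<Longrightarrow> 0 \<le> b \<Longrightarrow> 0 \<le> t \<Longrightarrow> hel (a + t) (b + t) \<le> hel a b"
  using hel_add[of a t b t] by simp

text \<open>Subadditivity says nothing about differences. As at most half is removed,
  \<open>sqrt x1\<close> is at most \<open>sqrt 2\<close> times \<open>sqrt x\<close>, and likewise
  for \<open>e\<close>. Dividing the difference of the masses by \<open>sqrt x + sqrt e\<close>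
  therefore loses only constants.\<close>

lemma hel_diff:
  assumes "0 \<le> x2" "x2 \<le> x1 / 2" "0 \<le> e2" "e2 \<le> e1 / 2"
  shows "hel (x1 - x2) (e1 - e2) \<le> 4 * hel x1 e1 + 2 * hel x2 e2"
proof -
  define x e where "x = x1 - x2" and "e = e1 - e2"
  define q where "q = sqrt x + sqrt e"
  have x: "0 \<le> x" "x1 \<le> 2 * x" "x2 \<le> x" and e: "0 \<le> e" "e1 \<le> 2 * e" "e2 \<le> e"
    using assms by (auto simp: x_def e_def)
  have fac: "\<bar>s - t\<bar> = \<bar>sqrt s - sqrt t\<bar> * (sqrt s + sqrt t)" if "0 \<le> s" "0 \<le> t" for s t
  proof -
    have "(sqrt s - sqrt t) * (sqrt s + sqrt t) = s - t"
      using that by (simp add: algebra_simps)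
    then show ?thesis using that by (metis abs_mult abs_of_nonneg add_nonneg_nonneg real_sqrt_ge_zero)
  qed
  have s1: "sqrt x1 + sqrt e1 \<le> sqrt 2 * q"
    using real_sqrt_le_mono[OF x(2)] real_sqrt_le_mono[OF e(2)]
    by (simp add: q_def real_sqrt_mult algebra_simps)
  have s2: "sqrt x2 + sqrt e2 \<le> q"
    using real_sqrt_le_mono[OF x(3)] real_sqrt_le_mono[OF e(3)] unfolding q_def by linarith
  define d1 d2 where "d1 = \<bar>sqrt x1 - sqrt e1\<bar>" and "d2 = \<bar>sqrt x2 - sqrt e2\<bar>"
  have d: "0 \<le> d1" "0 \<le> d2" by (auto simp: d1_def d2_def)
  have "\<bar>sqrt x - sqrt e\<bar> * q = \<bar>x - e\<bar>"
    using fac[OF x(1) e(1)] by (simp add: q_def)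
  also have "\<dots> \<le> \<bar>x1 - e1\<bar> + \<bar>x2 - e2\<bar>" by (simp add: x_def e_def)
  also have "\<dots> = d1 * (sqrt x1 + sqrt e1) + d2 * (sqrt x2 + sqrt e2)"
    using fac[of x1 e1] fac[of x2 e2] assms by (simp add: d1_def d2_def)
  also have "\<dots> \<le> d1 * (sqrt 2 * q) + d2 * q"
    using s1 s2 d by (intro add_mono mult_left_mono)
  finally have "\<bar>sqrt x - sqrt e\<bar> * q \<le> (sqrt 2 * d1 + d2) * q" by (simp add: algebra_simps)
  then have "\<bar>sqrt x - sqrt e\<bar> \<le> sqrt 2 * d1 + d2"
  proof (cases "q = 0")
    case True
    then have "sqrt x = 0" "sqrt e = 0" using x e by (auto simp: q_def add_nonneg_eq_0_iff)
    then show ?thesis using d by simp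
  next
    case False
    then have "0 < q" using x e by (simp add: q_def order_less_le)
    then show ?thesis using \<open>\<bar>sqrt x - sqrt e\<bar> * q \<le> _\<close> by (simp add: mult_le_cancel_right)
  qed
  then have "hel x e \<le> (sqrt 2 * d1 + d2)\<^sup>2"
    unfolding hel_def by (metis abs_ge_zero power2_abs power_mono)
  also have "\<dots> \<le> 4 * d1\<^sup>2 + 2 * d2\<^sup>2"
  proof -
    have "0 \<le> (sqrt 2 * d1 - d2)\<^sup>2" by simp
    then show ?thesis by (simp add: power2_sum power2_diff power_mult_distrib)
  qed
  finally show ?thesis by (simp add: hel_def x_def e_def d1_def d2_def)
qed

lemma hel_le_psi:
  assumes "0 < a" "0 < u"
  shows "hel a u \<le> psi a u"
proof -
  define q where "q = sqrt u / sqrt a"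
  have "ln q \<le> q - 1"
    unfolding q_def using assms by (intro ln_le_minus_one) simp
  moreover have "ln q = (ln u - ln a) / 2"
    using assms by (simp add: q_def ln_div ln_sqrt)
  ultimately have "2 * (1 - q) \<le> ln a - ln u" by simp
  then have "a * (2 * (1 - q)) \<le> a * (ln a - ln u)"
    using assms by (intro mult_left_mono) auto
  moreover have "a * q = sqrt (a * u)"
    using assms by (simp add: q_def real_sqrt_mult field_simps)
  ultimately show ?thesis using assms by (simp add: hel_eq psi_def algebra_simps)
qed

text \<open>Converse of \<open>hel_le_psi\<close> for values at most \<open>n\<close> times the
  mean, which holds automatically for a uniform measure on \<open>n\<close> points. The intermediate
  quantity is the chi-square term.\<close>

lemma psi_le_hel:
  assumes "0 < a" "0 < u" "a \<le> n * u" "1 \<le> n"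
  shows "psi a u \<le> 4 * n * hel a u"
proof -
  have "ln a - ln u \<le> a / u - 1"
    using ln_le_minus_one[of "a / u"] assms by (simp add: ln_div)
  then have "a * (ln a - ln u) \<le> a * (a / u - 1)"
    using assms by (intro mult_left_mono) auto
  then have "psi a u \<le> (a - u)\<^sup>2 / u"
    using assms by (simp add: psi_def power2_eq_square field_simps)
  also have "(a - u)\<^sup>2 = hel a u * (sqrt a + sqrt u)\<^sup>2"
  proof -
    have "a - u = (sqrt a - sqrt u) * (sqrt a + sqrt u)" using assms by (simp add: algebra_simps)
    then show ?thesis by (simp add: hel_def power_mult_distrib)
  qed
  also have "hel a u * (sqrt a + sqrt u)\<^sup>2 / u \<le> hel a u * (4 * n * u) / u"
  proof -
    have "(sqrt a + sqrt u)\<^sup>2 \<le> 2 * a + 2 * u"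
      using assms sum_squares_bound[of "sqrt a" "sqrt u"] by (simp add: power2_sum)
    also have "\<dots> \<le> 4 * n * u" 
    proof -
      have "u \<le> n * u" using assms by simp
      then show ?thesis using assms by linarith
    qed
    finally show ?thesis using assms by (intro divide_right_mono mult_left_mono) auto
  qed
  finally show ?thesis using assms by (simp add: mult.commute)
qed

text \<open>With a = p^2, b = q^2 and l = ln p - ln q, \<open>phi\<close> is 2 l (p - q)^2 + 4 l q
  (p - q), and l q <= p - q. Only the first summand sees the ratio, hence the merely logarithmic
  dependence on \<open>R\<close>.\<close>

lemma phi_le_hel:
  assumes "0 < a" "0 < b" "a \<le> R * b" "b \<le> R * a"
  shows "phi a b \<le> (4 + ln R) * hel a b"
proof -
  have *: "phi a b \<le> (4 + ln R) * hel a b" if "0 < b" "b \<le> a" "a \<le> R * b" for a b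
  proof -
    define p q where "p = sqrt a" and "q = sqrt b"
    have pq: "0 < q" "q \<le> p" "a = p\<^sup>2" "b = q\<^sup>2" using that by (auto simp: p_def q_def)
    define l where "l = ln p - ln q"
    have l: "0 \<le> l" using pq by (simp add: l_def)
    have "ln (p / q) \<le> p / q - 1" using pq by (intro ln_le_minus_one) simp
    then have "l * q \<le> p - q" using pq by (simp add: l_def ln_div field_simps)
    then have "l * q * (p - q) \<le> (p - q) * (p - q)" using pq by (intro mult_right_mono) auto
    then have "(p\<^sup>2 - q\<^sup>2) * (2 * l) \<le> (4 + 2 * l) * (p - q)\<^sup>2"
      by (simp add: power2_eq_square algebra_simps)
    moreover have "phi a b = (p\<^sup>2 - q\<^sup>2) * (2 * l)"
      using pq by (simp add: phi_def l_def ln_realpow algebra_simps)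
    moreover have "hel a b = (p - q)\<^sup>2" by (simp add: hel_def p_def q_def)
    moreover have "2 * l \<le> ln R"
    proof -
      have "2 * l = ln (a / b)" using pq by (simp add: l_def ln_realpow ln_div)
      also have "\<dots> \<le> ln R" using that by (intro ln_mono) (auto simp: pos_divide_le_eq)
      finally show ?thesis .
    qed
    ultimately show ?thesis
      by (metis add_le_cancel_left mult_right_mono order_trans zero_le_power2)
  qed
  show ?thesis
    using *[of b a] *[of a b] assms by (cases "b \<le> a") (auto simp: phi_sym hel_sym)
qed

lemma hel_le_phi:
  assumes "0 < a" "0 < b"
  shows "hel a b \<le> phi a b"
proof -
  have *: "hel a b \<le> phi a b" if "0 < b" "b \<le> a" for a b
  proof -
    have "ln (a / b) \<le> a / b - 1" using that by (intro ln_le_minus_one) simp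
    then have "b * (ln a - ln b) \<le> a - b" using that by (simp add: ln_div field_simps)
    then have "psi a b \<le> phi a b" by (simp add: psi_def phi_def algebra_simps)
    then show ?thesis using hel_le_psi[of a b] that by simp
  qed
  show ?thesis
    using *[of b a] *[of a b] assms by (cases "b \<le> a") (auto simp: phi_sym hel_sym)
qed

text \<open>Adding the mean to the function costs only a constant factor in entropy, and bounds all
  values from below by the old mean. Near the mean both sides are quadratic; beyond 7 u both sides
  are large and the right one is at least (a + u) / 4 up to the factor 20.\<close>

lemma psi_shift_bound:
  assumes "0 < a" "0 < u"
  shows "psi a u \<le> 20 * psi (a + u) (2 * u)"
proof (cases "a \<le> 7 * u")
  case True
  have "ln a - ln u \<le> a / u - 1"
    using ln_le_minus_one[of "a / u"] assms by (simp add: ln_div)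
  then have "a * (ln a - ln u) \<le> a * (a / u - 1)"
    using assms by (intro mult_left_mono) auto
  then have "psi a u \<le> (a - u)\<^sup>2 / u"
    using assms by (simp add: psi_def power2_eq_square field_simps)
  also have "(a - u)\<^sup>2 = hel (a + u) (2 * u) * (sqrt (a + u) + sqrt (2 * u))\<^sup>2"
  proof -
    have "a - u = (sqrt (a + u) - sqrt (2 * u)) * (sqrt (a + u) + sqrt (2 * u))"
      using assms by (simp add: algebra_simps flip: real_sqrt_mult)
    then show ?thesis by (simp add: hel_def power_mult_distrib)
  qed
  also have "\<dots> / u \<le> hel (a + u) (2 * u) * (20 * u) / u"
  proof -
    have "(sqrt (a + u) + sqrt (2 * u))\<^sup>2 \<le> 2 * (a + u) + 2 * (2 * u)"
      using assms sum_squares_bound[of "sqrt (a + u)" "sqrt (2 * u)"] by (simp add: power2_sum)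
    then show ?thesis using assms True by (intro divide_right_mono mult_left_mono) auto
  qed
  also have "\<dots> \<le> 20 * psi (a + u) (2 * u)"
    using hel_le_psi[of "a + u" "2 * u"] assms by simp
  finally show ?thesis .
next
  case False
  have "sqrt (4 * (2 * u)) \<le> sqrt (a + u)" using False by (intro real_sqrt_le_mono) auto
  moreover have "sqrt (4 * (2 * u)) = 2 * sqrt (2 * u)"
    by (simp only: real_sqrt_mult real_sqrt_four)
  ultimately have "2 * sqrt (2 * u) \<le> sqrt (a + u)" by linarith
  then have "(sqrt (a + u) / 2)\<^sup>2 \<le> hel (a + u) (2 * u)"
    unfolding hel_def using assms by (intro power_mono) auto
  then have "(a + u) / 4 \<le> psi (a + u) (2 * u)"
    using hel_le_psi[of "a + u" "2 * u"] assms by (simp add: power_divide)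
  moreover have "psi a u \<le> psi (a + u) (2 * u) + (a + u)"
  proof -
    have "ln a \<le> ln (a + u)" using assms by simp
    then have "a * ln a \<le> a * ln (a + u)" using assms by (intro mult_left_mono) auto
    moreover have "0 \<le> u * (ln (a + u) - ln (2 * u))" using assms False by (intro mult_nonneg_nonneg) auto
    moreover have "a * ln 2 \<le> a * 1" using assms ln_2_less_1 by (intro mult_left_mono) auto
    moreover have l: "ln (2 * u) = ln 2 + ln u" using assms by (simp add: ln_mult)
    ultimately show ?thesis
      using assms by (simp only: psi_def l distrib_left distrib_right right_diff_distrib left_diff_distrib)
  qed
  ultimately have "psi a u \<le> 5 * psi (a + u) (2 * u)" "0 \<le> psi (a + u) (2 * u)"
    using assms by auto
  then show ?thesis by simp
qed

text \<open>The entropy is at most the covariance of \<open>F\<close> and \<open>ln F\<close>, by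
  Jensen applied to the logarithm; the covariance is then written as a sum over pairs.\<close>

lemma psi_sum_le_phi_sum:
  fixes w F :: "'a \<Rightarrow> real"
  assumes "finite J" "\<And>j. j \<in> J \<Longrightarrow> 0 < w j" "\<And>j. j \<in> J \<Longrightarrow> 0 < F j"
    and W: "W = sum w J" "0 < W" and u: "W * u = (\<Sum>j\<in>J. w j * F j)" "0 < u"
  shows "(\<Sum>j\<in>J. w j * psi (F j) u) \<le> (\<Sum>j\<in>J. \<Sum>k\<in>J. w j * w k * phi (F j) (F k)) / (2 * W)"
proof -
  define X Y Z where "X = (\<Sum>j\<in>J. w j * (F j * ln (F j)))" and "Y = (\<Sum>j\<in>J. w j * ln (F j))"
    and "Z = (\<Sum>j\<in>J. w j * F j)"
  have "(\<Sum>j\<in>J. w j * (ln (F j) - ln u)) \<le> (\<Sum>j\<in>J. w j * (F j / u - 1))"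
  proof (intro sum_mono mult_left_mono)
    fix j assume "j \<in> J"
    then show "ln (F j) - ln u \<le> F j / u - 1"
      using ln_le_minus_one[of "F j / u"] assms(3)[of j] u by (simp add: ln_div)
    show "0 \<le> w j" using assms(2)[OF \<open>j \<in> J\<close>] by simp
  qed
  also have "\<dots> = Z / u - W"
    by (simp add: Z_def W right_diff_distrib sum_subtractf sum_divide_distrib)
  also have "\<dots> = 0" using u by (simp add: Z_def flip: u(1))
  finally have "Y \<le> W * ln u"
    by (simp add: Y_def W right_diff_distrib sum_subtractf sum_distrib_right)
  then have "Z * Y \<le> Z * (W * ln u)"
    using assms by (intro mult_left_mono) (auto simp: Z_def less_imp_le intro!: sum_nonneg mult_nonneg_nonneg)
  moreover have "(\<Sum>j\<in>J. \<Sum>k\<in>J. w j * w k * phi (F j) (F k)) = 2 * W * X - 2 * Z * Y"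
  proof -
    have "(\<Sum>j\<in>J. \<Sum>k\<in>J. w j * w k * phi (F j) (F k))
      = (\<Sum>j\<in>J. \<Sum>k\<in>J. (w j * (F j * ln (F j))) * w k + w j * (w k * (F k * ln (F k)))
          - (w j * F j) * (w k * ln (F k)) - (w j * ln (F j)) * (w k * F k))"
      by (intro sum.cong) (auto simp: phi_def algebra_simps)
    also have "\<dots> = X * W + W * X - Z * Y - Y * Z"
      unfolding X_def Y_def Z_def W by (simp add: sum.distrib sum_subtractf sum_product)
    finally show ?thesis by simp
  qed
  moreover have P: "(\<Sum>j\<in>J. w j * psi (F j) u) = X - Z * ln u"
  proof -
    have "(\<Sum>j\<in>J. w j * psi (F j) u) = X - Z * ln u - Z + W * u"
      unfolding X_def Z_def W psi_def sum_distrib_right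
      by (simp add: sum.distrib sum_subtractf algebra_simps)
    then show ?thesis using u by (simp add: Z_def)
  qed
  ultimately have "(\<Sum>j\<in>J. w j * psi (F j) u) * (2 * W) \<le> (\<Sum>j\<in>J. \<Sum>k\<in>J. w j * w k * phi (F j) (F k))"
    unfolding P by (simp add: algebra_simps)
  then show ?thesis using W(2) by (simp add: pos_le_divide_eq)
qed

text \<open>Coupling two averages along a partial matching of weight \<open>w\<close>; the unmatched parts
  only enter through the Hellinger distance, because the shift by \<open>u\<close> keeps their ratio bounded.\<close>

lemma phi_partial_coupling:
  fixes f :: "'a \<Rightarrow> real" and g g' :: "'p \<Rightarrow> 'a" and w u eps R x x' :: real
  assumes fin: "finite X" "finite X'" "finite P" and ne: "X \<noteq> {}" "X' \<noteq> {}"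
    and g: "\<And>p. p \<in> P \<Longrightarrow> g p \<in> X" "\<And>p. p \<in> P \<Longrightarrow> g' p \<in> X'"
    and f: "\<And>x. x \<in> X \<Longrightarrow> 0 < f x" "\<And>x. x \<in> X' \<Longrightarrow> 0 < f x"
    and w: "0 \<le> w" and u: "0 < u"
    and lam: "\<And>x. x \<in> X \<Longrightarrow> 0 \<le> 1 / card X - w * card {p \<in> P. g p = x}"
      "\<And>x. x \<in> X' \<Longrightarrow> 0 \<le> 1 / card X' - w * card {p \<in> P. g' p = x}"
    and eps: "eps = 1 - w * card P" "0 < eps"
    and ratio: "sum f X / card X \<le> R * (eps * u)" "sum f X' / card X' \<le> R * (eps * u)"
    and x: "x = (\<Sum>G\<in>X. (1 / card X - w * card {p \<in> P. g p = G}) * f G)"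
      "x' = (\<Sum>G\<in>X'. (1 / card X' - w * card {p \<in> P. g' p = G}) * f G)"
  shows "phi (sum f X / card X + u) (sum f X' / card X' + u)
     \<le> w * (\<Sum>p\<in>P. phi (f (g p)) (f (g' p)))
       + 2 * (4 + ln (1 + R)) * (hel x (eps * u) + hel x' (eps * u))"
proof -
  have f0: "\<And>x. x \<in> X \<Longrightarrow> 0 \<le> f x" "\<And>x. x \<in> X' \<Longrightarrow> 0 \<le> f x"
    using f by (auto intro: less_imp_le)
  have fib: "(\<Sum>G\<in>Y. real (card {p \<in> P. h p = G}) * f G) = (\<Sum>p\<in>P. f (h p))"
    if "finite Y" "\<And>p. p \<in> P \<Longrightarrow> h p \<in> Y" for Y and h :: "'p \<Rightarrow> 'a"
  proof -
    have "(\<Sum>p\<in>P. f (h p)) = (\<Sum>G\<in>Y. \<Sum>p\<in>{p \<in> P. h p = G}. f (h p))"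
      using that fin by (intro sum.group[symmetric]) auto
    also have "\<dots> = (\<Sum>G\<in>Y. real (card {p \<in> P. h p = G}) * f G)"
      by (intro sum.cong) auto
    finally show ?thesis by simp
  qed
  have dec: "sum f Y / card Y = (\<Sum>G\<in>Y. (1 / card Y - w * card {p \<in> P. h p = G}) * f G) + (\<Sum>p\<in>P. w * f (h p))"
    if "finite Y" "\<And>p. p \<in> P \<Longrightarrow> h p \<in> Y" for Y and h :: "'p \<Rightarrow> 'a"
    using fib[OF that] by (simp add: left_diff_distrib sum_subtractf sum_divide_distrib mult.assoc flip: sum_distrib_left)
  have x0: "0 \<le> x" "0 \<le> x'"
    unfolding x using f0 lam by (auto intro!: sum_nonneg mult_nonneg_nonneg)
  have le: "x \<le> sum f X / card X" "x' \<le> sum f X' / card X'"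
    using dec[OF fin(1) g(1)] dec[OF fin(2) g(2)] f0 g w
    by (auto simp: x intro!: sum_nonneg mult_nonneg_nonneg)
  \<comment> \<open>The shift is distributed like the mass: \<open>w * u\<close> goes to each
    matched pair and \<open>eps * u\<close> to the unmatched remainder, which is thereby bounded
    away from zero.\<close>
  have sp: "(\<Sum>p\<in>P. w * u) + eps * u = u" by (simp add: eps algebra_simps)
  have eu: "0 < eps * u" using eps u by simp
  have pw: "(\<Sum>p\<in>P. phi (w * (f (g p) + u)) (w * (f (g' p) + u))) \<le> w * (\<Sum>p\<in>P. phi (f (g p)) (f (g' p)))"
    unfolding sum_distrib_left
  proof (intro sum_mono)
    fix p assume p: "p \<in> P"
    show "phi (w * (f (g p) + u)) (w * (f (g' p) + u)) \<le> w * phi (f (g p)) (f (g' p))"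
    proof (cases "w = 0")
      case False
      then have "phi (w * (f (g p) + u)) (w * (f (g' p) + u)) = w * phi (f (g p) + u) (f (g' p) + u)"
        using w u f g p by (intro phi_scale add_pos_pos) auto
      also have "\<dots> \<le> w * phi (f (g p)) (f (g' p))"
        using w u f g p by (intro mult_left_mono phi_shift) auto
      finally show ?thesis .
    qed (simp add: phi_def)
  qed
  have A: "phi (sum f X / card X + u) (sum f X' / card X' + u)
     \<le> phi (x + eps * u) (x' + eps * u) + w * (\<Sum>p\<in>P. phi (f (g p)) (f (g' p)))"
  proof (cases "w = 0")
    case True
    then show ?thesis using eps by (simp add: x sum_divide_distrib)
  next
    case False
    then have wp: "0 < w" using w by simp
    have e1: "sum f X / card X + u = (x + eps * u) + (\<Sum>p\<in>P. w * (f (g p) + u))"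
      using dec[OF fin(1) g(1)] sp by (simp add: x sum.distrib distrib_left)
    have e2: "sum f X' / card X' + u = (x' + eps * u) + (\<Sum>p\<in>P. w * (f (g' p) + u))"
      using dec[OF fin(2) g(2)] sp by (simp add: x sum.distrib distrib_left)
    have "phi ((x + eps * u) + (\<Sum>p\<in>P. w * (f (g p) + u))) ((x' + eps * u) + (\<Sum>p\<in>P. w * (f (g' p) + u)))
       \<le> phi (x + eps * u) (x' + eps * u) + (\<Sum>p\<in>P. phi (w * (f (g p) + u)) (w * (f (g' p) + u)))"
    proof (intro phi_add_sum)
      fix p assume "p \<in> P"
      then show "0 < w * (f (g p) + u)" "0 < w * (f (g' p) + u)"
        using wp f g u by (auto intro!: mult_pos_pos add_pos_pos)
    qed (use fin x0 eu in auto)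
    then show ?thesis unfolding e1 e2 using pw by linarith
  qed
  have R0: "0 \<le> R"
  proof -
    have "0 < sum f X / card X" using fin ne f by (intro divide_pos_pos sum_pos) (auto simp: card_gt_0_iff)
    then have "0 < R * (eps * u)" using ratio by linarith
    then show ?thesis using eu by (simp add: zero_less_mult_iff)
  qed
  \<comment> \<open>Both shifted remainders lie between \<open>eps * u\<close> and
    \<open>(1 + R) * (eps * u)\<close>, so \<open>phi\<close> may be replaced by \<open>hel\<close>;
    the triangle inequality through \<open>eps * u\<close> then separates the two sides.\<close>
  have "phi (x + eps * u) (x' + eps * u) \<le> (4 + ln (1 + R)) * hel (x + eps * u) (x' + eps * u)"
  proof (rule phi_le_hel)
    show "0 < x + eps * u" "0 < x' + eps * u" using x0 eu by auto
    have "0 \<le> (1 + R) * x" "0 \<le> (1 + R) * x'" using R0 x0 by auto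
    then show "x + eps * u \<le> (1 + R) * (x' + eps * u)" "x' + eps * u \<le> (1 + R) * (x + eps * u)"
      using le ratio by (auto simp: algebra_simps)
  qed
  also have "\<dots> \<le> (4 + ln (1 + R)) * (2 * hel x (eps * u) + 2 * hel x' (eps * u))"
  proof (intro mult_left_mono)
    show "hel (x + eps * u) (x' + eps * u) \<le> 2 * hel x (eps * u) + 2 * hel x' (eps * u)"
      using hel_shift[OF x0, of "eps * u"] hel_triangle[of x x' "eps * u"] eu by (simp add: hel_sym)
    show "0 \<le> 4 + ln (1 + R)" using R0 by (intro add_nonneg_nonneg) auto
  qed
  finally show ?thesis using A by (simp add: algebra_simps)
qed

text \<open>The part \<open>al\<close> of the uniform average pays for the points that \<open>g'\<close> hits fewer than \<open>T\<close> times.\<close>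

lemma hel_transport:
  fixes f :: "'a \<Rightarrow> real" and g g' :: "'p \<Rightarrow> 'a" and w u T al :: real
  assumes fin: "finite X" "finite Q" and ne: "X \<noteq> {}"
    and g: "\<And>q. q \<in> Q \<Longrightarrow> g q \<in> X" "\<And>q. q \<in> Q \<Longrightarrow> g' q \<in> X"
    and f: "\<And>x. x \<in> X \<Longrightarrow> 0 < f x" and w: "0 \<le> w" and u: "0 < u"
    and T: "\<And>x. x \<in> X \<Longrightarrow> real (card {q \<in> Q. g' q = x}) \<le> T"
    and al: "2 * w * T * card X \<le> al"
  shows "hel (al * (sum f X / card X) + w * (\<Sum>q\<in>Q. f (g q))) ((al + w * card Q) * u)
    \<le> 2 * w * (\<Sum>q\<in>Q. hel (f (g q)) (f (g' q))) + 5 * al / card X * hel (sum f X) (card X * u)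
      + 2 * w * (\<Sum>x\<in>X. (T - card {q \<in> Q. g' q = x}) * hel (f x) u)"
proof -
  have f0: "\<And>x. x \<in> X \<Longrightarrow> 0 \<le> f x"
    using f by (auto intro: less_imp_le)
  define N where "N = real (card X)"
  have N: "0 < N" using fin ne by (simp add: N_def card_gt_0_iff)
  define n where "n = (\<lambda>x. real (card {q \<in> Q. g' q = x}))"
  define s where "s = sum f X"
  have s0: "0 \<le> s" unfolding s_def using f0 by (intro sum_nonneg)
  have T0: "0 \<le> T" using ne T order_trans of_nat_0_le_iff by (metis ex_in_conv)
  have al0: "0 \<le> al" using al w T0 by (meson mult_nonneg_nonneg of_nat_0_le_iff order_trans zero_le_numeral)
  have fib: "(\<Sum>x\<in>X. n x * h x) = (\<Sum>q\<in>Q. h (g' q))" for h :: "'a \<Rightarrow> real"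
  proof -
    have "(\<Sum>q\<in>Q. h (g' q)) = (\<Sum>x\<in>X. \<Sum>q\<in>{q \<in> Q. g' q = x}. h (g' q))"
      using g fin by (intro sum.group[symmetric]) auto
    also have "\<dots> = (\<Sum>x\<in>X. n x * h x)" by (intro sum.cong) (auto simp: n_def)
    finally show ?thesis by simp
  qed
  \<comment> \<open>\<open>z\<close> is the mass missing from the image of \<open>Q\<close> under
    \<open>g'\<close> until every point carries the same weight \<open>w * T\<close>. It is borrowed
    from the uniform part, which by \<open>al\<close> holds at least twice as much.\<close>
  define z where "z = (\<Sum>x\<in>X. w * (T - n x) * f x)"
  define ez where "ez = (\<Sum>x\<in>X. w * (T - n x))"
  have wn: "0 \<le> w * (T - n x)" if "x \<in> X" for x using T[OF that] w by (simp add: n_def)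
  have ez: "ez = w * T * N - w * card Q"
    using fib[of "\<lambda>_. 1"] by (simp add: ez_def N_def sum_subtractf right_diff_distrib algebra_simps flip: sum_distrib_left)
  have wQ: "0 \<le> w * card Q" using w by simp
  have z: "z = w * T * s - w * (\<Sum>q\<in>Q. f (g' q))"
    using fib[of f] by (simp add: z_def s_def sum_subtractf algebra_simps flip: sum_distrib_left)
  have n0: "0 \<le> n x" for x by (simp add: n_def)
  have z0: "0 \<le> z" "0 \<le> ez" unfolding z_def ez_def using wn f0 by (auto intro!: sum_nonneg simp: mult_nonneg_nonneg[OF wn])
  have zle: "z \<le> w * T * s" unfolding z using w f0 g by (auto intro!: sum_nonneg mult_nonneg_nonneg)
  have wTN: "w * T * N \<le> al / 2" using al by (simp add: N_def)
  have "hel (al * (s / N) - z) (al * u - ez * u) \<le> 4 * hel (al * (s / N)) (al * u) + 2 * hel z (ez * u)"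
  proof (rule hel_diff)
    have "z * N \<le> (w * T * N) * s" using zle N by (simp add: mult_right_mono algebra_simps)
    also have "\<dots> \<le> al / 2 * s" using wTN s0 by (intro mult_right_mono)
    finally show "z \<le> al * (s / N) / 2" using N by (simp add: field_simps)
    have "ez \<le> al / 2" using ez wTN wQ by linarith
    then show "ez * u \<le> al * u / 2" using u by simp
  qed (use z0 u in auto)
  moreover have "hel (al * (s / N)) (al * u) = al / N * hel s (N * u)"
    using hel_scale[of "al / N" s "N * u"] al0 N by simp
  moreover have "hel z (ez * u) \<le> w * (\<Sum>x\<in>X. (T - n x) * hel (f x) u)"
  proof -
    have "hel z (ez * u) \<le> (\<Sum>x\<in>X. hel (w * (T - n x) * f x) (w * (T - n x) * u))"
      unfolding z_def ez_def sum_distrib_right using wn f0 u less_imp_le[OF u]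
      by (intro hel_sum) (auto intro!: mult_nonneg_nonneg)
    also have "\<dots> = (\<Sum>x\<in>X. w * ((T - n x) * hel (f x) u))"
      using hel_scale[OF wn] by (intro sum.cong) (simp_all add: mult.assoc)
    finally show ?thesis by (simp add: sum_distrib_left)
  qed
  ultimately have A: "hel (al * (s / N) - z) (al * u - ez * u)
      \<le> 4 * al / N * hel s (N * u) + 2 * w * (\<Sum>x\<in>X. (T - n x) * hel (f x) u)" by simp
  have B: "hel (w * (\<Sum>q\<in>Q. f (g q)) + z) (w * T * s) \<le> w * (\<Sum>q\<in>Q. hel (f (g q)) (f (g' q)))"
  proof -
    have "hel (w * (\<Sum>q\<in>Q. f (g q)) + z) (w * T * s)
        \<le> hel (w * (\<Sum>q\<in>Q. f (g q))) (w * (\<Sum>q\<in>Q. f (g' q))) + hel z z"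
      using hel_add[of "w * (\<Sum>q\<in>Q. f (g q))" z "w * (\<Sum>q\<in>Q. f (g' q))" z] z z0 w f0 g
      by (auto intro!: sum_nonneg mult_nonneg_nonneg)
    also have "\<dots> = w * hel (\<Sum>q\<in>Q. f (g q)) (\<Sum>q\<in>Q. f (g' q))" using w by (simp add: hel_scale)
    also have "\<dots> \<le> w * (\<Sum>q\<in>Q. hel (f (g q)) (f (g' q)))"
      using w f0 g by (intro mult_left_mono hel_sum) (auto intro:)
    finally show ?thesis .
  qed
  have C: "hel (w * T * s) (w * T * N * u) \<le> al / (2 * N) * hel s (N * u)"
  proof -
    have "hel (w * T * s) (w * T * N * u) = w * T * hel s (N * u)"
      using hel_scale[of "w * T" s "N * u"] w T0 by (simp add: mult.assoc)
    also have "\<dots> \<le> al / (2 * N) * hel s (N * u)"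
      using wTN N by (intro mult_right_mono) (auto simp: field_simps)
    finally show ?thesis .
  qed
  have D: "hel (w * (\<Sum>q\<in>Q. f (g q)) + z) (w * T * N * u)
      \<le> 2 * w * (\<Sum>q\<in>Q. hel (f (g q)) (f (g' q))) + al / N * hel s (N * u)"
    using B C hel_triangle[of "w * (\<Sum>q\<in>Q. f (g q)) + z" "w * T * N * u" "w * T * s"] by simp
  have "hel (al * (s / N) + w * (\<Sum>q\<in>Q. f (g q))) ((al + w * card Q) * u)
     \<le> hel (al * (s / N) - z) (al * u - ez * u) + hel (w * (\<Sum>q\<in>Q. f (g q)) + z) (w * T * N * u)"
  proof -
    have e: "(al + w * card Q) * u = (al * u - ez * u) + w * T * N * u"
      by (simp add: ez algebra_simps)
    have "z * N \<le> (w * T * N) * s" using zle N by (simp add: mult_right_mono algebra_simps)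
    also have "\<dots> \<le> al * s" using wTN s0 al0 by (intro mult_right_mono) auto
    finally have a: "0 \<le> al * (s / N) - z" using N by (simp add: field_simps)
    have "ez \<le> al" using ez wTN wQ al0 by linarith
    then have b: "0 \<le> al * u - ez * u" using u by simp
    have c: "0 \<le> w * (\<Sum>q\<in>Q. f (g q)) + z" "0 \<le> w * T * N * u"
      using w f0 g z0 T0 N less_imp_le[OF u] by (auto intro!: add_nonneg_nonneg sum_nonneg mult_nonneg_nonneg)
    show ?thesis using hel_add[OF a c(1) b c(2)] unfolding e by simp
  qed
  \<comment> \<open>The later factor 5 is 4 from \<open>hel_diff\<close> in \<open>A\<close> and 1
    from \<open>C\<close>, whose half is doubled by the triangle inequality.\<close>
  then have "hel (al * (s / N) + w * (\<Sum>q\<in>Q. f (g q))) ((al + w * card Q) * u)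
    \<le> 2 * w * (\<Sum>q\<in>Q. hel (f (g q)) (f (g' q))) + (4 * al / N + al / N) * hel s (N * u)
      + 2 * w * (\<Sum>x\<in>X. (T - n x) * hel (f x) u)"
    using A D by (simp add: distrib_right)
  then show ?thesis by (simp add: s_def N_def n_def add_divide_distrib[symmetric])
qed

lemma psi_scale: "0 < k \<Longrightarrow> 0 < x \<Longrightarrow> 0 < y \<Longrightarrow> psi (k * x) (k * y) = k * psi x y"
  by (simp add: psi_def ln_mult algebra_simps)

lemma sum_le_inj:
  fixes x :: "'a \<Rightarrow> real" and y :: "'b \<Rightarrow> real"
  assumes "inj_on \<phi> S" "\<phi> ` S \<subseteq> T" "finite T" "\<And>t. t \<in> T \<Longrightarrow> 0 \<le> y t" "\<And>p. p \<in> S \<Longrightarrow> x p \<le> y (\<phi> p)"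
  shows "sum x S \<le> sum y T"
proof -
  have "sum x S \<le> (\<Sum>p\<in>S. y (\<phi> p))" using assms(5) by (intro sum_mono)
  also have "\<dots> = sum y (\<phi> ` S)" using sum.reindex[OF assms(1), of y] by simp
  also have "\<dots> \<le> sum y T" using assms by (intro sum_mono2) auto
  finally show ?thesis .
qed

section \<open>Graphs with prescribed degrees and switches\<close>

definition row :: "bgraph \<Rightarrow> nat \<Rightarrow> nat set" where
  "row G i = {j. (i, j) \<in> G}"

definition col :: "bgraph \<Rightarrow> nat \<Rightarrow> nat set" where
  "col G j = {i. (i, j) \<in> G}"

text \<open>Right vertices are not listed: a right vertex is absent when \<open>r j = 0\<close>.
  Finiteness is demanded because \<open>card\<close> is 0 on infinite sets.\<close>

definition graphs :: "nat \<Rightarrow> nat set \<Rightarrow> (nat \<Rightarrow> nat) \<Rightarrow> bgraph set" where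
  "graphs d L r = {G. finite G \<and> fst ` G \<subseteq> L \<and> (\<forall>i\<in>L. card (row G i) = d) \<and> (\<forall>j. card (col G j) = r j)}"

definition switch :: "bgraph \<Rightarrow> nat \<Rightarrow> nat \<Rightarrow> nat \<Rightarrow> nat \<Rightarrow> bgraph" where
  "switch G i k i' k' = (G - {(i, k), (i', k')}) \<union> {(i, k'), (i', k)}"

definition legal :: "bgraph \<Rightarrow> nat \<Rightarrow> nat \<Rightarrow> nat \<Rightarrow> nat \<Rightarrow> bool" where
  "legal G i k i' k' \<longleftrightarrow> (i, k) \<in> G \<and> (i', k') \<in> G \<and> (i, k') \<notin> G \<and> (i', k) \<notin> G"

text \<open>Quadruples are ordered, so the same exchange occurs twice, once with each of its two
  left vertices in first position.\<close>

definition switches :: "bgraph \<Rightarrow> (nat \<times> nat \<times> nat \<times> nat) set" where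
  "switches G = {(i, k, i', k'). legal G i k i' k'}"

definition dirichlet :: "bgraph set \<Rightarrow> (bgraph \<Rightarrow> real) \<Rightarrow> real" where
  "dirichlet X f = (\<Sum>G\<in>X. \<Sum>(i, k, i', k')\<in>switches G. phi (f G) (f (switch G i k i' k')))"

text \<open>Unnormalised, so that entropy decompositions become plain differences of sums, in which
  empty sets contribute zero.\<close>

definition mean_ent :: "'a set \<Rightarrow> ('a \<Rightarrow> real) \<Rightarrow> real" where
  "mean_ent X f = sum f X * ln (sum f X / card X)"

definition ent :: "'a set \<Rightarrow> ('a \<Rightarrow> real) \<Rightarrow> real" where
  "ent X f = (\<Sum>x\<in>X. f x * ln (f x)) - mean_ent X f"

lemma ent_eq_psi:
  assumes "finite X" "X \<noteq> {}" "\<And>x. x \<in> X \<Longrightarrow> 0 < f x" and u: "u = sum f X / card X"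
  shows "ent X f = (\<Sum>x\<in>X. psi (f x) u)"
proof -
  have "(\<Sum>x\<in>X. psi (f x) u) = (\<Sum>x\<in>X. f x * ln (f x)) - sum f X * ln u - sum f X + card X * u"
    by (simp add: psi_def sum.distrib sum_subtractf right_diff_distrib sum_distrib_right)
  then show ?thesis using assms by (simp add: ent_def mean_ent_def)
qed

lemma hel_sum_le_ent:
  assumes "finite X" "X \<noteq> {}" "\<And>x. x \<in> X \<Longrightarrow> 0 < f x" and u: "u = sum f X / card X"
  shows "(\<Sum>x\<in>X. hel (f x) u) \<le> ent X f"
proof -
  have "0 < u" unfolding u using assms by (intro divide_pos_pos sum_pos) (auto simp: card_gt_0_iff)
  then have "(\<Sum>x\<in>X. hel (f x) u) \<le> (\<Sum>x\<in>X. psi (f x) u)"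
    using assms(3) by (intro sum_mono hel_le_psi) auto
  then show ?thesis using ent_eq_psi[OF assms] by simp
qed

lemma ent_nonneg:
  assumes "finite X" "\<And>x. x \<in> X \<Longrightarrow> 0 < f x"
  shows "0 \<le> ent X f"
proof (cases "X = {}")
  case False
  have "0 \<le> (\<Sum>x\<in>X. hel (f x) (sum f X / card X))" by (intro sum_nonneg) simp
  also have "\<dots> \<le> ent X f" using assms False by (intro hel_sum_le_ent) auto
  finally show ?thesis .
qed (simp add: ent_def mean_ent_def)

lemma legal_neq: "legal G i k i' k' \<Longrightarrow> i \<noteq> i' \<and> k \<noteq> k'"
  by (auto simp: legal_def)

lemma legal_switch: "legal G i k i' k' \<Longrightarrow> legal (switch G i k i' k') i k' i' k"
  by (auto simp: legal_def switch_def)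

lemma switch_switch: "legal G i k i' k' \<Longrightarrow> switch (switch G i k i' k') i k' i' k = G"
  by (auto simp: legal_def switch_def)

lemma row_switch:
  assumes "legal G i k i' k'"
  shows "row (switch G i k i' k') a =
    (if a = i then insert k' (row G i - {k}) else if a = i' then insert k (row G i' - {k'}) else row G a)"
  using assms by (auto simp: row_def switch_def legal_def)

lemma col_switch:
  assumes "legal G i k i' k'"
  shows "col (switch G i k i' k') b =
    (if b = k then insert i' (col G k - {i}) else if b = k' then insert i (col G k' - {i'}) else col G b)"
  using assms by (auto simp: col_def switch_def legal_def)

lemma row_iff: "j \<in> row G i \<longleftrightarrow> (i, j) \<in> G"
  by (simp add: row_def)

lemma col_iff: "i \<in> col G j \<longleftrightarrow> (i, j) \<in> G"
  by (simp add: col_def)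

lemma finite_row: "finite G \<Longrightarrow> finite (row G i)"
  by (rule finite_subset[of _ "snd ` G"]) (force simp: row_def)+

lemma finite_col: "finite G \<Longrightarrow> finite (col G j)"
  by (rule finite_subset[of _ "fst ` G"]) (force simp: col_def)+

lemma finite_switches: "finite G \<Longrightarrow> finite (switches G)"
proof -
  assume "finite G"
  have "switches G \<subseteq> (\<lambda>((i, k), (i', k')). (i, k, i', k')) ` (G \<times> G)"
    by (force simp: switches_def legal_def)
  then show ?thesis using \<open>finite G\<close> finite_subset by blast
qed

lemma switch_in_graphs:
  assumes G: "G \<in> graphs d L r" and l: "legal G i k i' k'"
  shows "switch G i k i' k' \<in> graphs d L r"
proof -
  have fin: "finite G" and sub: "fst ` G \<subseteq> L" using G by (auto simp: graphs_def)
  have swap: "card (insert y (A - {x})) = card A" if "finite A" "x \<in> A" "y \<notin> A" for A and x y :: nat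
    using that card.remove[of A x] by (simp add: card_insert_if)
  have "card (row (switch G i k i' k') a) = card (row G a)" for a
    using l by (auto simp: row_switch[OF l] legal_def row_iff intro!: swap finite_row fin)
  moreover have "card (col (switch G i k i' k') b) = card (col G b)" for b
    using l by (auto simp: col_switch[OF l] legal_def col_iff intro!: swap finite_col fin)
  moreover have "fst ` switch G i k i' k' \<subseteq> L"
    using sub l by (force simp: switch_def legal_def)
  moreover have "finite (switch G i k i' k')" using fin by (simp add: switch_def)
  ultimately show ?thesis using G by (auto simp: graphs_def)
qed

section \<open>Sizes of rows, columns and of the class of graphs\<close>

locale degs =
  fixes d :: nat and L :: "nat set" and r :: "nat \<Rightarrow> nat"
  assumes finL: "finite L" and d_pos: "1 \<le> d" and r_le: "\<And>j. r j \<le> d"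
begin

abbreviation "Om \<equiv> graphs d L r"

lemma fin_graph: "G \<in> Om \<Longrightarrow> finite G"
  by (simp add: graphs_def)

lemma fin_row: "G \<in> Om \<Longrightarrow> finite (row G i)"
  using fin_graph finite_row by blast

lemma fin_col: "G \<in> Om \<Longrightarrow> finite (col G j)"
  using fin_graph finite_col by blast

lemma edge_L: "G \<in> Om \<Longrightarrow> (i, j) \<in> G \<Longrightarrow> i \<in> L"
  by (force simp: graphs_def)

lemma card_row: "G \<in> Om \<Longrightarrow> i \<in> L \<Longrightarrow> card (row G i) = d"
  by (simp add: graphs_def)

lemma row_empty: "G \<in> Om \<Longrightarrow> i \<notin> L \<Longrightarrow> row G i = {}"
  using edge_L by (auto simp: row_def)

lemma card_row_le: "G \<in> Om \<Longrightarrow> card (row G i) \<le> d"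
  using card_row row_empty by (cases "i \<in> L") auto

lemma card_col: "G \<in> Om \<Longrightarrow> card (col G j) = r j"
  by (simp add: graphs_def)

lemma card_col_le: "G \<in> Om \<Longrightarrow> card (col G j) \<le> d"
  using card_col r_le by simp

lemma card_graph: "G \<in> Om \<Longrightarrow> card G = card L * d"
proof -
  assume G: "G \<in> Om"
  have "G = Sigma L (row G)" using edge_L[OF G] by (auto simp: row_def)
  then have "card G = (\<Sum>i\<in>L. card (row G i))"
    using card_SigmaI[of L "row G"] finL fin_row[OF G] by simp
  then show ?thesis using card_row[OF G] by simp
qed

definition R :: "nat set" where "R = {j. 0 < r j}"

lemma R_eq: "G \<in> Om \<Longrightarrow> R = snd ` G"
proof -
  assume G: "G \<in> Om"
  have "0 < r j \<longleftrightarrow> j \<in> snd ` G" for j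
  proof -
    have "0 < r j \<longleftrightarrow> col G j \<noteq> {}"
      using fin_col[OF G, of j] by (simp add: card_gt_0_iff flip: card_col[OF G])
    then show ?thesis by (force simp: col_def)
  qed
  then show ?thesis by (auto simp: R_def)
qed

lemma row_sub_R: "G \<in> Om \<Longrightarrow> row G i \<subseteq> R"
  using R_eq by (force simp: row_def)

lemma fin_R: "G \<in> Om \<Longrightarrow> finite R"
  using R_eq fin_graph by simp

lemma card_R_le: "G \<in> Om \<Longrightarrow> card R \<le> card L * d"
  using R_eq card_graph card_image_le[OF fin_graph] by metis

lemma card_R_ge: "G \<in> Om \<Longrightarrow> card L \<le> card R"
proof -
  assume G: "G \<in> Om"
  have "G = (\<lambda>(j, i). (i, j)) ` Sigma R (col G)"
    using R_eq[OF G] by (force simp: col_def)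
  then have "card G \<le> card (Sigma R (col G))"
    using card_image_le finite_SigmaI fin_R[OF G] fin_col[OF G] by metis
  also have "\<dots> = (\<Sum>j\<in>R. card (col G j))" using fin_R[OF G] fin_col[OF G] by (simp add: card_SigmaI)
  also have "\<dots> \<le> (\<Sum>j\<in>R. d)" by (intro sum_mono card_col_le G)
  finally show ?thesis using card_graph[OF G] d_pos by simp
qed

lemma Om_sub_Pow: "Om \<subseteq> Pow (L \<times> R)"
  using R_eq edge_L by force

lemma fin_Om: "finite Om"
proof (cases "Om = {}")
  case False
  then obtain G where "G \<in> Om" by auto
  then show ?thesis using Om_sub_Pow fin_R finL finite_subset by (metis finite_Pow_iff finite_SigmaI)
qed simp

lemma card_Om_le: "card Om \<le> 2 ^ (card L * (card L * d))"
proof (cases "Om = {}")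
  case False
  then obtain G where G: "G \<in> Om" by auto
  have "card Om \<le> card (Pow (L \<times> R))" using Om_sub_Pow fin_R[OF G] finL by (intro card_mono) auto
  also have "\<dots> = 2 ^ (card L * card R)" using fin_R[OF G] finL by (simp add: card_Pow card_cartesian_product)
  also have "\<dots> \<le> 2 ^ (card L * (card L * d))" using card_R_le[OF G] by (intro power_increasing) auto
  finally show ?thesis .
qed simp

section \<open>Connectivity under switches and a crude inequality\<close>

definition step :: "(bgraph \<times> bgraph) set" where
  "step = {(G, H). G \<in> Om \<and> H \<in> Om \<and> (\<exists>i k i' k'. legal G i k i' k' \<and> H = switch G i k i' k')}"

lemma step_I: "G \<in> Om \<Longrightarrow> legal G i k i' k' \<Longrightarrow> (G, switch G i k i' k') \<in> step"
  using switch_in_graphs by (auto simp: step_def)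

lemma sym_step: "sym step"
  unfolding sym_def step_def using legal_switch switch_switch by (fastforce simp del: split_paired_Ex)

text \<open>Of two vertices that \<open>v\<close> has to exchange, the one of larger degree (inside the rows still
  in play) has a spare neighbour; so one of the two graphs can be moved towards the other.\<close>

lemma connected_aux:
  assumes "finite W" "G \<in> Om" "H \<in> Om" "\<And>i. i \<notin> W \<Longrightarrow> row G i = row H i"
  shows "(G, H) \<in> step\<^sup>*"
  using assms
proof (induction W arbitrary: G H rule: finite_induct)
  case empty
  then have "G = H" by (auto simp: row_def set_eq_iff)
  then show ?case by simp
next
  case (insert v W)
  from insert.prems show ?case
  proof (induction "card (row G v - row H v)" arbitrary: G H rule: less_induct)
    case less
    note GH = less.prems
    show ?case
    proof (cases "row G v = row H v")
      case True
      then show ?thesis using insert.IH GH by (metis insert_iff)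
    next
      case False
      then have vL: "v \<in> L" using row_empty GH by blast
      have "card (row G v) = card (row H v)" using GH vL card_row by simp
      then have "\<not> row G v \<subseteq> row H v" "\<not> row H v \<subseteq> row G v"
        using False fin_row GH by (metis card_subset_eq)+
      then obtain j j' where j: "(v, j) \<in> G" "(v, j) \<notin> H" "(v, j') \<in> H" "(v, j') \<notin> G"
        by (auto simp: row_def)
      define cc where "cc = (\<lambda>G j. card (col G j \<inter> insert v W))"
      \<comment> \<open>The right degrees agree and so do the rows outside
        \<open>insert v W\<close>, hence so do the degrees counted inside.\<close>
      have cc: "cc G b = cc H b" for b
      proof -
        have fW: "finite (insert v W)" using insert.hyps by simp
        have "card (col K b) = cc K b + card (col K b - insert v W)" if "K \<in> Om" for K
          unfolding cc_def using card_Int_Diff[OF fin_col[OF that]] by blast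
        moreover have "col G b - insert v W = col H b - insert v W"
          using GH(3) by (auto simp: col_def row_def set_eq_iff)
        ultimately show ?thesis using GH(1,2) card_col by (metis add_right_cancel)
      qed
      \<comment> \<open>Without such a row, every neighbour of \<open>b'\<close> inside
        \<open>insert v W\<close> would also be one of \<open>b\<close>; as \<open>v\<close> is
        adjacent to \<open>b\<close> only, the inclusion would be strict and contradict the
        degrees.\<close>
      have exch: "\<exists>i\<in>W. legal K v b i b'"
        if "K \<in> Om" "(v, b) \<in> K" "(v, b') \<notin> K" "cc K b \<le> cc K b'" for K b b'
      proof (rule ccontr)
        assume "\<not> ?thesis"
        then have "col K b' \<inter> insert v W \<subset> col K b \<inter> insert v W"
          using that by (auto simp: legal_def col_def)
        then have "cc K b' < cc K b" unfolding cc_def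
          using insert.hyps by (intro psubset_card_mono) auto
        then show False using that by simp
      qed
      have less': "card (row G' v - row H' v) < card (row G v - row H v)"
        if "row G' v - row H' v = (row G v - row H v) - {j}" for G' H'
        unfolding that using j fin_row[OF GH(1)] by (intro psubset_card_mono) (auto simp: row_def)
      show ?thesis
      proof (cases "cc G j \<le> cc G j'")
        case True
        then obtain i where i: "i \<in> W" "legal G v j i j'" using exch GH j by blast
        let ?G = "switch G v j i j'"
        have "row ?G v - row H v = (row G v - row H v) - {j}"
          using j by (auto simp: row_switch[OF i(2)] row_iff)
        moreover have "row ?G a = row H a" if "a \<notin> insert v W" for a
          using that i GH(3)[OF that] by (auto simp: row_switch[OF i(2)])
        ultimately have "(?G, H) \<in> step\<^sup>*"
          using switch_in_graphs[OF GH(1) i(2)] GH(1,2) less.hyps[OF less'] by simp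
        then show ?thesis using step_I[OF GH(1) i(2)] by (rule converse_rtrancl_into_rtrancl[rotated])
      next
        case False
        then have "cc H j' \<le> cc H j" using cc by simp
        then obtain i where i: "i \<in> W" "legal H v j' i j" using exch GH j by blast
        let ?H = "switch H v j' i j"
        have "row G v - row ?H v = (row G v - row H v) - {j}"
          using j by (auto simp: row_switch[OF i(2)] row_iff)
        moreover have "row G a = row ?H a" if "a \<notin> insert v W" for a
          using that i GH(3)[OF that] by (auto simp: row_switch[OF i(2)])
        ultimately have "(G, ?H) \<in> step\<^sup>*"
          using switch_in_graphs[OF GH(2) i(2)] GH(1,2) less.hyps[OF less'] by simp
        then show ?thesis using step_I[OF GH(2) i(2)] sym_step
          by (metis rtrancl_into_rtrancl symD)
      qed
    qed
  qed
qed

lemma connected: "G \<in> Om \<Longrightarrow> H \<in> Om \<Longrightarrow> (G, H) \<in> step\<^sup>*"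
  using connected_aux[OF finL] row_empty by metis

lemma dirichlet_nonneg:
  assumes "\<And>G. G \<in> Om \<Longrightarrow> 0 < f G"
  shows "0 \<le> dirichlet Om f"
  unfolding dirichlet_def using assms switch_in_graphs
  by (intro sum_nonneg) (auto simp: switches_def intro!: phi_nonneg)

text \<open>Two graphs are joined by a path of at most \<open>card step\<close> steps, at most the
  square of the number of graphs, and each step is controlled by the whole Dirichlet sum. Squaring
  gives the fourth power; \<open>psi_le_hel\<close> and the final summation contribute one factor
  each.\<close>

lemma ent_le_dirichlet_crude:
  assumes f: "\<And>G. G \<in> Om \<Longrightarrow> 0 < f G"
  shows "ent Om f \<le> 4 * real (card Om) ^ 6 * dirichlet Om f"
proof (cases "Om = {}")
  case True
  then show ?thesis by (simp add: ent_def mean_ent_def dirichlet_def)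
next
  case False
  define N where "N = card Om"
  have N: "0 < N" using False fin_Om by (simp add: N_def card_gt_0_iff)
  define D where "D = sqrt (dirichlet Om f)"
  have D0: "0 \<le> D" "D\<^sup>2 = dirichlet Om f" using dirichlet_nonneg[OF f] by (auto simp: D_def)
  have one: "\<bar>sqrt (f G) - sqrt (f H)\<bar> \<le> D" if "(G, H) \<in> step" for G H
  proof -
    obtain i k i' k' where GH: "G \<in> Om" "legal G i k i' k'" "H = switch G i k i' k'"
      using \<open>(G, H) \<in> step\<close> by (auto simp: step_def)
    have H: "H \<in> Om" using switch_in_graphs GH by simp
    have "hel (f G) (f H) \<le> phi (f G) (f H)" using f GH(1) H by (intro hel_le_phi)
    also have "\<dots> \<le> (\<Sum>(i, k, i', k')\<in>switches G. phi (f G) (f (switch G i k i' k')))"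
    proof -
      define F where "F = (\<lambda>(i, k, i', k'). phi (f G) (f (switch G i k i' k')))"
      have "0 \<le> F t" if "t \<in> switches G" for t
        using that f GH(1) switch_in_graphs[OF GH(1)] by (auto simp: F_def switches_def intro!: phi_nonneg)
      moreover have "(i, k, i', k') \<in> switches G" using GH by (simp add: switches_def)
      ultimately have "F (i, k, i', k') \<le> sum F (switches G)"
        using finite_switches[OF fin_graph[OF GH(1)]] by (intro member_le_sum) auto
      then show ?thesis using GH by (simp add: F_def)
    qed
    also have "\<dots> \<le> dirichlet Om f"
      unfolding dirichlet_def using GH f fin_Om switch_in_graphs
      by (intro member_le_sum sum_nonneg) (auto simp: switches_def intro!: phi_nonneg)
    finally have "(sqrt (f G) - sqrt (f H))\<^sup>2 \<le> D\<^sup>2" using D0 by (simp add: hel_def)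
    then show ?thesis using D0(1) abs_le_square_iff[of "sqrt (f G) - sqrt (f H)" D] by simp
  qed
  have path: "\<bar>sqrt (f G) - sqrt (f H)\<bar> \<le> n * D" if "(G, H) \<in> step ^^ n" for n G H
    using that
  proof (induction n arbitrary: H)
    case (Suc n)
    then obtain K where "(G, K) \<in> step ^^ n" "(K, H) \<in> step" by auto
    then have "\<bar>sqrt (f G) - sqrt (f K)\<bar> \<le> n * D" "\<bar>sqrt (f K) - sqrt (f H)\<bar> \<le> D"
      using Suc.IH one by auto
    then show ?case by (simp add: distrib_right)
  qed simp
  have step_sub: "step \<subseteq> Om \<times> Om" by (auto simp: step_def)
  have pair: "hel (f G) (f H) \<le> real N ^ 4 * dirichlet Om f" if "G \<in> Om" "H \<in> Om" for G H
  proof -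
    obtain n where n: "n \<le> card step" "(G, H) \<in> step ^^ n"
      using connected[OF \<open>G \<in> Om\<close> \<open>H \<in> Om\<close>] rtrancl_finite_eq_relpow[of step] step_sub fin_Om
        finite_subset by (metis (no_types, lifting) UN_iff finite_SigmaI mem_Collect_eq)
    have "card step \<le> N * N"
      using card_mono[OF _ step_sub] fin_Om by (simp add: N_def card_cartesian_product)
    then have "real n \<le> real N ^ 2" using n by (metis le_trans of_nat_mono of_nat_mult power2_eq_square)
    then have "\<bar>sqrt (f G) - sqrt (f H)\<bar> \<le> real N ^ 2 * D"
      using path[OF n(2)] D0 by (meson mult_right_mono order_trans)
    then have "hel (f G) (f H) \<le> (real N ^ 2 * D)\<^sup>2"
      unfolding hel_def by (metis abs_ge_zero power2_abs power_mono)
    then show ?thesis using D0 by (simp add: power_mult_distrib flip: power_mult)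
  qed
  define u where "u = sum f Om / card Om"
  have u: "0 < u" unfolding u_def using f False fin_Om N
    by (intro divide_pos_pos sum_pos) (auto simp: N_def)
  have "psi (f G) u \<le> 4 * real N ^ 5 * dirichlet Om f" if G: "G \<in> Om" for G
  proof -
    have "f G \<le> sum f Om" using f G fin_Om by (intro member_le_sum) (auto intro: less_imp_le)
    then have le: "psi (f G) u \<le> 4 * real N * hel (f G) u"
      using f[OF G] u N by (intro psi_le_hel) (auto simp: u_def N_def)
    have Nu: "real N * u = sum f Om" using N by (simp add: u_def N_def)
    have "real N * hel (f G) u = hel (\<Sum>H\<in>Om. f G) (sum f Om)"
      by (simp add: N_def flip: Nu hel_scale)
    also have "\<dots> \<le> (\<Sum>H\<in>Om. hel (f G) (f H))"
      using f G by (intro hel_sum) (auto intro: less_imp_le)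
    also have "\<dots> \<le> (\<Sum>H\<in>Om. real N ^ 4 * dirichlet Om f)" by (intro sum_mono pair G)
    also have "\<dots> = real N ^ 5 * dirichlet Om f" by (simp add: N_def power_numeral_reduce)
    finally show ?thesis using le by simp
  qed
  then have "(\<Sum>G\<in>Om. psi (f G) u) \<le> (\<Sum>G\<in>Om. 4 * real N ^ 5 * dirichlet Om f)"
    by (intro sum_mono)
  then have "ent Om f \<le> (\<Sum>G\<in>Om. 4 * real N ^ 5 * dirichlet Om f)"
    using ent_eq_psi[OF fin_Om False f u_def] by simp
  also have "\<dots> = 4 * real (card Om) ^ 6 * dirichlet Om f" by (simp add: N_def power_numeral_reduce)
  finally show ?thesis .
qed

end

section \<open>Revealing the neighbourhood of one left vertex\<close>

lemma mean_ent_empty [simp]: "mean_ent {} f = 0"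
  by (simp add: mean_ent_def)

text \<open>The sets \<open>Y j\<close> together cover \<open>X\<close> evenly, \<open>a\<close>
  times in cardinality and in mass, so the linear parts of \<open>psi\<close> cancel. Empty
  \<open>Y j\<close> are harmless since \<open>psi 0 0 = 0\<close>.\<close>

lemma mean_ent_family:
  fixes a u :: real
  assumes fin: "finite X" "X \<noteq> {}" and f: "\<And>x. x \<in> X \<Longrightarrow> 0 < f x"
    and Y: "\<And>j. j \<in> J \<Longrightarrow> Y j \<subseteq> X"
    and cY: "(\<Sum>j\<in>J. real (card (Y j))) = a * card X" and sY: "(\<Sum>j\<in>J. sum f (Y j)) = a * sum f X"
    and u: "u = sum f X / card X"
  shows "(\<Sum>j\<in>J. mean_ent (Y j) f) - a * mean_ent X f = (\<Sum>j\<in>J. psi (sum f (Y j)) (card (Y j) * u))"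
proof -
  have N: "0 < real (card X)" using fin by (simp add: card_gt_0_iff)
  have s: "0 < sum f X" using fin f by (intro sum_pos) auto
  have u0: "0 < u" using N s by (simp add: u del: of_nat_0_less_iff)
  have "psi (sum f (Y j)) (card (Y j) * u) = mean_ent (Y j) f - sum f (Y j) * ln u - sum f (Y j) + card (Y j) * u"
    if j: "j \<in> J" for j
  proof (cases "Y j = {}")
    case False
    have fY: "finite (Y j)" using Y[OF j] fin finite_subset by blast
    have c: "0 < real (card (Y j))" using False fY by (simp add: card_gt_0_iff)
    have "0 < sum f (Y j)" using False fY Y[OF j] f by (intro sum_pos) auto
    then show ?thesis using c u0 by (simp add: psi_def mean_ent_def ln_mult ln_div algebra_simps)
  qed (simp add: psi_def)
  then have "(\<Sum>j\<in>J. psi (sum f (Y j)) (card (Y j) * u))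
      = (\<Sum>j\<in>J. mean_ent (Y j) f) - (\<Sum>j\<in>J. sum f (Y j)) * ln u - (\<Sum>j\<in>J. sum f (Y j)) + (\<Sum>j\<in>J. real (card (Y j))) * u"
    by (simp add: sum.distrib sum_subtractf sum_distrib_right)
  also have "\<dots> = (\<Sum>j\<in>J. mean_ent (Y j) f) - a * mean_ent X f"
    unfolding cY sY using N by (simp add: mean_ent_def u algebra_simps)
  finally show ?thesis by simp
qed

lemma hel_le_psi0:
  fixes u :: real
  assumes "finite Y" "\<And>x. x \<in> Y \<Longrightarrow> 0 < f x" "0 < u"
  shows "hel (sum f Y) (card Y * u) \<le> psi (sum f Y) (card Y * u)"
proof (cases "Y = {}")
  case False
  then show ?thesis using assms by (intro hel_le_psi sum_pos) (auto simp: card_gt_0_iff)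
qed (simp add: psi_def)

locale degs_fun = degs +
  fixes f :: "bgraph \<Rightarrow> real" and v :: nat
  assumes f_pos: "\<And>G. G \<in> Om \<Longrightarrow> 0 < f G" and vL: "v \<in> L" and ne: "Om \<noteq> {}"
begin

lemma finR: "finite R"
  using ne fin_R by auto

section \<open>Graphs whose row at \<open>v\<close> contains a prescribed set\<close>

definition above :: "nat set \<Rightarrow> bgraph set" where
  "above A = {G \<in> Om. A \<subseteq> row G v}"

lemma above_sub: "above A \<subseteq> Om"
  by (auto simp: above_def)

lemma fin_above: "finite (above A)"
  using above_sub fin_Om finite_subset by blast

lemma f_above: "G \<in> above A \<Longrightarrow> 0 < f G"
  using f_pos above_sub by blast

lemma f_above_nonneg: "G \<in> above A \<Longrightarrow> 0 \<le> f G"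
  using f_above less_imp_le by blast

lemma above_insert_sub: "above (insert j A) \<subseteq> above A"
  by (auto simp: above_def)

text \<open>Double counting of the pairs of a graph and a further neighbour of
  \<open>v\<close>.\<close>

lemma sum_extend:
  fixes h :: "nat \<Rightarrow> bgraph \<Rightarrow> real"
  shows "(\<Sum>j\<in>R - A. \<Sum>G\<in>above (insert j A). h j G) = (\<Sum>G\<in>above A. \<Sum>j\<in>row G v - A. h j G)"
proof -
  have "(\<Sum>j\<in>R - A. \<Sum>G\<in>above (insert j A). h j G) = (\<Sum>j\<in>R - A. \<Sum>G\<in>{G \<in> above A. j \<in> row G v}. h j G)"
    by (intro sum.cong) (auto simp: above_def)
  also have "\<dots> = (\<Sum>G\<in>above A. \<Sum>j\<in>{j \<in> R - A. j \<in> row G v}. h j G)"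
    using finR fin_above by (intro sum.swap_restrict) auto
  also have "\<dots> = (\<Sum>G\<in>above A. \<Sum>j\<in>row G v - A. h j G)"
    using row_sub_R by (intro sum.cong) (auto simp: above_def)
  finally show ?thesis .
qed

lemma card_row_diff: "G \<in> above A \<Longrightarrow> card (row G v - A) = d - card A"
  using card_row[of G v] vL finite_subset[OF _ fin_row[of G v], of A] by (simp add: above_def card_Diff_subset)

lemma sum_extend_const:
  fixes h :: "bgraph \<Rightarrow> real"
  shows "(\<Sum>j\<in>R - A. \<Sum>G\<in>above (insert j A). h G) = real (d - card A) * sum h (above A)"
  unfolding sum_extend by (simp add: card_row_diff sum_distrib_left)

definition rows :: "nat set \<Rightarrow> nat set set" where
  "rows A = {S. S \<subseteq> R \<and> card S = d \<and> A \<subseteq> S}"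

lemma fin_rows: "finite (rows A)"
  by (rule finite_subset[of _ "Pow R"]) (use finR in \<open>auto simp: rows_def\<close>)

lemma above_full: "S \<in> rows A \<Longrightarrow> above S = {G \<in> Om. row G v = S}"
proof -
  assume S: "S \<in> rows A"
  have "S = row G v" if "G \<in> Om" "S \<subseteq> row G v" for G
    using S card_row[OF that(1) vL] by (intro card_subset_eq fin_row that) (simp add: rows_def)
  then show ?thesis by (auto simp: above_def)
qed

lemma sum_rows:
  fixes h :: "bgraph \<Rightarrow> real"
  shows "(\<Sum>S\<in>rows A. sum h (above S)) = sum h (above A)"
proof -
  have "(\<Sum>S\<in>rows A. sum h {G \<in> above A. row G v = S}) = sum h (above A)"
    using fin_rows fin_above subsetD[OF row_sub_R] card_row vL by (intro sum.group) (auto simp: above_def rows_def)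
  moreover have "above S = {G \<in> above A. row G v = S}" if "S \<in> rows A" for S
    using above_full[OF that] that by (auto simp: above_def rows_def)
  ultimately show ?thesis by simp
qed

lemma sum_rows_extend:
  fixes h :: "nat set \<Rightarrow> real"
  shows "(\<Sum>j\<in>R - A. \<Sum>S\<in>rows (insert j A). h S) = real (d - card A) * sum h (rows A)"
proof -
  have "(\<Sum>j\<in>R - A. \<Sum>S\<in>rows (insert j A). h S) = (\<Sum>j\<in>R - A. \<Sum>S\<in>{S \<in> rows A. j \<in> S}. h S)"
    by (intro sum.cong) (auto simp: rows_def)
  also have "\<dots> = (\<Sum>S\<in>rows A. \<Sum>j\<in>{j \<in> R - A. j \<in> S}. h S)"
    using finR fin_rows by (intro sum.swap_restrict) auto
  also have "\<dots> = (\<Sum>S\<in>rows A. real (d - card A) * h S)"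
  proof (intro sum.cong refl)
    fix S assume S: "S \<in> rows A"
    have "{j \<in> R - A. j \<in> S} = S - A" using S by (auto simp: rows_def)
    moreover have "card (S - A) = d - card A"
      using S finite_subset[OF _ finR] finite_subset[of A S]
      by (subst card_Diff_subset) (auto simp: rows_def)
    ultimately show "(\<Sum>j\<in>{j \<in> R - A. j \<in> S}. h S) = real (d - card A) * h S" by simp
  qed
  finally show ?thesis by (simp add: sum_distrib_left)
qed

text \<open>Entropy gained by revealing one further neighbour of \<open>v\<close>. Every graph is
  counted once for each of its \<open>d - card A\<close> unrevealed neighbours, hence the multiple
  of \<open>mean_ent (above A) f\<close>.\<close>

definition step_ent :: "nat set \<Rightarrow> real" where
  "step_ent A = (\<Sum>j\<in>R - A. mean_ent (above (insert j A)) f) - real (d - card A) * mean_ent (above A) f"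

definition row_ent :: "nat set \<Rightarrow> real" where
  "row_ent A = (\<Sum>S\<in>rows A. mean_ent (above S) f) - mean_ent (above A) f"

text \<open>Chain rule: to reveal the whole row, first reveal one of the remaining neighbours, in
  each of the \<open>d - card A\<close> possible ways.\<close>

lemma row_ent_rec: "real (d - card A) * row_ent A = step_ent A + (\<Sum>j\<in>R - A. row_ent (insert j A))"
  by (simp add: row_ent_def step_ent_def sum_subtractf sum_rows_extend right_diff_distrib)

lemma step_ent_eq:
  fixes u :: real
  assumes "above A \<noteq> {}" and u: "u = sum f (above A) / card (above A)"
  shows "step_ent A = (\<Sum>j\<in>R - A. psi (sum f (above (insert j A))) (card (above (insert j A)) * u))"
  unfolding step_ent_def
proof (rule mean_ent_family[OF fin_above assms(1) _ _ _ _ u])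
  show "(\<Sum>j\<in>R - A. real (card (above (insert j A)))) = real (d - card A) * card (above A)"
    using sum_extend_const[of "\<lambda>_. 1" A] by simp
qed (use above_insert_sub sum_extend_const f_above in auto)

lemma u_pos: "above A \<noteq> {} \<Longrightarrow> 0 < sum f (above A) / card (above A)"
  using fin_above f_above by (intro divide_pos_pos sum_pos) (auto simp: card_gt_0_iff)

lemma step_ent_nonneg: "0 \<le> step_ent A"
proof (cases "above A = {}")
  case True
  then have "above (insert j A) = {}" for j using above_insert_sub by blast
  then show ?thesis by (simp add: step_ent_def True)
next
  case False
  show ?thesis unfolding step_ent_eq[OF False refl]
    using u_pos[OF False] by (intro sum_nonneg order_trans[OF hel_nonneg hel_le_psi0]) (auto intro: fin_above f_above)
qed

text \<open>This direction lets Hellinger errors in the coupling be charged to the row entropy that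
  is being estimated.\<close>

lemma row_ent_ge_hel:
  fixes u :: real
  assumes "above A \<noteq> {}" and u: "u = sum f (above A) / card (above A)"
  shows "(\<Sum>S\<in>rows A. hel (sum f (above S)) (card (above S) * u)) \<le> row_ent A"
proof -
  have "(\<Sum>S\<in>rows A. mean_ent (above S) f) - 1 * mean_ent (above A) f
      = (\<Sum>S\<in>rows A. psi (sum f (above S)) (card (above S) * u))"
  proof (rule mean_ent_family[OF fin_above assms(1) _ _ _ _ u])
    show "(\<Sum>S\<in>rows A. real (card (above S))) = 1 * real (card (above A))" using sum_rows[of "\<lambda>_. 1" A] by simp
    show "(\<Sum>S\<in>rows A. sum f (above S)) = 1 * sum f (above A)" using sum_rows[of f A] by simp
  qed (auto simp: above_def rows_def f_pos)
  then have "row_ent A = (\<Sum>S\<in>rows A. psi (sum f (above S)) (card (above S) * u))" by (simp add: row_ent_def)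
  moreover have "0 < u" using u_pos assms by simp
  ultimately show ?thesis using sum_mono[OF hel_le_psi0[OF fin_above f_above]] by simp
qed

lemma row_ent_full:
  assumes "card A = d" "finite A"
  shows "row_ent A = 0"
proof (cases "A \<subseteq> R")
  case True
  have "S = A" if "S \<in> rows A" for S
    using that card_subset_eq[of S A] assms finite_subset[OF _ finR, of S] by (auto simp: rows_def)
  moreover have "A \<in> rows A" using True assms by (simp add: rows_def)
  ultimately have "rows A = {A}" by blast
  then show ?thesis by (simp add: row_ent_def)
next
  case False
  have "above A = {}" using False row_sub_R order_trans unfolding above_def by blast
  moreover have "rows A = {}" using False by (auto simp: rows_def)
  ultimately show ?thesis by (simp add: row_ent_def)
qed

text \<open>Since \<open>g\<close> is at most 1/2, the self-referring term is absorbed on the left.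
  With k neighbours missing, the constants satisfy c 0 = 0 and c (k + 1) = 2 + 2 c k, solved by 2^(k
  + 1) - 2. The condition on the sum of \<open>b\<close> says that the bound does not grow on
  average when one more neighbour is revealed.\<close>

lemma row_ent_bound:
  fixes b :: "nat set \<Rightarrow> real"
  assumes e: "\<And>A. A \<subseteq> R \<Longrightarrow> card A < d \<Longrightarrow> step_ent A \<le> b A + g * row_ent A"
    and b0: "\<And>A. 0 \<le> b A"
    and b: "\<And>A. A \<subseteq> R \<Longrightarrow> card A < d \<Longrightarrow> (\<Sum>j\<in>R - A. b (insert j A)) \<le> real (d - card A) * b A"
    and g: "0 \<le> g" "g \<le> 1 / 2"
    and A: "A \<subseteq> R" "card A \<le> d"
  shows "row_ent A \<le> (2 ^ (d - card A + 1) - 2) * b A"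
  using A
proof (induction "d - card A" arbitrary: A)
  case 0
  then have "card A = d" "finite A" using finR finite_subset by auto
  then show ?case using row_ent_full by simp
next
  case (Suc n)
  define a where "a = real (d - card A)"
  have fA: "finite A" using Suc.prems finR finite_subset by blast
  have a: "1 \<le> a" "d - card A = Suc n" "card A < d" using Suc.hyps(2) by (auto simp: a_def)
  have "row_ent (insert j A) \<le> (2 ^ (n + 1) - 2) * b (insert j A)" if "j \<in> R - A" for j
  proof -
    have "card (insert j A) = Suc (card A)" using that fA by simp
    then have *: "n = d - card (insert j A)" "card (insert j A) \<le> d" "insert j A \<subseteq> R"
      using Suc.prems that a(2) by auto
    show ?thesis using Suc.hyps(1)[OF *(1,3,2)] unfolding *(1)[symmetric] .
  qed
  then have "(\<Sum>j\<in>R - A. row_ent (insert j A)) \<le> (\<Sum>j\<in>R - A. (2 ^ (n + 1) - 2) * b (insert j A))"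
    by (intro sum_mono)
  also have "\<dots> \<le> (2 ^ (n + 1) - 2) * (a * b A)"
    unfolding sum_distrib_left[symmetric] a_def using b[OF Suc.prems(1) a(3)]
    by (intro mult_left_mono) auto
  finally have *: "a * row_ent A \<le> b A + g * row_ent A + (2 ^ (n + 1) - 2) * (a * b A)"
    using row_ent_rec[of A] e[OF Suc.prems(1) a(3)] by (simp add: a_def)
  show ?case
  proof (cases "row_ent A \<le> 0")
    case True
    moreover have "(1::real) \<le> 2 ^ n" by simp
    then have "0 \<le> 4 * (2::real) ^ n - 2" by linarith
    then have "(0::real) \<le> 2 ^ (Suc n + 1) - 2" by simp
    then have "0 \<le> (2 ^ (Suc n + 1) - 2) * b A" using b0[of A] by (intro mult_nonneg_nonneg)
    ultimately show ?thesis using a by simp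
  next
    case False
    have "g * row_ent A \<le> a / 2 * row_ent A" using False g a by (intro mult_right_mono) auto
    moreover have "b A \<le> a * b A" using b0[of A] a mult_right_mono[of 1 a "b A"] by simp
    ultimately have "a * row_ent A \<le> a * ((2 ^ (Suc n + 1) - 2) * b A)"
      using * by (simp add: algebra_simps)
    then show ?thesis using a by (simp add: mult_le_cancel_left)
  qed
qed

lemma above_empty: "above {} = Om"
  by (simp add: above_def)

text \<open>Chain rule along the neighbourhood of \<open>v\<close>, with nothing revealed at the
  start.\<close>

lemma ent_split: "ent Om f = (\<Sum>S\<in>rows {}. ent (above S) f) + row_ent {}"
  using sum_rows[of "\<lambda>G. f G * ln (f G)" "{}"]
  by (simp add: ent_def row_ent_def above_empty sum_subtractf)

text \<open>Equivalent to \<open>step_ent_nonneg\<close>: conditioning on one neighbour does not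
  increase the entropy on average.\<close>

lemma ent_extend: "(\<Sum>j\<in>R - A. ent (above (insert j A)) f) \<le> real (d - card A) * ent (above A) f"
  using step_ent_nonneg[of A] sum_extend_const[of "\<lambda>G. f G * ln (f G)" A]
  by (simp add: ent_def step_ent_def sum_subtractf algebra_simps)

end

section \<open>Counting switches\<close>

lemma card_rows_le:
  assumes "finite I" "finite G" "\<And>i. card (row G i) \<le> d" "card I \<le> c"
  shows "card {(i, k). (i, k) \<in> G \<and> i \<in> I} \<le> c * d"
proof -
  have "{(i, k). (i, k) \<in> G \<and> i \<in> I} = Sigma I (row G)" by (auto simp: row_def)
  then have "card {(i, k). (i, k) \<in> G \<and> i \<in> I} = (\<Sum>i\<in>I. card (row G i))"
    using assms finite_row by (simp add: card_SigmaI)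
  also have "\<dots> \<le> card I * d" using sum_bounded_above[of I "\<lambda>i. card (row G i)" d] assms(3) by simp
  also have "\<dots> \<le> c * d" using assms(4) by simp
  finally show ?thesis .
qed

lemma card_cols_le:
  assumes "finite K" "finite G" "\<And>k. card (col G k) \<le> d" "card K \<le> c"
  shows "card {(i, k). (i, k) \<in> G \<and> k \<in> K} \<le> c * d"
proof -
  have "{(i, k). (i, k) \<in> G \<and> k \<in> K} = (\<lambda>(k, i). (i, k)) ` Sigma K (col G)" by (auto simp: col_def)
  then have "card {(i, k). (i, k) \<in> G \<and> k \<in> K} \<le> card (Sigma K (col G))"
    using card_image_le finite_SigmaI assms finite_col by metis
  also have "\<dots> = (\<Sum>k\<in>K. card (col G k))"
    using assms finite_col by (simp add: card_SigmaI)
  also have "\<dots> \<le> card K * d" using sum_bounded_above[of K "\<lambda>i. card (col G i)" d] assms(3) by simp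
  also have "\<dots> \<le> c * d" using assms(4) by simp
  finally show ?thesis .
qed

context degs
begin

lemma card_rows: "G \<in> Om \<Longrightarrow> finite I \<Longrightarrow> card I \<le> c \<Longrightarrow> card {(i, k). (i, k) \<in> G \<and> i \<in> I} \<le> c * d"
  using card_rows_le fin_graph card_row_le by blast

lemma card_cols: "G \<in> Om \<Longrightarrow> finite K \<Longrightarrow> card K \<le> c \<Longrightarrow> card {(i, k). (i, k) \<in> G \<and> k \<in> K} \<le> c * d"
  using card_cols_le fin_graph card_col_le by blast

end

text \<open>The first size condition makes at least half of all edges available for a switch; the
  second keeps the relative imbalance 2 d^3 / m of the classes \<open>X j\<close> at most
  1/2.\<close>

locale degs_key = degs_fun +
  fixes A :: "nat set"
  assumes AR: "A \<subseteq> R" and cardA: "card A < d" and neA: "above A \<noteq> {}"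
    and large: "6 * d \<le> card L" "4 * d ^ 3 \<le> card L"
begin

abbreviation "X j \<equiv> above (insert j A)"

abbreviation "free G i j' \<equiv> {(i2, k2). i2 \<noteq> v \<and> legal G i j' i2 k2}"
abbreviation "blocked G i j' \<equiv> {(i2, k2). (i2, k2) \<in> G \<and> (i2 = v \<or> i2 \<in> col G j' \<or> k2 \<in> row G i)}"

lemma X_Om: "G \<in> X j \<Longrightarrow> G \<in> Om"
  by (simp add: above_def)

lemma card_blocked: "G \<in> Om \<Longrightarrow> card (blocked G i j') \<le> 3 * d\<^sup>2"
proof -
  assume G: "G \<in> Om"
  have "blocked G i j' \<subseteq> {(i, k). (i, k) \<in> G \<and> i \<in> {v}} \<union> {(i, k). (i, k) \<in> G \<and> i \<in> col G j'}
      \<union> {(a, k). (a, k) \<in> G \<and> k \<in> row G i}" by auto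
  then have "card (blocked G i j') \<le> card ({(i, k). (i, k) \<in> G \<and> i \<in> {v}} \<union> {(i, k). (i, k) \<in> G \<and> i \<in> col G j'}
      \<union> {(a, k). (a, k) \<in> G \<and> k \<in> row G i})"
    by (rule card_mono[rotated]) (rule finite_subset[OF _ fin_graph[OF G]], auto)
  also have "\<dots> \<le> 1 * d + d * d + d * d"
    using card_rows[OF G, of "{v}" 1] card_rows[OF G fin_col[OF G] card_col_le[OF G], of j']
      card_cols[OF G fin_row[OF G] card_row_le[OF G], of i]
    by (intro order_trans[OF card_Un_le] add_mono) auto
  also have "\<dots> \<le> 3 * d\<^sup>2" using d_pos by (simp add: power2_eq_square)
  finally show ?thesis .
qed

text \<open>An edge fails to be exchangeable with \<open>(i, j')\<close> away from \<open>v\<close>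
  precisely when it is blocked, so the two sets partition the edges.\<close>

lemma card_free_blocked:
  assumes G: "G \<in> Om" and "(i, j') \<in> G"
  shows "card (free G i j') + card (blocked G i j') = card L * d"
proof -
  have "free G i j' \<union> blocked G i j' = G" "free G i j' \<inter> blocked G i j' = {}"
    using assms by (auto simp: legal_def row_def col_def)
  moreover have "finite (free G i j')" "finite (blocked G i j')"
    by (rule finite_subset[OF _ fin_graph[OF G]], auto simp: legal_def)+
  ultimately have "card G = card (free G i j') + card (blocked G i j')"
    using card_Un_disjoint[of "free G i j'" "blocked G i j'"] by simp
  then show ?thesis using card_graph[OF G] by simp
qed

lemma token_in_X:
  assumes "G \<in> X j" "j' \<notin> insert j A" "(i, j) \<in> G" "i2 \<noteq> v" "legal G i j' i2 k2"
  shows "switch G i j' i2 k2 \<in> X j" "(i, j) \<in> switch G i j' i2 k2"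
proof -
  have G: "G \<in> Om" "insert j A \<subseteq> row G v" using assms by (auto simp: above_def)
  show "switch G i j' i2 k2 \<in> X j"
    using switch_in_graphs[OF G(1) assms(5)] G(2) assms by (auto simp: above_def row_switch[OF assms(5)])
  show "(i, j) \<in> switch G i j' i2 k2" using assms by (auto simp: switch_def legal_def)
qed

text \<open>Each common neighbour \<open>i\<close> can be destroyed by switching
  \<open>(i, j')\<close> with one of at least m d / 2 free edges. The result determines the origin
  once \<open>i\<close> and the two new neighbours are marked, which is possible in at most d^3
  ways.\<close>

lemma common_nbrs_rare:
  assumes j: "j' \<notin> insert j A"
  shows "(\<Sum>G\<in>X j. card (col G j \<inter> col G j')) * card L \<le> 2 * d\<^sup>2 * card (X j)"
proof -
  define Tok where "Tok = (SIGMA p : (SIGMA G : X j. col G j \<inter> col G j'). free (fst p) (snd p) j')"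
  define Im where "Im = (SIGMA G : X j. SIGMA i : col G j. row G i \<times> col G j')"
  have finLG: "finite (free G i j')" if "G \<in> Om" for G i
    by (rule finite_subset[OF _ fin_graph[OF that]]) (auto simp: legal_def)
  have "(\<Sum>G\<in>X j. card (col G j \<inter> col G j')) * (card L * d - 3 * d\<^sup>2)
      = (\<Sum>G\<in>X j. \<Sum>i\<in>col G j \<inter> col G j'. card L * d - 3 * d\<^sup>2)" by (simp add: sum_distrib_right)
  also have "\<dots> \<le> (\<Sum>G\<in>X j. \<Sum>i\<in>col G j \<inter> col G j'. card (free G i j'))"
  proof (intro sum_mono)
    fix G i assume "G \<in> X j" "i \<in> col G j \<inter> col G j'"
    then show "card L * d - 3 * d\<^sup>2 \<le> card (free G i j')"
      using card_free_blocked[of G i j'] card_blocked[where G = G and i = i and j' = j'] X_Om[of G j] by (simp add: col_iff)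
  qed
  also have "\<dots> = card Tok"
    unfolding Tok_def using fin_above fin_col X_Om finLG
    by (subst card_SigmaI) (auto simp: sum.Sigma case_prod_beta)
  also have "card Tok \<le> card Im"
  proof (rule card_inj_on_le)
    let ?F = "\<lambda>((G, i), (i2, k2)). (switch G i j' i2 k2, i, k2, i2)"
    show "inj_on ?F Tok"
      by (rule inj_on_inverseI[where g = "\<lambda>(G, i, k2, i2). ((switch G i k2 i2 j', i), (i2, k2))"])
        (auto simp: Tok_def switch_switch)
    show "?F ` Tok \<subseteq> Im"
    proof clarify
      fix G i i2 k2 assume "((G, i), (i2, k2)) \<in> Tok"
      then have t: "G \<in> X j" "(i, j) \<in> G" "i2 \<noteq> v" "legal G i j' i2 k2" by (auto simp: Tok_def col_iff)
      show "(switch G i j' i2 k2, i, k2, i2) \<in> Im"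
        using token_in_X[OF t(1) j t(2-4)] legal_switch[OF t(4)]
        by (simp add: Im_def row_iff col_iff legal_def)
    qed
    show "finite Im" unfolding Im_def using fin_above fin_col fin_row X_Om by (intro finite_SigmaI finite_cartesian_product) auto
  qed
  also have "card Im \<le> card (X j) * d ^ 3"
  proof -
    have "card Im = (\<Sum>G\<in>X j. \<Sum>i\<in>col G j. card (row G i) * card (col G j'))"
      unfolding Im_def using fin_above fin_col fin_row X_Om
      by (simp add: card_SigmaI card_cartesian_product)
    also have "\<dots> \<le> (\<Sum>G\<in>X j. d * (d * d))"
    proof (intro sum_mono)
      fix G assume "G \<in> X j"
      then have G: "G \<in> Om" by (rule X_Om)
      have "(\<Sum>i\<in>col G j. card (row G i) * card (col G j')) \<le> (\<Sum>i\<in>col G j. d * d)"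
        using card_row_le[OF G] card_col_le[OF G] by (intro sum_mono mult_le_mono)
      also have "\<dots> \<le> d * (d * d)" using card_col_le[OF G] by simp
      finally show "(\<Sum>i\<in>col G j. card (row G i) * card (col G j')) \<le> d * (d * d)" .
    qed
    finally show ?thesis by (simp add: power3_eq_cube mult.assoc)
  qed
  finally have 1: "(\<Sum>G\<in>X j. card (col G j \<inter> col G j')) * (card L * d - 3 * d\<^sup>2) \<le> card (X j) * d ^ 3" .
  have "card L * d \<le> 2 * (card L * d - 3 * d\<^sup>2)"
  proof -
    have "6 * (d * d) \<le> card L * d" using mult_le_mono1[OF large(1), of d] by (simp only: mult.assoc)
    then show ?thesis unfolding power2_eq_square by linarith
  qed
  then have "(\<Sum>G\<in>X j. card (col G j \<inter> col G j')) * (card L * d)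
      \<le> (\<Sum>G\<in>X j. card (col G j \<inter> col G j')) * (2 * (card L * d - 3 * d\<^sup>2))"
    by (rule mult_le_mono2)
  also have "\<dots> = 2 * ((\<Sum>G\<in>X j. card (col G j \<inter> col G j')) * (card L * d - 3 * d\<^sup>2))"
    by (rule mult.left_commute)
  also have "\<dots> \<le> 2 * (card (X j) * d ^ 3)" using 1 by (rule mult_le_mono2)
  finally have "(\<Sum>G\<in>X j. card (col G j \<inter> col G j')) * (card L * d) \<le> 2 * (card (X j) * d ^ 3)" .
  then have "((\<Sum>G\<in>X j. card (col G j \<inter> col G j')) * card L) * d \<le> (2 * d\<^sup>2 * card (X j)) * d"
    by (simp add: power2_eq_square power3_eq_cube ac_simps)
  then show ?thesis using d_pos by (simp add: mult_le_cancel2)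
qed

section \<open>The matching of \<open>X j\<close> with \<open>X j'\<close> by single switches at
  \<open>v\<close>\<close>

definition partners :: "nat \<Rightarrow> nat \<Rightarrow> bgraph \<Rightarrow> nat" where
  "partners j j' G = card {i. legal G v j i j'}"

lemma fin_legal: "G \<in> Om \<Longrightarrow> finite {i. legal G v j i j'}"
  by (rule finite_subset[OF _ fin_col]) (auto simp: legal_def col_def)

lemma partners_eq:
  assumes "G \<in> X j"
  shows "partners j j' G = (if (v, j') \<in> G then 0 else r j' - card (col G j \<inter> col G j'))"
proof -
  have G: "G \<in> Om" "(v, j) \<in> G" using assms by (auto simp: above_def row_def)
  have "{i. legal G v j i j'} = (if (v, j') \<in> G then {} else col G j' - col G j)"
    using G by (auto simp: legal_def col_def)
  then show ?thesis
    using card_col[OF G(1), of j'] card_Diff_subset_Int[of "col G j'" "col G j"] fin_col[OF G(1)]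
    by (simp add: partners_def Int_commute)
qed

definition pairs :: "nat \<Rightarrow> nat \<Rightarrow> (bgraph \<times> nat) set" where
  "pairs j j' = (SIGMA G : X j. {i. legal G v j i j'})"

lemma fin_pairs: "finite (pairs j j')"
  unfolding pairs_def using fin_above fin_legal X_Om by (intro finite_SigmaI) auto

lemma card_pairs: "card (pairs j j') = (\<Sum>G\<in>X j. partners j j' G)"
  unfolding pairs_def partners_def using fin_above fin_legal X_Om by (subst card_SigmaI) auto

lemma pairs_fst: "G \<in> X j \<Longrightarrow> card {p \<in> pairs j j'. fst p = G} = partners j j' G"
proof -
  assume "G \<in> X j"
  then have "{p \<in> pairs j j'. fst p = G} = Pair G ` {i. legal G v j i j'}"
    by (auto simp: pairs_def)
  then show ?thesis by (simp add: partners_def card_image inj_on_def)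
qed

lemma switch_pairs:
  assumes "(G, i) \<in> pairs j j'" "j \<notin> A"
  shows "(switch G v j i j', i) \<in> pairs j' j"
proof -
  have G: "G \<in> Om" "insert j A \<subseteq> row G v" "legal G v j i j'" using assms by (auto simp: pairs_def above_def)
  show ?thesis
    using switch_in_graphs[OF G(1,3)] legal_switch[OF G(3)] G(2) assms(2)
    by (auto simp: pairs_def above_def row_switch[OF G(3)])
qed

text \<open>Keeping the partner \<open>i\<close> as a label makes the switch reversible, so the
  number of matched pairs at a graph of \<open>X j'\<close> is again a number of partners.\<close>

lemma bij_pairs:
  assumes "j \<notin> A" "j' \<notin> A"
  shows "bij_betw (\<lambda>(G, i). (switch G v j i j', i)) (pairs j j') (pairs j' j)"
proof (rule bij_betw_byWitness[where f' = "\<lambda>(G, i). (switch G v j' i j, i)"])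
  show "(\<lambda>(G, i). (switch G v j i j', i)) ` pairs j j' \<subseteq> pairs j' j" using switch_pairs assms by auto
  show "(\<lambda>(G, i). (switch G v j' i j, i)) ` pairs j' j \<subseteq> pairs j j'" using switch_pairs assms by auto
qed (auto simp: pairs_def switch_switch)

lemma card_pairs_sym: "j \<notin> A \<Longrightarrow> j' \<notin> A \<Longrightarrow> card (pairs j j') = card (pairs j' j)"
  using bij_betw_same_card bij_pairs by blast

lemma pairs_snd:
  assumes "j \<notin> A" "j' \<notin> A" "G \<in> X j'"
  shows "card {p \<in> pairs j j'. (\<lambda>(G, i). switch G v j i j') p = G} = partners j' j G"
proof -
  let ?F = "\<lambda>(G, i). (switch G v j' i j, i)"
  have "{p \<in> pairs j j'. (\<lambda>(G, i). switch G v j i j') p = G} = ?F ` {p \<in> pairs j' j. fst p = G}"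
  proof (intro equalityI subsetI)
    fix p assume "p \<in> {p \<in> pairs j j'. (\<lambda>(G, i). switch G v j i j') p = G}"
    then obtain H i where p: "p = (H, i)" "(H, i) \<in> pairs j j'" "switch H v j i j' = G" by auto
    have "(H, i) = ?F (G, i)" using p(2,3) switch_switch[of H v j i j'] by (auto simp: pairs_def)
    moreover have "(G, i) \<in> pairs j' j" using switch_pairs[OF p(2) assms(1)] p(3) by simp
    ultimately show "p \<in> ?F ` {p \<in> pairs j' j. fst p = G}" unfolding p(1) by (intro image_eqI) auto
  next
    fix p assume "p \<in> ?F ` {p \<in> pairs j' j. fst p = G}"
    then obtain i where p: "p = (switch G v j' i j, i)" "(G, i) \<in> pairs j' j" by auto
    then show "p \<in> {p \<in> pairs j j'. (\<lambda>(G, i). switch G v j i j') p = G}"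
      using switch_pairs[OF p(2) assms(2)] switch_switch[of G v j' i j] by (auto simp: pairs_def)
  qed
  moreover have "inj_on ?F {p \<in> pairs j' j. fst p = G}" by (auto simp: inj_on_def)
  ultimately show ?thesis using pairs_fst[OF assms(3)] by (simp add: card_image)
qed

text \<open>Counting matched pairs from both sides: graphs of \<open>X j\<close> have
  \<open>r j'\<close> partners and those of \<open>X j'\<close> have \<open>r j\<close>, up to
  common neighbours, which are rare.\<close>

lemma balance:
  assumes j: "j \<in> R - A" "j' \<in> R - A" "j \<noteq> j'"
  shows "real (card (X j)) * r j' - 2 * d ^ 3 * card (X j) / card L \<le> real (card (X j')) * r j"
proof -
  have m: "0 < card L" using large d_pos by auto
  have "card (pairs j j') \<le> r j * card (X j')"
  proof -
    have "partners j' j G \<le> r j" if "G \<in> X j'" for G using partners_eq[OF that] by simp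
    then show ?thesis
      using sum_bounded_above[of "X j'" "partners j' j" "r j"] card_pairs_sym[of j j'] j
      by (simp add: card_pairs mult.commute)
  qed
  moreover have "r j' * card (X j) \<le> card (pairs j j') + d * (\<Sum>G\<in>X j. card (col G j \<inter> col G j'))"
  proof -
    have "r j' \<le> partners j j' G + d * card (col G j \<inter> col G j')" if G: "G \<in> X j" for G
    proof (cases "(v, j') \<in> G")
      \<comment> \<open>Here there is no partner at all, but \<open>v\<close> itself is a common
        neighbour; the factor \<open>d\<close> in front of the number of common neighbours pays for
        the loss of \<open>r j'\<close>.\<close>
      case True
      then have "v \<in> col G j \<inter> col G j'" using G by (auto simp: above_def row_def col_def)
      then have "1 \<le> card (col G j \<inter> col G j')"
        using fin_col X_Om[OF G] by (metis One_nat_def Suc_leI card_gt_0_iff emptyE finite_Int)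
      then have "r j' \<le> d * card (col G j \<inter> col G j')"
        using r_le[of j'] by (metis le_trans mult.right_neutral mult_le_mono2)
      then show ?thesis by simp
    next
      case False
      have "card (col G j \<inter> col G j') \<le> d * card (col G j \<inter> col G j')" using d_pos by simp
      moreover have "r j' \<le> partners j j' G + card (col G j \<inter> col G j')" using partners_eq[OF G, of j'] False by simp
      ultimately show ?thesis by linarith
    qed
    then have "(\<Sum>G\<in>X j. r j') \<le> (\<Sum>G\<in>X j. partners j j' G + d * card (col G j \<inter> col G j'))"
      by (intro sum_mono)
    then show ?thesis by (simp add: card_pairs sum.distrib sum_distrib_left mult.commute)
  qed
  ultimately have "card (X j) * r j' \<le> card (X j') * r j + d * (\<Sum>G\<in>X j. card (col G j \<inter> col G j'))"
    by (simp add: mult.commute)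
  then have 1: "real (card (X j)) * r j' \<le> real (card (X j')) * r j + d * real (\<Sum>G\<in>X j. card (col G j \<inter> col G j'))"
    by (metis (mono_tags, lifting) of_nat_add of_nat_le_iff of_nat_mult)
  have "real (\<Sum>G\<in>X j. card (col G j \<inter> col G j')) * card L \<le> 2 * d\<^sup>2 * card (X j)"
    using common_nbrs_rare[of j' j] j by (metis (mono_tags, lifting) DiffE insertE of_nat_le_iff of_nat_mult of_nat_numeral of_nat_power)
  then have "real (\<Sum>G\<in>X j. card (col G j \<inter> col G j')) \<le> 2 * d\<^sup>2 * card (X j) / card L"
    using m by (simp add: pos_le_divide_eq)
  then have 2: "d * real (\<Sum>G\<in>X j. card (col G j \<inter> col G j')) \<le> d * (2 * d\<^sup>2 * card (X j) / card L)"
    by (intro mult_left_mono) auto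
  have "real d * (2 * d\<^sup>2 * card (X j) / card L) = 2 * d ^ 3 * card (X j) / card L"
    by (simp add: power2_eq_square power3_eq_cube)
  then show ?thesis using 1 2 by linarith
qed

section \<open>Comparing two neighbours\<close>

abbreviation "m \<equiv> real (card L)"
abbreviation "N j \<equiv> real (card (X j))"
abbreviation "s j \<equiv> sum f (X j)"
abbreviation "NA \<equiv> real (card (above A))"
abbreviation "a \<equiv> real (d - card A)"
definition u :: real where "u = sum f (above A) / NA"
definition D :: real where "D = real d"

lemma D_ge_1: "1 \<le> D" "D = real d" using d_pos by (auto simp: D_def)

lemma m_bounds: "6 * D \<le> m" "4 * D ^ 3 \<le> m" "0 < m"
proof -
  show "6 * D \<le> m" unfolding D_def using large(1) by (metis of_nat_le_iff of_nat_mult of_nat_numeral)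
  show "4 * D ^ 3 \<le> m" unfolding D_def using large(2)
    by (metis of_nat_le_iff of_nat_mult of_nat_numeral of_nat_power)
  show "0 < m" using \<open>6 * D \<le> m\<close> D_ge_1 by linarith
qed

lemma NA_ge_1: "1 \<le> NA"
  using neA fin_above by (simp add: Suc_leI card_gt_0_iff)

lemma a_ge_1: "1 \<le> a"
  using cardA by simp

lemma u_gt_0: "0 < u"
  unfolding u_def by (rule u_pos[OF neA])

lemma r_ge_1: "j \<in> R - A \<Longrightarrow> 1 \<le> real (r j)"
  by (simp add: R_def)

lemma r_le_D: "real (r j) \<le> D"
  using r_le by (simp add: D_def)

lemma balance_real: 
  assumes "j \<in> R - A" "j' \<in> R - A" "j \<noteq> j'"
  shows "N j * r j' - 2 * D ^ 3 / m * N j \<le> N j' * r j"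
  using balance[OF assms] by (simp add: D_def)

lemma D_cube_le: "2 * D ^ 3 / m \<le> 1 / 2"
  using m_bounds by (simp add: field_simps)

lemma N_ratio:
  assumes "j \<in> R - A" "j' \<in> R - A"
  shows "N j \<le> 2 * D * N j'"
proof (cases "j = j'")
  case True
  then show ?thesis using D_ge_1 mult_right_mono[of 1 "2 * D" "N j"] by simp
next
  case False
  have "2 * D ^ 3 / m * N j \<le> 1 / 2 * N j" by (intro mult_right_mono D_cube_le) simp
  moreover have "N j * 1 \<le> N j * r j'" using r_ge_1[OF assms(2)] by (intro mult_left_mono) auto
  moreover have "N j' * r j \<le> N j' * D" using r_le_D by (intro mult_left_mono) auto
  ultimately show ?thesis using balance_real[OF assms False] by (simp add: mult.commute)
qed

lemma sum_N: "(\<Sum>j\<in>R - A. N j) = a * NA"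
  using sum_extend_const[of "\<lambda>_. 1" A] by simp

lemma sum_s: "(\<Sum>j\<in>R - A. s j) = a * sum f (above A)"
  using sum_extend_const[of f A] by simp

lemma N_pos:
  assumes "j \<in> R - A"
  shows "0 < N j"
proof (rule ccontr)
  assume "\<not> ?thesis"
  then have "N j' \<le> 0" if "j' \<in> R - A" for j' using N_ratio[OF that assms] by simp
  then have "(\<Sum>j\<in>R - A. N j) \<le> 0" by (intro sum_nonpos)
  moreover have "0 < a * NA" using a_ge_1 NA_ge_1 by (intro mult_pos_pos) linarith+
  ultimately show False unfolding sum_N by linarith
qed

lemma X_ne: "j \<in> R - A \<Longrightarrow> X j \<noteq> {}"
  using N_pos by fastforce

lemma card_J_bounds: "m / 2 \<le> card (R - A)" "real (card (R - A)) \<le> m * D"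
proof -
  obtain G where G: "G \<in> Om" using ne by auto
  have "card (R - A) = card R - card A" using AR finR finite_subset by (intro card_Diff_subset) auto
  moreover have "card L \<le> card R" by (rule card_R_ge[OF G])
  ultimately have "m \<le> real (card (R - A)) + D" using cardA by (simp add: D_def)
  then show "m / 2 \<le> card (R - A)" using m_bounds D_ge_1 by linarith
  have "card (R - A) \<le> card R" by (intro card_mono finR) auto
  then have "card (R - A) \<le> card L * d" using card_R_le[OF G] by simp
  then show "real (card (R - A)) \<le> m * D" unfolding D_def by (metis of_nat_le_iff of_nat_mult)
qed

text \<open>All classes have comparable size and there are at least m / 2 of them, so each takes a
  share of order 1/m of the total \<open>a * NA\<close>.\<close>

lemma N_upper:
  assumes "j \<in> R - A"
  shows "N j \<le> 4 * D * a * NA / m"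
proof -
  have "N j * (m / 2) \<le> N j * card (R - A)" using card_J_bounds by (intro mult_left_mono) auto
  also have "\<dots> = (\<Sum>j'\<in>R - A. N j)" by simp
  also have "\<dots> \<le> (\<Sum>j'\<in>R - A. 2 * D * N j')" using N_ratio[OF assms] by (intro sum_mono)
  also have "\<dots> = 2 * D * (a * NA)" by (simp add: sum_N flip: sum_distrib_left)
  finally show ?thesis using m_bounds by (simp add: field_simps)
qed

lemma N_lower:
  assumes "j \<in> R - A"
  shows "a * NA \<le> 2 * D\<^sup>2 * m * N j"
proof -
  have "a * NA \<le> (\<Sum>j'\<in>R - A. 2 * D * N j)" unfolding sum_N[symmetric]
    using N_ratio[OF _ assms] by (intro sum_mono)
  also have "\<dots> = card (R - A) * (2 * D * N j)" by simp
  also have "\<dots> \<le> (m * D) * (2 * D * N j)" using card_J_bounds D_ge_1 by (intro mult_right_mono) auto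
  finally show ?thesis by (simp add: power2_eq_square ac_simps)
qed

section \<open>The weight of the matching and the mass it leaves uncoupled\<close>

text \<open>The factor \<open>1 - 2 * D / m\<close> leaves a multiple of the uniform measure uncoupled, which the
  second round of switches consumes.\<close>

definition weight :: "nat \<Rightarrow> nat \<Rightarrow> real" where
  "weight j j' = (1 - 2 * D / m) / max (N j * r j') (N j' * r j)"

text \<open>The mass that would remain uncoupled if every graph of \<open>X j\<close> had its full
  number \<open>r j'\<close> of partners. It is spread uniformly over \<open>X j\<close>.\<close>

definition generic :: "nat \<Rightarrow> nat \<Rightarrow> real" where
  "generic j j' = 1 - weight j j' * r j' * N j"

text \<open>Total uncoupled mass; \<open>residual\<close> is the same mass weighted by
  \<open>f\<close>.\<close>

definition defect :: "nat \<Rightarrow> nat \<Rightarrow> real" where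
  "defect j j' = 1 - weight j j' * card (pairs j j')"

definition residual :: "nat \<Rightarrow> nat \<Rightarrow> real" where
  "residual j j' = (\<Sum>G\<in>X j. (1 / N j - weight j j' * partners j j' G) * f G)"

lemma weight_sym: "weight j j' = weight j' j"
  by (simp add: weight_def max.commute)

lemma theta_bounds: "0 \<le> 1 - 2 * D / m" "2 * D / m \<le> 1"
  using m_bounds D_ge_1 by (auto simp: field_simps)

lemma p_pos: "j \<in> R - A \<Longrightarrow> j' \<in> R - A \<Longrightarrow> 0 < N j * r j'"
  using N_pos[of j] r_ge_1[of j'] by (intro mult_pos_pos) auto

lemma weight_nonneg: "0 \<le> weight j j'"
  unfolding weight_def using theta_bounds by (intro divide_nonneg_nonneg) (auto simp: max_def)

text \<open>The maximum in the denominator makes the weight symmetric and keeps both marginals of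
  the matching below the uniform distributions.\<close>

lemma weight_le:
  assumes "j \<in> R - A" "j' \<in> R - A"
  shows "weight j j' * r j' * N j \<le> 1 - 2 * D / m"
proof -
  define p M where "p = N j * r j'" and "M = max p (N j' * r j)"
  have p: "0 < p" "p \<le> M" using p_pos[OF assms] by (auto simp: p_def M_def)
  have "weight j j' * r j' * N j = (1 - 2 * D / m) * (p / M)"
    by (simp add: weight_def p_def M_def)
  also have "\<dots> \<le> (1 - 2 * D / m) * 1" using theta_bounds p by (intro mult_left_mono) auto
  finally show ?thesis by simp
qed

lemma generic_ge: "j \<in> R - A \<Longrightarrow> j' \<in> R - A \<Longrightarrow> 2 * D / m \<le> generic j j'"
  using weight_le by (fastforce simp: generic_def)

text \<open>By \<open>balance\<close>, the quotient of the two products under the maximum is at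
  least 1 - 2 D^3 / m when it is below 1. So the uncoupled part is of order 1/m from above as well
  as from below.\<close>

lemma generic_le:
  assumes j: "j \<in> R - A" "j' \<in> R - A" "j \<noteq> j'"
  shows "generic j j' \<le> 4 * D ^ 3 / m"
proof -
  define p q where "p = N j * r j'" and "q = N j' * r j"
  have pq: "0 < p" "0 < q" using p_pos j by (auto simp: p_def q_def)
  have w: "weight j j' * r j' * N j = (1 - 2 * D / m) * (p / max p q)"
    by (simp add: weight_def p_def q_def)
  have DD: "D \<le> D ^ 3" using D_ge_1 power_increasing[of 1 3 D] by simp
  have dm: "2 * D / m \<le> 2 * D ^ 3 / m" using DD m_bounds by (intro divide_right_mono) auto
  have "1 - 2 * D ^ 3 / m \<le> p / max p q"
  proof (cases "q \<le> p")
    case True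
    then show ?thesis using pq D_ge_1 m_bounds by (simp add: max_def)
  next
    case False
    have "N j' * 1 \<le> N j' * r j" using r_ge_1[OF j(1)] by (intro mult_left_mono) auto
    then have "2 * D ^ 3 / m * N j' \<le> 2 * D ^ 3 / m * q"
      using D_ge_1 m_bounds by (intro mult_left_mono) (auto simp: q_def)
    then have "(1 - 2 * D ^ 3 / m) * q \<le> p"
      using balance_real[OF j(2,1)] j(3) by (simp add: p_def q_def algebra_simps)
    then show ?thesis using False pq by (simp add: max_def pos_le_divide_eq)
  qed
  then have "(1 - 2 * D / m) * (1 - 2 * D ^ 3 / m) \<le> weight j j' * r j' * N j"
    unfolding w using theta_bounds by (intro mult_left_mono)
  moreover have "(1 - 2 * D / m) * (1 - 2 * D ^ 3 / m) = 1 - 2 * D / m - 2 * D ^ 3 / m + (2 * D / m) * (2 * D ^ 3 / m)"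
    by (simp only: left_diff_distrib right_diff_distrib)
  moreover have "0 \<le> (2 * D / m) * (2 * D ^ 3 / m)" using D_ge_1 m_bounds by simp
  moreover have "4 * D ^ 3 / m = 2 * D ^ 3 / m + 2 * D ^ 3 / m" by simp
  ultimately show ?thesis using dm unfolding generic_def by linarith
qed

lemma partners_le: "G \<in> X j \<Longrightarrow> partners j j' G \<le> r j'"
  using partners_eq by simp

lemma weight_partners_le:
  assumes "j \<in> R - A" "j' \<in> R - A" "G \<in> X j"
  shows "weight j j' * partners j j' G \<le> 1 / N j"
proof -
  have "weight j j' * partners j j' G \<le> weight j j' * r j'"
    using partners_le[OF assms(3)] weight_nonneg by (intro mult_left_mono) auto
  moreover have "0 \<le> 2 * D / m" using D_ge_1 m_bounds by simp
  then have "weight j j' * r j' * N j \<le> 1" using weight_le[OF assms(1,2)] by linarith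
  then have "weight j j' * r j' \<le> 1 / N j" using N_pos[OF assms(1)] by (simp add: pos_le_divide_eq)
  ultimately show ?thesis by linarith
qed

lemma weight_pairs_le:
  assumes "j \<in> R - A" "j' \<in> R - A"
  shows "weight j j' * card (pairs j j') \<le> 1 - 2 * D / m"
proof -
  have "card (pairs j j') \<le> r j' * card (X j)"
    unfolding card_pairs using sum_bounded_above[of "X j" "partners j j'" "r j'"] partners_le by (simp add: mult.commute)
  then have "real (card (pairs j j')) \<le> r j' * N j" by (metis of_nat_le_iff of_nat_mult)
  then have "weight j j' * card (pairs j j') \<le> weight j j' * (r j' * N j)"
    using weight_nonneg by (intro mult_left_mono)
  then show ?thesis using weight_le[OF assms] by (simp add: mult.assoc)
qed

lemma defect_ge: "j \<in> R - A \<Longrightarrow> j' \<in> R - A \<Longrightarrow> 2 * D / m \<le> defect j j'"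
  using weight_pairs_le by (fastforce simp: defect_def)

text \<open>The price of passing from \<open>phi\<close> to \<open>hel\<close> in
  \<open>phi_partial_coupling\<close>; \<open>D * m^2\<close> is the ratio supplied by
  \<open>avg_ratio\<close>.\<close>

definition Lam :: real where "Lam = 4 + ln (1 + D * m\<^sup>2)"

text \<open>The class \<open>X j\<close> holds at least a fraction of order 1/m of
  \<open>above A\<close>, which bounds its average by \<open>2 * D^2 * m * u\<close>; the uncoupled
  mass of at least \<open>2 * D / m\<close> costs another factor of order \<open>m\<close>.\<close>

lemma avg_ratio:
  assumes "j \<in> R - A" "2 * D / m \<le> e"
  shows "s j / N j \<le> D * m\<^sup>2 * (e * u)"
proof -
  have "s j \<le> sum f (above A)" using above_insert_sub fin_above f_above_nonneg by (intro sum_mono2) auto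
  also have "\<dots> = NA * u" using NA_ge_1 by (simp add: u_def)
  also have "\<dots> \<le> (a * NA) * u" using a_ge_1 NA_ge_1 u_gt_0 mult_right_mono[of 1 a_ge_1 "NA * u"] by simp
  also have "\<dots> \<le> (2 * D\<^sup>2 * m * N j) * u" using N_lower[OF assms(1)] u_gt_0 by (intro mult_right_mono) auto
  finally have "s j / N j \<le> 2 * D\<^sup>2 * m * u" using N_pos[OF assms(1)] by (simp add: field_simps)
  also have "\<dots> = D * m\<^sup>2 * (2 * D / m * u)" using m_bounds by (simp add: power2_eq_square)
  also have "\<dots> \<le> D * m\<^sup>2 * (e * u)" using assms D_ge_1 u_gt_0 by (intro mult_left_mono mult_right_mono) auto
  finally show ?thesis .
qed

lemma pair_bound:
  assumes j: "j \<in> R - A" "j' \<in> R - A"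
  shows "phi (s j / N j + u) (s j' / N j' + u)
    \<le> weight j j' * (\<Sum>(G, i)\<in>pairs j j'. phi (f G) (f (switch G v j i j')))
      + 2 * Lam * (hel (residual j j') (defect j j' * u) + hel (residual j' j) (defect j' j * u))"
proof -
  have jA: "j \<notin> A" "j' \<notin> A" using j by auto
  have e: "defect j j' = defect j' j" using card_pairs_sym[OF jA] by (simp add: defect_def weight_sym)
  have e0: "0 < 2 * D / m" using D_ge_1 m_bounds by simp
  have res2: "residual j' j = (\<Sum>G\<in>X j'. (1 / N j' - weight j j' * card {p \<in> pairs j j'. (\<lambda>(G, i). switch G v j i j') p = G}) * f G)"
    unfolding residual_def by (intro sum.cong) (simp_all add: pairs_snd[OF jA] weight_sym)
  have res1: "residual j j' = (\<Sum>G\<in>X j. (1 / N j - weight j j' * card {p \<in> pairs j j'. fst p = G}) * f G)"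
    unfolding residual_def by (intro sum.cong) (simp_all add: pairs_fst)
  have "phi (s j / N j + u) (s j' / N j' + u)
    \<le> weight j j' * (\<Sum>p\<in>pairs j j'. phi (f (fst p)) (f ((\<lambda>(G, i). switch G v j i j') p)))
      + 2 * (4 + ln (1 + D * m\<^sup>2)) * (hel (residual j j') (defect j j' * u) + hel (residual j' j) (defect j j' * u))"
  proof (rule phi_partial_coupling[OF fin_above fin_above fin_pairs X_ne[OF j(1)] X_ne[OF j(2)] _ _ _ _ weight_nonneg u_gt_0 _ _ _ _ _ _ res1 res2])
    show "fst p \<in> X j" if "p \<in> pairs j j'" for p using that by (auto simp: pairs_def)
    show "(\<lambda>(G, i). switch G v j i j') p \<in> X j'" if "p \<in> pairs j j'" for p
      using that switch_pairs[OF _ jA(1)] by (auto simp: pairs_def)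
    show "0 \<le> 1 / N j - weight j j' * card {p \<in> pairs j j'. fst p = G}" if "G \<in> X j" for G
      using pairs_fst[OF that] weight_partners_le[OF j that] by simp
    show "0 \<le> 1 / N j' - weight j j' * card {p \<in> pairs j j'. (\<lambda>(G, i). switch G v j i j') p = G}" if "G \<in> X j'" for G
      using pairs_snd[OF jA that] weight_partners_le[OF j(2,1) that] by (simp add: weight_sym)
    show "defect j j' = 1 - weight j j' * card (pairs j j')" by (simp add: defect_def)
    show "0 < defect j j'" using defect_ge[OF j] e0 by linarith
    show "s j / N j \<le> D * m\<^sup>2 * (defect j j' * u)" "s j' / N j' \<le> D * m\<^sup>2 * (defect j j' * u)"
      using avg_ratio defect_ge[OF j] j by auto
  qed (auto intro: f_above)
  then show ?thesis by (simp add: e Lam_def case_prod_beta)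
qed

section \<open>Removing the failures of the coupling by a second switch\<close>

text \<open>A token is a graph with a common neighbour \<open>i\<close> of \<open>j\<close> and \<open>j'\<close>, and a second edge with which
  \<open>(i, j')\<close> can be switched; switching frees \<open>j\<close> and \<open>j'\<close> of this common neighbour.\<close>

definition tokens :: "nat \<Rightarrow> nat \<Rightarrow> ((bgraph \<times> nat) \<times> (nat \<times> nat)) set" where
  "tokens j j' = (SIGMA p : (SIGMA G : {G \<in> X j. (v, j') \<notin> G}. col G j \<inter> col G j'). free (fst p) (snd p) j')"

text \<open>Combinations of a common neighbour with an edge that cannot be used for the second
  switch.\<close>

definition bad_tokens :: "nat \<Rightarrow> nat \<Rightarrow> bgraph \<Rightarrow> nat" where
  "bad_tokens j j' G = (if (v, j') \<in> G then 0 else \<Sum>i\<in>col G j \<inter> col G j'. card (blocked G i j'))"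

text \<open>The weight of one common neighbour, spread evenly over all \<open>m * D\<close> edges,
  whether usable or not.\<close>

definition tokw :: "nat \<Rightarrow> nat \<Rightarrow> real" where
  "tokw j j' = weight j j' / (m * D)"

lemma fin_free: "G \<in> Om \<Longrightarrow> finite (free G i j')"
  by (rule finite_subset[OF _ fin_graph]) (auto simp: legal_def)

lemma fin_tokens: "finite (tokens j j')"
  unfolding tokens_def using fin_above fin_col fin_free X_Om by (intro finite_SigmaI) auto

text \<open>At each graph the uncoupled weight is the generic part plus one \<open>weight\<close>
  per missing partner. Partners are missing because of common neighbours, split into usable and
  blocked tokens, or all at once because \<open>(v, j')\<close> is already an edge. Taking
  \<open>h\<close> constant gives the corresponding masses.\<close>

lemma residual_decomp:
  fixes h :: "bgraph \<Rightarrow> real"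
  assumes j: "j \<in> R - A" "j' \<in> R - A"
  shows "(\<Sum>G\<in>X j. (1 / N j - weight j j' * partners j j' G) * h G)
    = (generic j j' * (sum h (X j) / N j) + tokw j j' * (\<Sum>q\<in>tokens j j'. h (fst (fst q))))
      + weight j j' * r j' * sum h (above (insert j' (insert j A))) + tokw j j' * (\<Sum>G\<in>X j. bad_tokens j j' G * h G)"
proof -
  have N: "N j \<noteq> 0" using N_pos[OF j(1)] by simp
  have md: "m * D \<noteq> 0" using m_bounds D_ge_1 by simp
  define lg where "lg = (\<lambda>G. if (v, j') \<in> G then 0 else \<Sum>i\<in>col G j \<inter> col G j'. card (free G i j'))"
  have "(1 / N j - weight j j' * partners j j' G) * h G
      = generic j j' / N j * h G + tokw j j' * (lg G * h G) + weight j j' * r j' * (if (v, j') \<in> G then h G else 0)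
        + tokw j j' * (bad_tokens j j' G * h G)" if G: "G \<in> X j" for G
  proof -
    have 1: "1 / N j = generic j j' / N j + weight j j' * r j'" using N by (simp add: generic_def field_simps)
    have 2: "weight j j' * (real (r j') - partners j j' G)
       = tokw j j' * lg G + weight j j' * r j' * (if (v, j') \<in> G then 1 else 0) + tokw j j' * bad_tokens j j' G"
    proof (cases "(v, j') \<in> G")
      case True
      then show ?thesis using partners_eq[OF G] by (simp add: lg_def bad_tokens_def)
    next
      case False
      have "card (col G j \<inter> col G j') \<le> r j'"
        using card_col[OF X_Om[OF G]] fin_col[OF X_Om[OF G]] by (metis card_mono inf_le2)
      then have "real (r j') - partners j j' G = card (col G j \<inter> col G j')"
        using partners_eq[OF G, of j'] False by simp
      moreover have "card (col G j \<inter> col G j') * (card L * d) = lg G + bad_tokens j j' G"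
      proof -
        have "lg G + bad_tokens j j' G = (\<Sum>i\<in>col G j \<inter> col G j'. card (free G i j') + card (blocked G i j'))"
          using False by (simp add: lg_def bad_tokens_def sum.distrib)
        also have "\<dots> = (\<Sum>i\<in>col G j \<inter> col G j'. card L * d)"
          using X_Om[OF G] card_free_blocked by (intro sum.cong refl) (simp add: col_iff)
        finally show ?thesis by simp
      qed
      then have "real (card (col G j \<inter> col G j')) * (m * D) = real (lg G) + bad_tokens j j' G"
        unfolding D_def by (metis of_nat_add of_nat_mult)
      then have "real (card (col G j \<inter> col G j')) = (real (lg G) + bad_tokens j j' G) / (m * D)"
        using md by (simp add: field_simps)
      ultimately show ?thesis using False by (simp add: tokw_def add_divide_distrib distrib_left)
    qed
    have "(1 / N j - weight j j' * partners j j' G) * h G = (generic j j' / N j + weight j j' * (real (r j') - partners j j' G)) * h G"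
      unfolding 1 by (simp add: right_diff_distrib)
    then show ?thesis unfolding 2 by (simp add: distrib_right)
  qed
  then have "(\<Sum>G\<in>X j. (1 / N j - weight j j' * partners j j' G) * h G)
    = generic j j' * (sum h (X j) / N j) + tokw j j' * (\<Sum>G\<in>X j. lg G * h G)
      + weight j j' * r j' * (\<Sum>G\<in>X j. if (v, j') \<in> G then h G else 0) + tokw j j' * (\<Sum>G\<in>X j. bad_tokens j j' G * h G)"
    by (simp add: sum.distrib sum_distrib_left sum_divide_distrib mult.assoc)
  moreover have "(\<Sum>G\<in>X j. if (v, j') \<in> G then h G else 0) = sum h (above (insert j' (insert j A)))"
  proof -
    have "above (insert j' (insert j A)) = {G \<in> X j. (v, j') \<in> G}" by (auto simp: above_def row_iff)
    then show ?thesis using sum.inter_filter[OF fin_above, where g = h and P = "\<lambda>G. (v, j') \<in> G"] by simp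
  qed
  moreover have "(\<Sum>G\<in>X j. lg G * h G) = (\<Sum>q\<in>tokens j j'. h (fst (fst q)))"
  proof -
    have "(\<Sum>q\<in>tokens j j'. h (fst (fst q)))
        = (\<Sum>p\<in>(SIGMA G : {G \<in> X j. (v, j') \<notin> G}. col G j \<inter> col G j'). card (free (fst p) (snd p) j') * h (fst p))"
      unfolding tokens_def using fin_above fin_col fin_free X_Om
      by (subst sum.Sigma[symmetric, unfolded case_prod_beta]) (auto simp: case_prod_beta)
    also have "\<dots> = (\<Sum>G\<in>{G \<in> X j. (v, j') \<notin> G}. \<Sum>i\<in>col G j \<inter> col G j'. card (free G i j') * h G)"
      using fin_above fin_col X_Om by (subst sum.Sigma) (auto simp: case_prod_beta)
    also have "\<dots> = (\<Sum>G\<in>X j. lg G * h G)"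
      by (subst sum.inter_filter[OF fin_above]) (auto intro!: sum.cong simp: lg_def sum_distrib_right)
    finally show ?thesis by simp
  qed
  ultimately show ?thesis by simp
qed

definition moved :: "nat \<Rightarrow> (bgraph \<times> nat) \<times> (nat \<times> nat) \<Rightarrow> bgraph" where
  "moved j' = (\<lambda>((G, i), (i2, k2)). switch G i j' i2 k2)"

definition arrivals :: "nat \<Rightarrow> nat \<Rightarrow> bgraph \<Rightarrow> nat" where
  "arrivals j j' G = card {q \<in> tokens j j'. moved j' q = G}"

text \<open>Number of ways to choose the data of a reverse switch: a neighbour of \<open>j\<close>
  other than \<open>v\<close>, another edge at it, and a neighbour of \<open>j'\<close>. It does not
  depend on the graph.\<close>

definition max_tokens :: "nat \<Rightarrow> nat \<Rightarrow> nat" where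
  "max_tokens j j' = (r j - 1) * ((d - 1) * r j')"

abbreviation "arriving j j' G \<equiv> {(i, k, i2). (v, j') \<notin> G \<and> i \<noteq> v \<and> (i, j) \<in> G \<and> k \<noteq> j \<and> i2 \<noteq> v \<and> legal G i k i2 j'}"
abbreviation "candidates j j' G \<equiv> (SIGMA i : col G j - {v}. (row G i - {j}) \<times> col G j')"

lemma tokens_D:
  assumes "((G, i), (i2, k2)) \<in> tokens j j'"
  shows "G \<in> X j" "(v, j') \<notin> G" "(i, j) \<in> G" "(i, j') \<in> G" "i2 \<noteq> v" "legal G i j' i2 k2" "i \<noteq> v"
  using assms by (auto simp: tokens_def col_iff)

lemma moved_in_X:
  assumes "q \<in> tokens j j'" "j' \<notin> insert j A"
  shows "moved j' q \<in> X j"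
proof -
  obtain G i i2 k2 where q: "q = ((G, i), (i2, k2))" by (metis surj_pair)
  note t = tokens_D[OF assms(1)[unfolded q]]
  show ?thesis using token_in_X(1)[OF t(1) assms(2) t(3,5,6)] by (simp add: q moved_def)
qed

lemma row_v_switch: "legal G i k i' k' \<Longrightarrow> i \<noteq> v \<Longrightarrow> i' \<noteq> v \<Longrightarrow> (v, b) \<in> switch G i k i' k' \<longleftrightarrow> (v, b) \<in> G"
  using row_switch[of G i k i' k' v] by (simp flip: row_iff)

text \<open>A token arriving at \<open>G\<close> is recovered by switching back, so arrivals
  correspond to the legal choices among \<open>candidates\<close>.\<close>

lemma arrivals_eq:
  assumes G: "G \<in> X j" and j: "j' \<notin> insert j A"
  shows "arrivals j j' G = card (arriving j j' G)"
proof -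
  let ?F = "\<lambda>(i, k, i2). ((switch G i k i2 j', i), (i2, k))"
  have "{q \<in> tokens j j'. moved j' q = G} = ?F ` arriving j j' G"
  proof (intro equalityI subsetI)
    fix q assume q: "q \<in> {q \<in> tokens j j'. moved j' q = G}"
    obtain H i i2 k where qq: "q = ((H, i), (i2, k))" by (metis surj_pair)
    have t: "H \<in> X j" "(v, j') \<notin> H" "(i, j) \<in> H" "(i, j') \<in> H" "i2 \<noteq> v" "legal H i j' i2 k" "i \<noteq> v"
      and HG: "switch H i j' i2 k = G"
      using q tokens_D[of H i i2 k j j'] by (auto simp: qq moved_def)
    have "(i, k, i2) \<in> arriving j j' G"
      using row_v_switch[OF t(6,7,5), of j'] token_in_X(2)[OF t(1) j t(3,5,6)] legal_switch[OF t(6)] t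
      unfolding HG by (auto simp: legal_def)
    moreover have "q = ?F (i, k, i2)" using switch_switch[OF t(6)] by (simp add: qq HG)
    ultimately show "q \<in> ?F ` arriving j j' G" by (rule rev_image_eqI)
  next
    fix q assume "q \<in> ?F ` arriving j j' G"
    then obtain i k i2 where q: "q = ((switch G i k i2 j', i), (i2, k))"
      and t: "(v, j') \<notin> G" "i \<noteq> v" "(i, j) \<in> G" "k \<noteq> j" "i2 \<noteq> v" "legal G i k i2 j'" by auto
    have "switch G i k i2 j' \<in> X j"
      using G switch_in_graphs[OF X_Om[OF G] t(6)] t row_switch[OF t(6), of v] by (simp add: above_def)
    moreover have "(i, j) \<in> switch G i k i2 j'" using t by (auto simp: switch_def)
    ultimately show "q \<in> {q \<in> tokens j j'. moved j' q = G}"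
      using row_v_switch[OF t(6,2,5), of j'] t legal_switch[OF t(6)] switch_switch[OF t(6)]
      by (auto simp: q tokens_def moved_def col_iff legal_def)
  qed
  moreover have "inj_on ?F (arriving j j' G)" by (auto simp: inj_on_def)
  ultimately show ?thesis unfolding arrivals_def by (simp add: card_image)
qed

lemma fin_candidates: "G \<in> Om \<Longrightarrow> finite (candidates j j' G)"
  using fin_col fin_row by (intro finite_SigmaI finite_cartesian_product) auto

lemma arriving_sub: "arriving j j' G \<subseteq> candidates j j' G"
  by (auto simp: row_iff col_iff legal_def)

lemma card_candidates:
  assumes "G \<in> X j"
  shows "card (candidates j j' G) = max_tokens j j'"
proof -
  have G: "G \<in> Om" "(v, j) \<in> G" using assms by (auto simp: above_def row_iff)
  have "card (candidates j j' G) = (\<Sum>i\<in>col G j - {v}. card (row G i - {j}) * card (col G j'))"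
    using fin_col[OF G(1)] fin_row[OF G(1)] by (simp add: card_SigmaI card_cartesian_product)
  also have "\<dots> = (\<Sum>i\<in>col G j - {v}. (d - 1) * r j')"
    using card_row[OF G(1) edge_L[OF G(1)]] card_col[OF G(1)] fin_row[OF G(1)]
    by (intro sum.cong) (auto simp: col_iff row_iff card_Diff_singleton)
  also have "\<dots> = max_tokens j j'"
    using G fin_col[OF G(1)] card_col[OF G(1)] by (simp add: max_tokens_def col_iff card_Diff_singleton)
  finally show ?thesis .
qed

lemma arrivals_le: "G \<in> X j \<Longrightarrow> j' \<notin> insert j A \<Longrightarrow> arrivals j j' G \<le> max_tokens j j'"
  using card_mono[OF fin_candidates arriving_sub] X_Om by (simp add: arrivals_eq flip: card_candidates)

lemma max_tokens_arrivals:
  assumes "G \<in> X j" "j' \<notin> insert j A"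
  shows "max_tokens j j' - arrivals j j' G = card (candidates j j' G - arriving j j' G)"
  using card_Diff_subset[OF finite_subset[OF arriving_sub fin_candidates[OF X_Om[OF assms(1)]]] arriving_sub]
  by (simp add: arrivals_eq[OF assms] card_candidates[OF assms(1)])

text \<open>What matters is that the bound holds for the sum over all \<open>j'\<close>. A failing
  candidate has its edge \<open>(i2, j')\<close> near \<open>v\<close>, \<open>i\<close> or
  \<open>k\<close>, namely among 4 d^2 edges for each of at most d^2 pairs
  \<open>(i, k)\<close>.\<close>

lemma sum_max_tokens_arrivals:
  assumes G: "G \<in> X j"
  shows "(\<Sum>j'\<in>R - insert j A. max_tokens j j' - arrivals j j' G) \<le> 4 * d ^ 4"
proof -
  have GO: "G \<in> Om" using X_Om[OF G] .
  define BE where "BE = (\<lambda>i k. {(i2, b). (i2, b) \<in> G \<and> i2 \<in> {v}} \<union> {(i2, b). (i2, b) \<in> G \<and> i2 \<in> col G k}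
    \<union> {(i2, b). (i2, b) \<in> G \<and> b \<in> row G v} \<union> {(i2, b). (i2, b) \<in> G \<and> b \<in> row G i})"
  have finBE: "finite (BE i k)" for i k
    by (rule finite_subset[OF _ fin_graph[OF GO]]) (auto simp: BE_def)
  have cBE: "card (BE i k) \<le> 4 * (d * d)" for i k
  proof -
    have "card (BE i k) \<le> 1 * d + d * d + d * d + d * d"
      unfolding BE_def
      using card_rows[OF GO, of "{v}" 1] card_rows[OF GO fin_col[OF GO] card_col_le[OF GO], of k]
        card_cols[OF GO fin_row[OF GO] card_row_le[OF GO], of i] card_cols[OF GO fin_row[OF GO] card_row_le[OF GO], of v]
      by (intro order_trans[OF card_Un_le] add_mono) auto
    moreover have "d \<le> d * d" using d_pos by simp
    ultimately show ?thesis by linarith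
  qed
  let ?B = "SIGMA i : col G j. SIGMA k : row G i. BE i k"
  have "(\<Sum>j'\<in>R - insert j A. max_tokens j j' - arrivals j j' G) = (\<Sum>j'\<in>R - insert j A. card (candidates j j' G - arriving j j' G))"
    by (intro sum.cong) (auto simp: max_tokens_arrivals[OF G])
  also have "\<dots> = card (SIGMA j' : R - insert j A. candidates j j' G - arriving j j' G)"
    using finR fin_candidates[OF GO] by (subst card_SigmaI) auto
  also have "\<dots> \<le> card ?B"
  proof (rule card_inj_on_le)
    let ?F = "\<lambda>(j', i, k, i2). (i, k, (i2, j'))"
    show "inj_on ?F (SIGMA j' : R - insert j A. candidates j j' G - arriving j j' G)" by (auto simp: inj_on_def)
    show "?F ` (SIGMA j' : R - insert j A. candidates j j' G - arriving j j' G) \<subseteq> ?B"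
      by (auto simp: BE_def row_iff col_iff legal_def)
    show "finite ?B" using fin_col[OF GO] fin_row[OF GO] finBE by (intro finite_SigmaI) auto
  qed
  also have "card ?B = (\<Sum>i\<in>col G j. \<Sum>k\<in>row G i. card (BE i k))"
    using fin_col[OF GO] fin_row[OF GO] finBE by (simp add: card_SigmaI)
  also have "\<dots> \<le> (\<Sum>i\<in>col G j. \<Sum>k\<in>row G i. 4 * (d * d))" by (intro sum_mono cBE)
  also have "\<dots> = (\<Sum>i\<in>col G j. card (row G i) * (4 * (d * d)))" by simp
  also have "\<dots> \<le> (\<Sum>i\<in>col G j. d * (4 * (d * d)))" using card_row_le[OF GO] by (intro sum_mono mult_le_mono1)
  also have "\<dots> = card (col G j) * (d * (4 * (d * d)))" by simp
  also have "\<dots> \<le> d * (d * (4 * (d * d)))" using card_col_le[OF GO] by (intro mult_le_mono1)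
  also have "\<dots> = 4 * d ^ 4" by (simp add: power4_eq_xxxx ac_simps)
  finally show ?thesis .
qed

text \<open>Again the total over \<open>j'\<close> is bounded: a common neighbour \<open>i\<close>
  is adjacent to \<open>j\<close>, then \<open>j'\<close> is adjacent to \<open>i\<close>, and each
  such pair has at most 3 d^2 blocked edges.\<close>

lemma sum_bad_tokens:
  assumes GO: "G \<in> Om"
  shows "(\<Sum>j'\<in>R - insert j A. bad_tokens j j' G) \<le> 3 * d ^ 4"
proof -
  have "(\<Sum>j'\<in>R - insert j A. bad_tokens j j' G) \<le> (\<Sum>j'\<in>R - insert j A. \<Sum>i\<in>{i \<in> col G j. (i, j') \<in> G}. 3 * d\<^sup>2)"
  proof (intro sum_mono)
    fix j'
    have "col G j \<inter> col G j' = {i \<in> col G j. (i, j') \<in> G}" by (auto simp: col_iff)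
    then show "bad_tokens j j' G \<le> (\<Sum>i\<in>{i \<in> col G j. (i, j') \<in> G}. 3 * d\<^sup>2)"
      using sum_mono[of "col G j \<inter> col G j'" "\<lambda>i. card (blocked G i j')" "\<lambda>_. 3 * d\<^sup>2"] card_blocked[OF GO]
      by (simp add: bad_tokens_def)
  qed
  also have "\<dots> = (\<Sum>i\<in>col G j. \<Sum>j'\<in>{j' \<in> R - insert j A. (i, j') \<in> G}. 3 * d\<^sup>2)"
    using finR fin_col[OF GO] by (intro sum.swap_restrict) auto
  also have "\<dots> \<le> (\<Sum>i\<in>col G j. d * (3 * d\<^sup>2))"
  proof (intro sum_mono)
    fix i
    have "card {j' \<in> R - insert j A. (i, j') \<in> G} \<le> card (row G i)"
      by (intro card_mono fin_row GO) (auto simp: row_iff)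
    then have "card {j' \<in> R - insert j A. (i, j') \<in> G} \<le> d" using card_row_le[OF GO, of i] by simp
    then show "(\<Sum>j'\<in>{j' \<in> R - insert j A. (i, j') \<in> G}. 3 * d\<^sup>2) \<le> d * (3 * d\<^sup>2)"
      by (simp only: sum_constant of_nat_id) (rule mult_le_mono1)
  qed
  also have "\<dots> = card (col G j) * (d * (3 * d\<^sup>2))" by simp
  also have "\<dots> \<le> d * (d * (3 * d\<^sup>2))" using card_col_le[OF GO] by (intro mult_le_mono1)
  also have "\<dots> = 3 * d ^ 4" by (simp add: power4_eq_xxxx power2_eq_square ac_simps)
  finally show ?thesis .
qed

lemma tokw_nonneg: "0 \<le> tokw j j'"
  unfolding tokw_def using weight_nonneg D_ge_1 m_bounds by simp

text \<open>Generic part and usable tokens are treated jointly by \<open>hel_transport\<close>; the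
  graphs containing both edges at \<open>v\<close> and the blocked tokens are added by
  subadditivity.\<close>

lemma residual_bound:
  assumes j: "j \<in> R - A" "j' \<in> R - A" "j \<noteq> j'"
  shows "hel (residual j j') (defect j j' * u)
    \<le> 2 * tokw j j' * (\<Sum>q\<in>tokens j j'. hel (f (fst (fst q))) (f (moved j' q)))
      + 5 * generic j j' / N j * hel (s j) (N j * u)
      + 2 * tokw j j' * (\<Sum>G\<in>X j. real (max_tokens j j' - arrivals j j' G) * hel (f G) u)
      + weight j j' * r j' * hel (sum f (above (insert j' (insert j A)))) (card (above (insert j' (insert j A))) * u)
      + tokw j j' * (\<Sum>G\<in>X j. bad_tokens j j' G * hel (f G) u)"
proof -
  let ?Y = "above (insert j' (insert j A))"
  have jj: "j' \<notin> insert j A" using j by auto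
  have N: "0 < N j" using N_pos[OF j(1)] .
  have e: "defect j j' = (generic j j' + tokw j j' * card (tokens j j')) + weight j j' * r j' * card ?Y + tokw j j' * (\<Sum>G\<in>X j. bad_tokens j j' G)"
  proof -
    have "(\<Sum>G\<in>X j. (1 / N j - weight j j' * partners j j' G) * 1) = defect j j'"
      using N by (simp add: defect_def card_pairs sum_subtractf flip: sum_distrib_left)
    then show ?thesis using residual_decomp[OF j(1,2), of "\<lambda>_. 1"] N by simp
  qed
  have r: "residual j j' = (generic j j' * (s j / N j) + tokw j j' * (\<Sum>q\<in>tokens j j'. f (fst (fst q))))
      + weight j j' * r j' * sum f ?Y + tokw j j' * (\<Sum>G\<in>X j. bad_tokens j j' G * f G)"
    unfolding residual_def by (rule residual_decomp[OF j(1,2)])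
  have al0: "0 \<le> generic j j'" using generic_ge[OF j(1,2)] D_ge_1 m_bounds by (smt (verit) divide_nonneg_nonneg)
  have fq: "0 < f (fst (fst q))" if "q \<in> tokens j j'" for q
    using that by (intro f_above[of _ "insert j A"] tokens_D(1)[of _ "snd (fst q)" "fst (snd q)" "snd (snd q)" _ j']) simp
  \<comment> \<open>\<open>max_tokens\<close> is at most \<open>D^2 * r j'\<close>, so the left side
    is at most \<open>2 * D / m\<close>. This is exactly the uniform mass reserved by the factor
    \<open>1 - 2 * D / m\<close> in \<open>weight\<close>.\<close>
  have T: "2 * tokw j j' * max_tokens j j' * card (X j) \<le> generic j j'"
  proof -
    have "max_tokens j j' \<le> (d * d) * r j'"
      unfolding max_tokens_def using r_le[of j] by (simp only: mult.assoc) (intro mult_le_mono, auto)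
    then have "real (max_tokens j j') \<le> D\<^sup>2 * r j'"
      unfolding D_def power2_eq_square by (metis of_nat_le_iff of_nat_mult)
    then have "tokw j j' * N j * max_tokens j j' \<le> tokw j j' * N j * (D\<^sup>2 * r j')"
      using tokw_nonneg by (intro mult_left_mono) auto
    also have "\<dots> = (weight j j' * r j' * N j) * (D / m)"
      using D_ge_1 m_bounds by (simp add: tokw_def power2_eq_square)
    also have "\<dots> \<le> 1 * (D / m)"
      using weight_le[OF j(1,2)] D_ge_1 m_bounds theta_bounds by (intro mult_right_mono) (auto simp: divide_nonneg_nonneg order_trans)
    finally have "2 * (tokw j j' * N j * max_tokens j j') \<le> 2 * D / m" by simp
    moreover have "2 * tokw j j' * max_tokens j j' * card (X j) = 2 * (tokw j j' * N j * max_tokens j j')" by simp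
    ultimately show ?thesis using generic_ge[OF j(1,2)] by linarith
  qed
  have 1: "hel (generic j j' * (s j / N j) + tokw j j' * (\<Sum>q\<in>tokens j j'. f (fst (fst q)))) ((generic j j' + tokw j j' * card (tokens j j')) * u)
    \<le> 2 * tokw j j' * (\<Sum>q\<in>tokens j j'. hel (f (fst (fst q))) (f (moved j' q)))
      + 5 * generic j j' / N j * hel (s j) (N j * u)
      + 2 * tokw j j' * (\<Sum>G\<in>X j. (real (max_tokens j j') - card {q \<in> tokens j j'. moved j' q = G}) * hel (f G) u)"
  proof (rule hel_transport[OF fin_above fin_tokens X_ne[OF j(1)] _ _ _ tokw_nonneg u_gt_0 _ T])
    show "fst (fst q) \<in> X j" if "q \<in> tokens j j'" for q
      using that tokens_D(1)[of "fst (fst q)" "snd (fst q)" "fst (snd q)" "snd (snd q)"] by simp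
    show "moved j' q \<in> X j" if "q \<in> tokens j j'" for q using moved_in_X[OF that jj] .
    show "real (card {q \<in> tokens j j'. moved j' q = G}) \<le> real (max_tokens j j')" if "G \<in> X j" for G
      using arrivals_le[OF that jj] by (simp add: arrivals_def)
  qed (rule f_above)
  have 2: "hel (weight j j' * r j' * sum f ?Y) (weight j j' * r j' * card ?Y * u) = weight j j' * r j' * hel (sum f ?Y) (card ?Y * u)"
    using hel_scale[of "weight j j' * r j'" "sum f ?Y" "card ?Y * u"] weight_nonneg by (simp add: mult.assoc)
  have 3: "hel (tokw j j' * (\<Sum>G\<in>X j. bad_tokens j j' G * f G)) (tokw j j' * (\<Sum>G\<in>X j. bad_tokens j j' G) * u)
      \<le> tokw j j' * (\<Sum>G\<in>X j. bad_tokens j j' G * hel (f G) u)"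
  proof -
    have "hel (tokw j j' * (\<Sum>G\<in>X j. bad_tokens j j' G * f G)) (tokw j j' * (\<Sum>G\<in>X j. bad_tokens j j' G) * u)
       = tokw j j' * hel (\<Sum>G\<in>X j. bad_tokens j j' G * f G) (\<Sum>G\<in>X j. bad_tokens j j' G * u)"
      using hel_scale[OF tokw_nonneg, of j j' "\<Sum>G\<in>X j. bad_tokens j j' G * f G" "(\<Sum>G\<in>X j. bad_tokens j j' G) * u"]
      by (simp add: mult.assoc sum_distrib_right)
    also have "\<dots> \<le> tokw j j' * (\<Sum>G\<in>X j. hel (bad_tokens j j' G * f G) (bad_tokens j j' G * u))"
      using f_above_nonneg u_gt_0 by (intro mult_left_mono hel_sum tokw_nonneg) auto
    finally show ?thesis by (simp add: hel_scale)
  qed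
  have nn: "0 \<le> generic j j' * (s j / N j) + tokw j j' * (\<Sum>q\<in>tokens j j'. f (fst (fst q)))"
      "0 \<le> (generic j j' + tokw j j' * card (tokens j j')) * u"
      "0 \<le> weight j j' * r j' * sum f ?Y" "0 \<le> weight j j' * r j' * card ?Y * u"
      "0 \<le> tokw j j' * (\<Sum>G\<in>X j. bad_tokens j j' G * f G)" "0 \<le> tokw j j' * (\<Sum>G\<in>X j. bad_tokens j j' G) * u"
    using al0 tokw_nonneg weight_nonneg less_imp_le[OF u_gt_0] N f_above_nonneg less_imp_le[OF fq]
    by (auto intro!: add_nonneg_nonneg mult_nonneg_nonneg sum_nonneg divide_nonneg_nonneg)
  have 0: "hel (residual j j') (defect j j' * u)
     \<le> hel (generic j j' * (s j / N j) + tokw j j' * (\<Sum>q\<in>tokens j j'. f (fst (fst q)))) ((generic j j' + tokw j j' * card (tokens j j')) * u)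
      + hel (weight j j' * r j' * sum f ?Y) (weight j j' * r j' * card ?Y * u)
      + hel (tokw j j' * (\<Sum>G\<in>X j. bad_tokens j j' G * f G)) (tokw j j' * (\<Sum>G\<in>X j. bad_tokens j j' G) * u)"
    unfolding e r distrib_right[of _ _ u]
    by (intro order_trans[OF hel_add] add_mono order_refl add_nonneg_nonneg nn[unfolded distrib_right[of _ _ u]]) 
  have t: "(\<Sum>G\<in>X j. (real (max_tokens j j') - card {q \<in> tokens j j'. moved j' q = G}) * hel (f G) u)
      = (\<Sum>G\<in>X j. real (max_tokens j j' - arrivals j j' G) * hel (f G) u)"
    using arrivals_le[OF _ jj] by (intro sum.cong) (auto simp: arrivals_def of_nat_diff)
  show ?thesis
    by (rule order_trans[OF 0 add_mono[OF add_mono[OF 1[unfolded t] eq_refl[OF 2]] 3]])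
qed

section \<open>Summation over all pairs of neighbours\<close>

definition pairw :: "nat \<Rightarrow> nat \<Rightarrow> real" where
  "pairw j j' = N j * N j' / (2 * a * NA)"

lemma aNA: "0 < a * NA"
  using a_ge_1 NA_ge_1 by (intro mult_pos_pos) linarith+

lemma aNA_self: "a * NA / (a * NA) = 1"
  using aNA by (intro divide_self) linarith

lemma pairw_nonneg: "0 \<le> pairw j j'"
  by (simp add: pairw_def)

text \<open>One factor \<open>N j\<close> is cancelled by the weight of the matching, the other one
  is a share of order 1/m by \<open>N_upper\<close>.\<close>

lemma pairw_weight_r:
  assumes j: "j \<in> R - A" "j' \<in> R - A"
  shows "pairw j j' * (weight j j' * r j') \<le> 2 * D / m"
proof -
  have "pairw j j' * (weight j j' * r j') = (weight j j' * r j' * N j) * (N j' / (2 * (a * NA)))"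
    by (simp add: pairw_def ac_simps del: of_nat_diff)
  also have "\<dots> \<le> 1 * (N j' / (2 * (a * NA)))"
    using weight_le[OF j] aNA D_ge_1 m_bounds by (intro mult_right_mono) (auto simp: divide_nonneg_nonneg intro: order_trans)
  also have "\<dots> \<le> 2 * D / m"
  proof -
    define z where "z = a * NA"
    have "0 < z" "N j' \<le> 4 * D * z / m" using aNA N_upper[OF j(2)] by (simp_all only: z_def mult.assoc)
    then show ?thesis unfolding z_def[symmetric] using m_bounds(3) by (simp add: field_simps)
  qed
  finally show ?thesis .
qed

lemma pairw_weight:
  assumes j: "j \<in> R - A" "j' \<in> R - A"
  shows "pairw j j' * weight j j' \<le> 2 * D / m"
proof -
  have "pairw j j' * (weight j j' * 1) \<le> pairw j j' * (weight j j' * r j')"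
    using r_ge_1[OF j(2)] pairw_nonneg weight_nonneg by (intro mult_left_mono) auto
  then show ?thesis using pairw_weight_r[OF j] by simp
qed

lemma pairw_tokw:
  assumes j: "j \<in> R - A" "j' \<in> R - A"
  shows "pairw j j' * tokw j j' \<le> 2 / m\<^sup>2"
proof -
  have "pairw j j' * tokw j j' = (pairw j j' * weight j j') / (m * D)" by (simp add: tokw_def)
  also have "\<dots> \<le> (2 * D / m) / (m * D)" using pairw_weight[OF j] m_bounds D_ge_1 by (intro divide_right_mono) auto
  also have "\<dots> = 2 / m\<^sup>2" using D_ge_1 by (simp add: power2_eq_square)
  finally show ?thesis .
qed

lemma pairw_generic:
  assumes j: "j \<in> R - A" "j' \<in> R - A" "j \<noteq> j'"
  shows "pairw j j' * (5 * generic j j' / N j) \<le> 10 * D ^ 3 / m * (N j' / (a * NA))"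
proof -
  have "pairw j j' * (5 * generic j j' / N j) = generic j j' * (5 / 2 * (N j' / (a * NA)))"
    using N_pos[OF j(1)] by (simp add: pairw_def)
  also have "\<dots> \<le> 4 * D ^ 3 / m * (5 / 2 * (N j' / (a * NA)))"
    using generic_le[OF j] aNA by (intro mult_right_mono) auto
  finally show ?thesis by simp
qed

abbreviation "J' j \<equiv> R - insert j A"

definition vertex_sum :: real where
  "vertex_sum = (\<Sum>G\<in>above A. \<Sum>(i, k, i', k')\<in>switches G. if i = v then phi (f G) (f (switch G i k i' k')) else 0)"

text \<open>The number of common neighbours of \<open>i\<close> and \<open>v\<close> counts the
  possible \<open>j\<close> for a token switch at \<open>i\<close>. Summed over all
  \<open>v\<close>, it is bounded in terms of \<open>d\<close> alone.\<close>

definition near_sum :: real where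
  "near_sum = (\<Sum>G\<in>above A. \<Sum>(i, k, i', k')\<in>switches G. card (row G i \<inter> row G v) * hel (f G) (f (switch G i k i' k')))"

text \<open>Distinct triples \<open>(j, j', i)\<close> give distinct ordered switches with
  \<open>v\<close> in first position, so nothing is counted repeatedly.\<close>

lemma sum_pairs_le: "(\<Sum>j\<in>R - A. \<Sum>j'\<in>J' j. pairw j j' * (weight j j' * (\<Sum>(G, i)\<in>pairs j j'. phi (f G) (f (switch G v j i j')))))
   \<le> 2 * D / m * vertex_sum"
proof -
  have phi0: "0 \<le> phi (f G) (f (switch G i k i' k'))" if "G \<in> Om" "legal G i k i' k'" for G i k i' k'
    using that switch_in_graphs by (intro phi_nonneg f_pos) auto
  have "(\<Sum>j\<in>R - A. \<Sum>j'\<in>J' j. pairw j j' * (weight j j' * (\<Sum>(G, i)\<in>pairs j j'. phi (f G) (f (switch G v j i j')))))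
     \<le> (\<Sum>j\<in>R - A. \<Sum>j'\<in>J' j. 2 * D / m * (\<Sum>(G, i)\<in>pairs j j'. phi (f G) (f (switch G v j i j'))))"
    unfolding mult.assoc[symmetric]
    by (intro sum_mono mult_right_mono pairw_weight sum_nonneg) (auto simp: pairs_def above_def intro!: phi0)
  also have "\<dots> = 2 * D / m * (\<Sum>j\<in>R - A. \<Sum>j'\<in>J' j. \<Sum>(G, i)\<in>pairs j j'. phi (f G) (f (switch G v j i j')))"
    by (simp only: sum_distrib_left)
  also have "(\<Sum>j\<in>R - A. \<Sum>j'\<in>J' j. \<Sum>(G, i)\<in>pairs j j'. phi (f G) (f (switch G v j i j')))
      = (\<Sum>j\<in>R - A. \<Sum>G\<in>X j. \<Sum>j'\<in>J' j. \<Sum>i\<in>{i. legal G v j i j'}. phi (f G) (f (switch G v j i j')))"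
  proof (intro sum.cong refl)
    fix j
    have "(\<Sum>j'\<in>J' j. \<Sum>(G, i)\<in>pairs j j'. phi (f G) (f (switch G v j i j')))
      = (\<Sum>j'\<in>J' j. \<Sum>G\<in>X j. \<Sum>i\<in>{i. legal G v j i j'}. phi (f G) (f (switch G v j i j')))"
      unfolding pairs_def using fin_above fin_legal X_Om by (intro sum.cong refl sum.Sigma[symmetric]) auto
    then show "(\<Sum>j'\<in>J' j. \<Sum>(G, i)\<in>pairs j j'. phi (f G) (f (switch G v j i j')))
      = (\<Sum>G\<in>X j. \<Sum>j'\<in>J' j. \<Sum>i\<in>{i. legal G v j i j'}. phi (f G) (f (switch G v j i j')))"
      by (simp only: sum.swap[of _ "J' j" "X j"])
  qed
  also have "\<dots> = (\<Sum>G\<in>above A. \<Sum>j\<in>row G v - A. \<Sum>j'\<in>J' j. \<Sum>i\<in>{i. legal G v j i j'}. phi (f G) (f (switch G v j i j')))"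
    by (rule sum_extend)
  also have "\<dots> \<le> vertex_sum"
    unfolding vertex_sum_def
  proof (rule sum_mono)
    fix G assume "G \<in> above A"
    then have G: "G \<in> Om" by (simp add: above_def)
    define S where "S = (SIGMA j : row G v - A. SIGMA j' : J' j. {i. legal G v j i j'})"
    have "(\<Sum>j\<in>row G v - A. \<Sum>j'\<in>J' j. \<Sum>i\<in>{i. legal G v j i j'}. phi (f G) (f (switch G v j i j')))
       = (\<Sum>(j, j', i)\<in>S. phi (f G) (f (switch G v j i j')))"
      unfolding S_def using finR fin_row[OF G] fin_legal[OF G] by (simp add: sum.Sigma)
    also have "\<dots> \<le> (\<Sum>(i, k, i', k')\<in>switches G. if i = v then phi (f G) (f (switch G i k i' k')) else 0)"
      by (rule sum_le_inj[where \<phi> = "\<lambda>(j, j', i). (v, j, i, j')"])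
        (auto simp: S_def inj_on_def switches_def finite_switches[OF fin_graph[OF G], unfolded switches_def] intro!: phi0 G)
    finally show "(\<Sum>j\<in>row G v - A. \<Sum>j'\<in>J' j. \<Sum>i\<in>{i. legal G v j i j'}. phi (f G) (f (switch G v j i j')))
       \<le> (\<Sum>(i, k, i', k')\<in>switches G. if i = v then phi (f G) (f (switch G i k i' k')) else 0)" .
  qed
  finally show ?thesis using D_ge_1 m_bounds by (simp add: mult_left_mono divide_right_mono)
qed

text \<open>A token determines an ordered switch and a vertex \<open>j\<close> adjacent to both
  \<open>i\<close> and \<open>v\<close>; distinct tokens give distinct such data.\<close>

lemma sum_tokens_le: "(\<Sum>j\<in>R - A. \<Sum>j'\<in>J' j. pairw j j' * (2 * tokw j j' * (\<Sum>q\<in>tokens j j'. hel (f (fst (fst q))) (f (moved j' q)))))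
   \<le> 4 / m\<^sup>2 * near_sum"
proof -
  define h where "h = (\<lambda>G i k i' k'. hel (f G) (f (switch G i k i' k')))"
  have h0: "0 \<le> h G i k i' k'" for G i k i' k' by (simp add: h_def)
  have q: "(\<Sum>q\<in>tokens j j'. hel (f (fst (fst q))) (f (moved j' q)))
      = (\<Sum>G\<in>X j. \<Sum>i\<in>{i \<in> col G j \<inter> col G j'. (v, j') \<notin> G}. \<Sum>(i2, k2)\<in>free G i j'. h G i j' i2 k2)" for j j'
  proof -
    have "(\<Sum>q\<in>tokens j j'. hel (f (fst (fst q))) (f (moved j' q)))
      = (\<Sum>p\<in>(SIGMA G : {G \<in> X j. (v, j') \<notin> G}. col G j \<inter> col G j'). \<Sum>(i2, k2)\<in>free (fst p) (snd p) j'. h (fst p) (snd p) j' i2 k2)"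
      unfolding tokens_def using fin_above fin_col fin_free X_Om
      by (subst sum.Sigma) (auto simp: case_prod_beta h_def moved_def intro!: sum.cong)
    also have "\<dots> = (\<Sum>G\<in>{G \<in> X j. (v, j') \<notin> G}. \<Sum>i\<in>col G j \<inter> col G j'. \<Sum>(i2, k2)\<in>free G i j'. h G i j' i2 k2)"
      using fin_above fin_col X_Om by (subst sum.Sigma) (auto simp: case_prod_beta)
    also have "\<dots> = (\<Sum>G\<in>X j. \<Sum>i\<in>{i \<in> col G j \<inter> col G j'. (v, j') \<notin> G}. \<Sum>(i2, k2)\<in>free G i j'. h G i j' i2 k2)"
      by (subst sum.inter_filter[OF fin_above]) (auto intro!: sum.cong)
    finally show ?thesis .
  qed
  let ?h = "\<lambda>G j. \<Sum>j'\<in>J' j. \<Sum>i\<in>{i \<in> col G j \<inter> col G j'. (v, j') \<notin> G}. \<Sum>(i2, k2)\<in>free G i j'. h G i j' i2 k2"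
  have "(\<Sum>j\<in>R - A. \<Sum>j'\<in>J' j. pairw j j' * (2 * tokw j j' * (\<Sum>q\<in>tokens j j'. hel (f (fst (fst q))) (f (moved j' q)))))
     \<le> (\<Sum>j\<in>R - A. \<Sum>j'\<in>J' j. 4 / m\<^sup>2 * (\<Sum>q\<in>tokens j j'. hel (f (fst (fst q))) (f (moved j' q))))"
  proof (intro sum_mono)
    fix j j' assume "j \<in> R - A" "j' \<in> J' j"
    then have "pairw j j' * (2 * tokw j j') \<le> 4 / m\<^sup>2" using pairw_tokw[of j j'] by simp
    then show "pairw j j' * (2 * tokw j j' * (\<Sum>q\<in>tokens j j'. hel (f (fst (fst q))) (f (moved j' q))))
      \<le> 4 / m\<^sup>2 * (\<Sum>q\<in>tokens j j'. hel (f (fst (fst q))) (f (moved j' q)))"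
      unfolding mult.assoc[symmetric] by (intro mult_right_mono sum_nonneg) auto
  qed
  also have "\<dots> = 4 / m\<^sup>2 * (\<Sum>j\<in>R - A. \<Sum>G\<in>X j. ?h G j)"
    unfolding q sum_distrib_left[symmetric]
    by (intro arg_cong2[of _ _ _ _ "(*)"] sum.cong refl sum.swap)
  also have "(\<Sum>j\<in>R - A. \<Sum>G\<in>X j. ?h G j)
     = (\<Sum>G\<in>above A. \<Sum>j\<in>row G v - A. ?h G j)"
    by (rule sum_extend)
  also have "\<dots> \<le> near_sum"
    unfolding near_sum_def
  proof (rule sum_mono)
    fix G assume "G \<in> above A"
    then have G: "G \<in> Om" by (simp add: above_def)
    define S where "S = (SIGMA j : row G v - A. SIGMA j' : J' j. SIGMA i : {i \<in> col G j \<inter> col G j'. (v, j') \<notin> G}. free G i j')"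
    define T where "T = (SIGMA t : switches G. row G (fst t) \<inter> row G v)"
    have "(\<Sum>j\<in>row G v - A. ?h G j)
       = (\<Sum>(j, j', i, i2, k2)\<in>S. h G i j' i2 k2)"
      unfolding S_def using finR fin_row[OF G] fin_free[OF G] fin_col[OF G] by (simp add: sum.Sigma)
    also have "\<dots> \<le> (\<Sum>((i, k, i', k'), b)\<in>T. h G i k i' k')"
    proof (rule sum_le_inj[where \<phi> = "\<lambda>(j, j', i, i2, k2). ((i, j', i2, k2), j)"])
      show "finite T" unfolding T_def using finite_switches[OF fin_graph[OF G]] fin_row[OF G] by (intro finite_SigmaI) auto
    qed (auto simp: S_def T_def inj_on_def switches_def row_iff col_iff h0)
    also have "\<dots> = (\<Sum>t\<in>switches G. \<Sum>b\<in>row G (fst t) \<inter> row G v. case t of (i, k, i', k') \<Rightarrow> h G i k i' k')"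
      unfolding T_def using finite_switches[OF fin_graph[OF G]] fin_row[OF G]
      by (subst sum.Sigma) (auto simp: case_prod_beta)
    also have "\<dots> = (\<Sum>(i, k, i', k')\<in>switches G. card (row G i \<inter> row G v) * h G i k i' k')"
      by (intro sum.cong) auto
    finally show "(\<Sum>j\<in>row G v - A. ?h G j)
       \<le> (\<Sum>(i, k, i', k')\<in>switches G. card (row G i \<inter> row G v) * hel (f G) (f (switch G i k i' k')))"
      by (simp add: h_def)
  qed
  finally show ?thesis by (simp add: mult_left_mono divide_right_mono)
qed

text \<open>Converts a bound on a count summed over \<open>j'\<close> into one against the Hellinger
  sum over \<open>above A\<close>; the extra factor \<open>D\<close> bounds the number of choices of
  \<open>j\<close> in the row of \<open>v\<close>.\<close>

lemma sum_local:
  assumes c: "\<And>j j'. j \<in> R - A \<Longrightarrow> j' \<in> J' j \<Longrightarrow> c j j' \<le> (b::real)" "\<And>j j'. 0 \<le> c j j'"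
    and n: "\<And>j G. G \<in> X j \<Longrightarrow> (\<Sum>j'\<in>J' j. n j j' G) \<le> (K::nat)" and b: "0 \<le> b"
  shows "(\<Sum>j\<in>R - A. \<Sum>j'\<in>J' j. c j j' * (\<Sum>G\<in>X j. real (n j j' G) * hel (f G) u))
    \<le> b * (D * K) * (\<Sum>G\<in>above A. hel (f G) u)"
proof -
  have "(\<Sum>j\<in>R - A. \<Sum>j'\<in>J' j. c j j' * (\<Sum>G\<in>X j. real (n j j' G) * hel (f G) u))
     \<le> (\<Sum>j\<in>R - A. \<Sum>j'\<in>J' j. b * (\<Sum>G\<in>X j. real (n j j' G) * hel (f G) u))"
    using c by (intro sum_mono mult_right_mono sum_nonneg) auto
  also have "\<dots> = b * (\<Sum>j\<in>R - A. \<Sum>G\<in>X j. (\<Sum>j'\<in>J' j. real (n j j' G)) * hel (f G) u)"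
    unfolding sum_distrib_left[symmetric] sum_distrib_right
    by (intro arg_cong2[of _ _ _ _ "(*)"] sum.cong refl sum.swap)
  also have "\<dots> \<le> b * (\<Sum>j\<in>R - A. \<Sum>G\<in>X j. K * hel (f G) u)"
  proof (intro mult_left_mono sum_mono mult_right_mono b)
    fix j G assume "G \<in> X j"
    from n[OF this] show "(\<Sum>j'\<in>J' j. real (n j j' G)) \<le> real K"
      by (simp only: of_nat_sum[symmetric] of_nat_le_iff)
  qed auto
  also have "\<dots> = b * (a * (K * (\<Sum>G\<in>above A. hel (f G) u)))"
    unfolding sum_extend_const by (simp add: sum_distrib_left)
  also have "\<dots> \<le> b * (D * (K * (\<Sum>G\<in>above A. hel (f G) u)))"
    using b by (intro mult_left_mono mult_right_mono) (auto simp: D_def intro!: mult_nonneg_nonneg sum_nonneg)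
  finally show ?thesis by (simp add: mult.assoc)
qed

text \<open>All rows are compared with the one mean \<open>u\<close> of \<open>above A\<close>, also
  when \<open>B\<close> is larger than \<open>A\<close>; this lets the sums over extensions be
  iterated.\<close>

definition hel_rows :: "nat set \<Rightarrow> real" where
  "hel_rows B = (\<Sum>S\<in>rows B. hel (sum f (above S)) (card (above S) * u))"

lemma hel_rows_nonneg: "0 \<le> hel_rows B"
  unfolding hel_rows_def by (intro sum_nonneg) auto

lemma hel_le_hel_rows: "hel (sum f (above B)) (card (above B) * u) \<le> hel_rows B"
proof -
  have "hel (\<Sum>S\<in>rows B. sum f (above S)) (\<Sum>S\<in>rows B. card (above S) * u) \<le> hel_rows B"
    unfolding hel_rows_def using u_gt_0 f_above_nonneg by (intro hel_sum) (auto intro: sum_nonneg)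
  moreover have "(\<Sum>S\<in>rows B. card (above S) * u) = card (above B) * u"
    using sum_rows[of "\<lambda>_. 1" B] by (simp flip: sum_distrib_right)
  ultimately show ?thesis by (simp add: sum_rows)
qed

lemma hel_rows_extend: "(\<Sum>j\<in>R - B. hel_rows (insert j B)) \<le> D * hel_rows B"
proof -
  have "(\<Sum>j\<in>R - B. hel_rows (insert j B)) = real (d - card B) * hel_rows B"
    unfolding hel_rows_def by (rule sum_rows_extend)
  also have "\<dots> \<le> D * hel_rows B" using hel_rows_nonneg by (intro mult_right_mono) (auto simp: D_def)
  finally show ?thesis .
qed

lemma hel_rows_le: "hel_rows A \<le> row_ent A"
  unfolding hel_rows_def by (rule row_ent_ge_hel[OF neA u_def])

text \<open>The sum over \<open>j'\<close> is a total probability and disappears. The remaining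
  averages over \<open>X j\<close> are controlled by full rows, hence by the row entropy with a
  coefficient of order 1/m.\<close>

lemma sum_single_le: "(\<Sum>j\<in>R - A. \<Sum>j'\<in>J' j. pairw j j' * (5 * generic j j' / N j * hel (s j) (N j * u)))
   \<le> 10 * D ^ 4 / m * row_ent A"
proof -
  have "(\<Sum>j\<in>R - A. \<Sum>j'\<in>J' j. pairw j j' * (5 * generic j j' / N j * hel (s j) (N j * u)))
     \<le> (\<Sum>j\<in>R - A. \<Sum>j'\<in>R - A. 10 * D ^ 3 / m * (N j' / (a * NA)) * hel (s j) (N j * u))"
  proof (rule sum_mono)
    fix j assume j: "j \<in> R - A"
    have "(\<Sum>j'\<in>J' j. pairw j j' * (5 * generic j j' / N j * hel (s j) (N j * u)))
       \<le> (\<Sum>j'\<in>J' j. 10 * D ^ 3 / m * (N j' / (a * NA)) * hel (s j) (N j * u))"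
      unfolding mult.assoc[symmetric, of "pairw j _"] using j
      by (intro sum_mono mult_right_mono pairw_generic) auto
    also have "\<dots> \<le> (\<Sum>j'\<in>R - A. 10 * D ^ 3 / m * (N j' / (a * NA)) * hel (s j) (N j * u))"
      using finR D_ge_1 m_bounds by (intro sum_mono2) auto
    finally show "(\<Sum>j'\<in>J' j. pairw j j' * (5 * generic j j' / N j * hel (s j) (N j * u)))
       \<le> (\<Sum>j'\<in>R - A. 10 * D ^ 3 / m * (N j' / (a * NA)) * hel (s j) (N j * u))" .
  qed
  also have "\<dots> = (\<Sum>j\<in>R - A. 10 * D ^ 3 / m * hel (s j) (N j * u))"
  proof (intro sum.cong refl)
    fix j
    have "(\<Sum>j'\<in>R - A. 10 * D ^ 3 / m * (N j' / (a * NA)) * hel (s j) (N j * u))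
      = 10 * D ^ 3 / m * ((\<Sum>j'\<in>R - A. N j') / (a * NA)) * hel (s j) (N j * u)"
      by (simp only: sum_distrib_left[symmetric] sum_distrib_right[symmetric] sum_divide_distrib[symmetric])
    then show "(\<Sum>j'\<in>R - A. 10 * D ^ 3 / m * (N j' / (a * NA)) * hel (s j) (N j * u)) = 10 * D ^ 3 / m * hel (s j) (N j * u)"
      unfolding sum_N aNA_self by simp
  qed
  also have "\<dots> \<le> 10 * D ^ 3 / m * (\<Sum>j\<in>R - A. hel_rows (insert j A))"
    unfolding sum_distrib_left using D_ge_1 m_bounds by (intro sum_mono mult_left_mono hel_le_hel_rows) auto
  also have "\<dots> \<le> 10 * D ^ 3 / m * (D * row_ent A)"
    using hel_rows_extend[of A] hel_rows_le D_ge_1 m_bounds by (intro mult_left_mono) (auto intro: order_trans mult_left_mono)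
  finally show ?thesis by (simp add: power_numeral_reduce)
qed

lemma sum_double_le: "(\<Sum>j\<in>R - A. \<Sum>j'\<in>J' j. pairw j j' * (weight j j' * r j' *
      hel (sum f (above (insert j' (insert j A)))) (card (above (insert j' (insert j A))) * u)))
   \<le> 2 * D ^ 4 / m * row_ent A"
proof -
  have "(\<Sum>j\<in>R - A. \<Sum>j'\<in>J' j. pairw j j' * (weight j j' * r j' *
      hel (sum f (above (insert j' (insert j A)))) (card (above (insert j' (insert j A))) * u)))
    \<le> (\<Sum>j\<in>R - A. \<Sum>j'\<in>J' j. 2 * D / m * hel_rows (insert j' (insert j A)))"
  proof (intro sum_mono)
    fix j j' assume "j \<in> R - A" "j' \<in> J' j"
    then have "pairw j j' * (weight j j' * r j') * hel (sum f (above (insert j' (insert j A)))) (card (above (insert j' (insert j A))) * u)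
        \<le> 2 * D / m * hel_rows (insert j' (insert j A))"
      using D_ge_1 m_bounds by (intro mult_mono pairw_weight_r hel_le_hel_rows) auto
    then show "pairw j j' * (weight j j' * r j' *
        hel (sum f (above (insert j' (insert j A)))) (card (above (insert j' (insert j A))) * u))
        \<le> 2 * D / m * hel_rows (insert j' (insert j A))" by (simp only: mult.assoc)
  qed
  also have "\<dots> = 2 * D / m * (\<Sum>j\<in>R - A. \<Sum>j'\<in>J' j. hel_rows (insert j' (insert j A)))"
    by (simp only: sum_distrib_left)
  also have "\<dots> \<le> 2 * D / m * (\<Sum>j\<in>R - A. D * hel_rows (insert j A))"
    using D_ge_1 m_bounds by (intro mult_left_mono sum_mono hel_rows_extend) auto
  also have "\<dots> \<le> 2 * D / m * (D * (D * row_ent A))"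
    unfolding sum_distrib_left[symmetric] using hel_rows_extend[of A] hel_rows_le D_ge_1 m_bounds
    by (intro mult_left_mono) (auto intro: order_trans mult_left_mono)
  also have "\<dots> = 2 * D ^ 3 / m * row_ent A" by (simp add: power_numeral_reduce)
  \<comment> \<open>The power is raised so that this bound can be added to the one of
    \<open>sum_single_le\<close>.\<close>
  also have "\<dots> \<le> 2 * D ^ 4 / m * row_ent A"
  proof -
    have "D ^ 3 \<le> D ^ 4" using D_ge_1 by (intro power_increasing) auto
    moreover have "0 \<le> row_ent A" using hel_rows_le hel_rows_nonneg order_trans by blast
    ultimately show ?thesis using m_bounds by (intro mult_right_mono divide_right_mono) auto
  qed
  finally show ?thesis .
qed

lemma Lam_nonneg: "0 \<le> Lam"
  unfolding Lam_def using D_ge_1 by (intro add_nonneg_nonneg) auto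

text \<open>The shift by \<open>u\<close> costs the factor 20; \<open>pairw\<close> is the pair
  weight divided by twice the total weight \<open>a * NA\<close>, as in
  \<open>psi_sum_le_phi_sum\<close>.\<close>

lemma step_ent_le_pairs:
  "step_ent A \<le> 20 * (\<Sum>j\<in>R - A. \<Sum>j'\<in>R - A. pairw j j' * phi (s j / N j + u) (s j' / N j' + u))"
proof -
  have Fp: "0 < s j / N j" if "j \<in> R - A" for j
    using N_pos[OF that] X_ne[OF that] fin_above f_above by (intro divide_pos_pos sum_pos) auto
  have "step_ent A = (\<Sum>j\<in>R - A. psi (s j) (N j * u))"
    by (rule step_ent_eq[OF neA u_def])
  also have "\<dots> = (\<Sum>j\<in>R - A. N j * psi (s j / N j) u)"
  proof (intro sum.cong refl)
    fix j assume j: "j \<in> R - A"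
    then show "psi (s j) (N j * u) = N j * psi (s j / N j) u"
      using psi_scale[OF N_pos[OF j] Fp[OF j] u_gt_0] N_pos[OF j] by simp
  qed
  also have "\<dots> \<le> (\<Sum>j\<in>R - A. N j * (20 * psi (s j / N j + u) (2 * u)))"
    using Fp u_gt_0 by (intro sum_mono mult_left_mono psi_shift_bound) auto
  also have "\<dots> = 20 * (\<Sum>j\<in>R - A. N j * psi (s j / N j + u) (2 * u))"
    by (simp add: sum_distrib_left ac_simps)
  also have "\<dots> \<le> 20 * ((\<Sum>j\<in>R - A. \<Sum>k\<in>R - A. N j * N k * phi (s j / N j + u) (s k / N k + u)) / (2 * (a * NA)))"
  proof (intro mult_left_mono psi_sum_le_phi_sum)
    have "(\<Sum>j\<in>R - A. N j * (s j / N j + u)) = (\<Sum>j\<in>R - A. s j + N j * u)"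
      using N_pos by (intro sum.cong) (auto simp: distrib_left)
    also have "\<dots> = a * sum f (above A) + a * NA * u"
      using sum_s sum_N by (simp add: sum.distrib flip: sum_distrib_right)
    also have "\<dots> = a * NA * (2 * u)" using NA_ge_1 by (simp add: u_def)
    finally show "a * NA * (2 * u) = (\<Sum>j\<in>R - A. N j * (s j / N j + u))" by simp
    show "0 < s j / N j + u" if "j \<in> R - A" for j using Fp[OF that] u_gt_0 by simp
  qed (use finR N_pos sum_N[symmetric] aNA u_gt_0 in \<open>simp_all del: of_nat_diff\<close>)
  finally show ?thesis by (simp add: pairw_def sum_divide_distrib mult.assoc)
qed

theorem step_ent_le:
  "step_ent A \<le> 40 * D / m * vertex_sum + 80 * Lam * (12 * D ^ 4 / m * row_ent A + 4 / m\<^sup>2 * near_sum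
      + 22 * D ^ 5 / m\<^sup>2 * ent (above A) f)"
proof -
  define p where "p = (\<lambda>j j'. phi (s j / N j + u) (s j' / N j' + u))"
  define w where "w = (\<lambda>j j'. \<Sum>(G, i)\<in>pairs j j'. phi (f G) (f (switch G v j i j')))"
  define h where "h = (\<lambda>j j'. hel (residual j j') (defect j j' * u))"
  define E where "E = (\<Sum>j\<in>R - A. \<Sum>j'\<in>J' j. pairw j j' * h j j')"
  have offdiag: "(\<Sum>j'\<in>R - A. pairw j j' * p j j') = (\<Sum>j'\<in>J' j. pairw j j' * p j j')" if "j \<in> R - A" for j
  proof -
    have "(\<Sum>j'\<in>R - A. pairw j j' * p j j') = pairw j j * p j j + (\<Sum>j'\<in>R - A - {j}. pairw j j' * p j j')"
      using that finR by (intro sum.remove) auto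
    moreover have "R - A - {j} = J' j" by auto
    moreover have "p j j = 0" by (simp add: p_def)
    ultimately show ?thesis by simp
  qed
  \<comment> \<open>\<open>pair_bound\<close> has one residual for each side; exchanging the names
    of \<open>j\<close> and \<open>j'\<close> identifies the two sums.\<close>
  have swap: "(\<Sum>j\<in>R - A. \<Sum>j'\<in>J' j. pairw j j' * h j' j) = E"
  proof -
    have e: "J' j = {j' \<in> R - A. j \<noteq> j'}" for j by auto
    have "(\<Sum>j\<in>R - A. \<Sum>j'\<in>J' j. pairw j j' * h j' j) = (\<Sum>j'\<in>R - A. \<Sum>j\<in>{j \<in> R - A. j \<noteq> j'}. pairw j j' * h j' j)"
      unfolding e using finR by (intro sum.swap_restrict) auto
    also have "\<dots> = E" unfolding E_def e
      by (intro sum.cong) (auto simp: pairw_def mult.commute)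
    finally show ?thesis .
  qed
  have "(\<Sum>j\<in>R - A. \<Sum>j'\<in>R - A. pairw j j' * p j j') = (\<Sum>j\<in>R - A. \<Sum>j'\<in>J' j. pairw j j' * p j j')"
    by (intro sum.cong offdiag) auto
  also have "\<dots> \<le> (\<Sum>j\<in>R - A. \<Sum>j'\<in>J' j. pairw j j' * (weight j j' * w j j') + 2 * Lam * (pairw j j' * h j j' + pairw j j' * h j' j))"
  proof (intro sum_mono)
    fix j j' assume "j \<in> R - A" "j' \<in> J' j"
    then have "pairw j j' * p j j' \<le> pairw j j' * (weight j j' * w j j' + 2 * Lam * (h j j' + h j' j))"
      unfolding p_def w_def h_def by (intro mult_left_mono pair_bound pairw_nonneg) auto
    then show "pairw j j' * p j j' \<le> pairw j j' * (weight j j' * w j j') + 2 * Lam * (pairw j j' * h j j' + pairw j j' * h j' j)"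
      by (simp add: algebra_simps)
  qed
  also have "\<dots> = (\<Sum>j\<in>R - A. \<Sum>j'\<in>J' j. pairw j j' * (weight j j' * w j j')) + 2 * Lam * (E + E)"
    using swap by (simp add: E_def sum.distrib distrib_left flip: sum_distrib_left)
  also have "\<dots> \<le> 2 * D / m * vertex_sum + 4 * Lam * E"
    using sum_pairs_le by (simp add: w_def)
  finally have 1: "step_ent A \<le> 20 * (2 * D / m * vertex_sum + 4 * Lam * E)"
    using step_ent_le_pairs by (simp add: p_def)
  define Q1 where "Q1 = (\<lambda>j j'. 2 * tokw j j' * (\<Sum>q\<in>tokens j j'. hel (f (fst (fst q))) (f (moved j' q))))"
  define Q2 where "Q2 = (\<lambda>j j'. 5 * generic j j' / N j * hel (s j) (N j * u))"
  define Q3 where "Q3 = (\<lambda>j j'. 2 * tokw j j' * (\<Sum>G\<in>X j. real (max_tokens j j' - arrivals j j' G) * hel (f G) u))"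
  define Q4 where "Q4 = (\<lambda>j j'. weight j j' * r j' * hel (sum f (above (insert j' (insert j A)))) (card (above (insert j' (insert j A))) * u))"
  define Q5 where "Q5 = (\<lambda>j j'. tokw j j' * (\<Sum>G\<in>X j. bad_tokens j j' G * hel (f G) u))"
  define He where "He = (\<Sum>G\<in>above A. hel (f G) u)"
  have Q3: "(\<Sum>j\<in>R - A. \<Sum>j'\<in>J' j. pairw j j' * Q3 j j') \<le> 4 / m\<^sup>2 * (D * real (4 * d ^ 4)) * He"
  proof -
    have "(\<Sum>j\<in>R - A. \<Sum>j'\<in>J' j. (pairw j j' * (2 * tokw j j')) * (\<Sum>G\<in>X j. real (max_tokens j j' - arrivals j j' G) * hel (f G) u))
        \<le> 4 / m\<^sup>2 * (D * real (4 * d ^ 4)) * He"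
      unfolding He_def
    proof (rule sum_local)
      show "pairw j j' * (2 * tokw j j') \<le> 4 / m\<^sup>2" if "j \<in> R - A" "j' \<in> J' j" for j j'
        using pairw_tokw[of j j'] that by simp
      show "(\<Sum>j'\<in>J' j. max_tokens j j' - arrivals j j' G) \<le> 4 * d ^ 4" if "G \<in> X j" for j G
        by (rule sum_max_tokens_arrivals[OF that])
    qed (use pairw_nonneg tokw_nonneg in auto)
    then show ?thesis by (simp only: Q3_def mult.assoc)
  qed
  have Q5: "(\<Sum>j\<in>R - A. \<Sum>j'\<in>J' j. pairw j j' * Q5 j j') \<le> 2 / m\<^sup>2 * (D * real (3 * d ^ 4)) * He"
  proof -
    have "(\<Sum>j\<in>R - A. \<Sum>j'\<in>J' j. (pairw j j' * tokw j j') * (\<Sum>G\<in>X j. real (bad_tokens j j' G) * hel (f G) u))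
        \<le> 2 / m\<^sup>2 * (D * real (3 * d ^ 4)) * He"
      unfolding He_def
    proof (rule sum_local)
      show "pairw j j' * tokw j j' \<le> 2 / m\<^sup>2" if "j \<in> R - A" "j' \<in> J' j" for j j'
        using pairw_tokw[of j j'] that by simp
      show "(\<Sum>j'\<in>J' j. bad_tokens j j' G) \<le> 3 * d ^ 4" if "G \<in> X j" for j G
        by (rule sum_bad_tokens[OF X_Om[OF that]])
    qed (use pairw_nonneg tokw_nonneg in auto)
    then show ?thesis by (simp only: Q5_def mult.assoc)
  qed
  have "E \<le> (\<Sum>j\<in>R - A. \<Sum>j'\<in>J' j. pairw j j' * (Q1 j j' + Q2 j j' + Q3 j j' + Q4 j j' + Q5 j j'))"
    unfolding E_def h_def Q1_def Q2_def Q3_def Q4_def Q5_def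
    by (intro sum_mono mult_left_mono residual_bound pairw_nonneg) auto
  also have "\<dots> = (\<Sum>j\<in>R - A. \<Sum>j'\<in>J' j. pairw j j' * Q1 j j') + (\<Sum>j\<in>R - A. \<Sum>j'\<in>J' j. pairw j j' * Q2 j j')
     + (\<Sum>j\<in>R - A. \<Sum>j'\<in>J' j. pairw j j' * Q3 j j') + (\<Sum>j\<in>R - A. \<Sum>j'\<in>J' j. pairw j j' * Q4 j j')
     + (\<Sum>j\<in>R - A. \<Sum>j'\<in>J' j. pairw j j' * Q5 j j')"
    by (simp add: distrib_left sum.distrib)
  also have "(\<Sum>j\<in>R - A. \<Sum>j'\<in>J' j. pairw j j' * Q1 j j') \<le> 4 / m\<^sup>2 * near_sum"
    using sum_tokens_le by (simp add: Q1_def)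
  also have "(\<Sum>j\<in>R - A. \<Sum>j'\<in>J' j. pairw j j' * Q2 j j') \<le> 10 * D ^ 4 / m * row_ent A"
    using sum_single_le by (simp add: Q2_def)
  also have "(\<Sum>j\<in>R - A. \<Sum>j'\<in>J' j. pairw j j' * Q4 j j') \<le> 2 * D ^ 4 / m * row_ent A"
    using sum_double_le by (simp add: Q4_def)
  also note Q3
  also note Q5
  finally have "E \<le> 4 / m\<^sup>2 * near_sum + 10 * D ^ 4 / m * row_ent A + 4 / m\<^sup>2 * (D * real (4 * d ^ 4)) * He
     + 2 * D ^ 4 / m * row_ent A + 2 / m\<^sup>2 * (D * real (3 * d ^ 4)) * He" by simp
  also have "\<dots> = 12 * D ^ 4 / m * row_ent A + 4 / m\<^sup>2 * near_sum + 22 * D ^ 5 / m\<^sup>2 * He"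
    by (simp add: D_def power_numeral_reduce field_simps)
  also have "\<dots> \<le> 12 * D ^ 4 / m * row_ent A + 4 / m\<^sup>2 * near_sum + 22 * D ^ 5 / m\<^sup>2 * ent (above A) f"
  proof -
    have "He \<le> ent (above A) f"
      unfolding He_def by (rule hel_sum_le_ent[OF fin_above neA _ u_def]) (rule f_above)
    then show ?thesis using D_ge_1 by (intro add_left_mono mult_left_mono) auto
  qed
  finally have "80 * Lam * E \<le> 80 * Lam * (12 * D ^ 4 / m * row_ent A + 4 / m\<^sup>2 * near_sum + 22 * D ^ 5 / m\<^sup>2 * ent (above A) f)"
    using Lam_nonneg by (intro mult_left_mono) auto
  then show ?thesis using 1 by simp
qed

end

section \<open>Induction on the number of left vertices\<close>

text \<open>Versions for a single graph and outside the locale, so that they can be summed over all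
  vertices \<open>v\<close>.\<close>

definition vertex_dir :: "nat \<Rightarrow> (bgraph \<Rightarrow> real) \<Rightarrow> bgraph \<Rightarrow> real" where
  "vertex_dir v f G = (\<Sum>(i, k, i', k')\<in>switches G. if i = v then phi (f G) (f (switch G i k i' k')) else 0)"

definition near_dir :: "nat \<Rightarrow> (bgraph \<Rightarrow> real) \<Rightarrow> bgraph \<Rightarrow> real" where
  "near_dir v f G = (\<Sum>(i, k, i', k')\<in>switches G. card (row G i \<inter> row G v) * hel (f G) (f (switch G i k i' k')))"

definition avoiding_dir :: "nat \<Rightarrow> (bgraph \<Rightarrow> real) \<Rightarrow> bgraph \<Rightarrow> real" where
  "avoiding_dir v f G = (\<Sum>(i, k, i', k')\<in>switches G. if i \<noteq> v \<and> i' \<noteq> v then phi (f G) (f (switch G i k i' k')) else 0)"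

lemma ent_reindex:
  assumes "bij_betw \<phi> Y X"
  shows "ent X f = ent Y (f \<circ> \<phi>)"
  using sum.reindex_bij_betw[OF assms, of f] sum.reindex_bij_betw[OF assms, of "\<lambda>x. f x * ln (f x)"]
    bij_betw_same_card[OF assms]
  by (simp add: ent_def mean_ent_def)

context degs_fun
begin

abbreviation "lam \<equiv> 4 + ln (1 + real d * (real (card L))\<^sup>2)"

lemma vdir_nonneg: "G \<in> Om \<Longrightarrow> 0 \<le> vertex_dir v f G"
  unfolding vertex_dir_def using switch_in_graphs f_pos
  by (intro sum_nonneg) (auto simp: switches_def intro!: phi_nonneg)

lemma neardir_nonneg: "0 \<le> near_dir v f G"
  unfolding near_dir_def by (intro sum_nonneg) auto

text \<open>\<open>row_ent_bound\<close> starting from the empty set. The coefficient of the row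
  entropy in \<open>step_ent_le\<close> is 80 * 12 = 960 times \<open>lam * d^4 / m\<close>, at most
  1/2 by the size assumption.\<close>

lemma row_ent_le:
  assumes large: "2 ^ (d + 1) * 3520 * real d ^ 5 * lam \<le> real (card L)"
  shows "row_ent {} \<le> 2 ^ (d + 1) * (40 * real d / card L * sum (vertex_dir v f) Om
    + 320 * lam / (real (card L))\<^sup>2 * sum (near_dir v f) Om + 1760 * lam * real d ^ 5 / (real (card L))\<^sup>2 * ent Om f)"
proof -
  define m where "m = real (card L)"
  define D where "D = real d"
  have D: "1 \<le> D" using d_pos by (simp add: D_def)
  have Dp: "1 \<le> D ^ 5" "D \<le> D ^ 5" "D ^ 3 \<le> D ^ 5" "D ^ 4 \<le> D ^ 5"
    using D power_increasing[of _ 5 D] power_increasing[of 1 5 D] by auto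
  have lam4: "4 \<le> lam" using D by simp
  have p2: "(2::real) \<le> 2 ^ (d + 1)" by simp
  have Dl: "D ^ 5 * 4 \<le> D ^ 5 * lam" using D Dp lam4 by (intro mult_left_mono) auto
  have m: "2 * 3520 * (D ^ 5 * lam) \<le> m"
  proof -
    have "0 \<le> 3520 * (D ^ 5 * lam)" using Dl Dp by linarith
    then have "2 * (3520 * (D ^ 5 * lam)) \<le> 2 ^ (d + 1) * (3520 * (D ^ 5 * lam))"
      by (intro mult_right_mono p2)
    then show ?thesis using large by (simp add: m_def D_def mult.assoc)
  qed
  have m0: "0 < m" using m Dl Dp by linarith
  have l1: "6 * d \<le> card L" 
  proof -
    have "6 * D \<le> m" using m Dl Dp D by linarith
    then show ?thesis unfolding m_def D_def by (metis of_nat_le_iff of_nat_mult of_nat_numeral)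
  qed
  have l2: "4 * d ^ 3 \<le> card L"
  proof -
    have "4 * D ^ 3 \<le> m" using m Dl Dp D by linarith
    then show ?thesis unfolding m_def D_def by (metis of_nat_le_iff of_nat_mult of_nat_numeral of_nat_power)
  qed
  define b where "b = (\<lambda>A. 40 * D / m * sum (vertex_dir v f) (above A) + 320 * lam / m\<^sup>2 * sum (near_dir v f) (above A)
    + 1760 * lam * D ^ 5 / m\<^sup>2 * ent (above A) f)"
  define g where "g = 960 * lam * D ^ 4 / m"
  have ent0: "0 \<le> ent (above A) f" for A by (intro ent_nonneg fin_above f_above)
  have b0: "0 \<le> b A" for A
    unfolding b_def using D m0 lam4 ent0 vdir_nonneg[OF subsetD[OF above_sub]] neardir_nonneg
    by (intro add_nonneg_nonneg mult_nonneg_nonneg divide_nonneg_nonneg sum_nonneg) auto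
  have "row_ent {} \<le> (2 ^ (d - card ({} :: nat set) + 1) - 2) * b {}"
  proof (rule row_ent_bound[where b = b and g = g])
    fix A assume A: "A \<subseteq> R" "card A < d"
    show "step_ent A \<le> b A + g * row_ent A"
    proof (cases "above A = {}")
      case True
      have e: "above B = {}" if "A \<subseteq> B" for B using True that by (auto simp: above_def)
      have "above (insert j A) = {}" for j by (rule e) auto
      then have "step_ent A = 0" using True by (simp add: step_ent_def)
      moreover have "(\<Sum>S\<in>rows A. mean_ent (above S) f) = 0"
        using e by (intro sum.neutral) (auto simp: rows_def)
      then have "row_ent A = 0" using True by (simp add: row_ent_def)
      ultimately show ?thesis using b0 by simp
    next
      case False
      interpret K: degs_key d L r f v A
        by unfold_locales (use A False l1 l2 in auto)
      have "K.vertex_sum = sum (vertex_dir v f) (above A)" "K.near_sum = sum (near_dir v f) (above A)"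
        by (simp_all add: K.vertex_sum_def K.near_sum_def vertex_dir_def near_dir_def)
      then have "step_ent A \<le> 40 * D / m * sum (vertex_dir v f) (above A) + 80 * lam * (12 * D ^ 4 / m * row_ent A
          + 4 / m\<^sup>2 * sum (near_dir v f) (above A) + 22 * D ^ 5 / m\<^sup>2 * ent (above A) f)"
        using K.step_ent_le by (simp add: K.Lam_def K.D_def m_def D_def)
      also have "\<dots> = b A + g * row_ent A"
        using m0 by (simp add: b_def g_def field_simps)
      finally show ?thesis .
    qed
    \<comment> \<open>The two Dirichlet terms are sums over graphs and extend with equality; only
      the entropy term needs \<open>ent_extend\<close>.\<close>
    have "(\<Sum>j\<in>R - A. b (insert j A))
       = 40 * D / m * (\<Sum>j\<in>R - A. sum (vertex_dir v f) (above (insert j A)))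
         + 320 * lam / m\<^sup>2 * (\<Sum>j\<in>R - A. sum (near_dir v f) (above (insert j A)))
         + 1760 * lam * D ^ 5 / m\<^sup>2 * (\<Sum>j\<in>R - A. ent (above (insert j A)) f)"
      unfolding b_def by (simp only: sum.distrib sum_distrib_left)
    also have "\<dots> \<le> 40 * D / m * (real (d - card A) * sum (vertex_dir v f) (above A))
         + 320 * lam / m\<^sup>2 * (real (d - card A) * sum (near_dir v f) (above A))
         + 1760 * lam * D ^ 5 / m\<^sup>2 * (real (d - card A) * ent (above A) f)"
      unfolding sum_extend_const using D m0 lam4 ent_extend
      by (intro add_left_mono mult_left_mono) auto
    also have "\<dots> = real (d - card A) * b A"
      by (simp add: b_def algebra_simps del: of_nat_diff)
    finally show "(\<Sum>j\<in>R - A. b (insert j A)) \<le> real (d - card A) * b A" .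
  next
    show "0 \<le> g" using D m0 lam4 by (auto simp: g_def)
    have "960 * (lam * D ^ 4) \<le> 960 * (lam * D ^ 5)" using Dp lam4 by (intro mult_left_mono) auto
    moreover have "0 \<le> D ^ 5 * lam" using Dl Dp by linarith
    ultimately have "960 * (lam * D ^ 4) * 2 \<le> m" using m by (simp only: mult.commute[of lam "D ^ 5"])
    then show "g \<le> 1 / 2" using m0 by (simp add: g_def field_simps)
  qed (use b0 in auto)
  also have "\<dots> \<le> 2 ^ (d + 1) * b {}" using b0[of "{}"] by (simp add: algebra_simps)
  finally show ?thesis by (simp add: b_def above_empty m_def D_def)
qed

text \<open>Deleting the edges at \<open>v\<close> is a bijection onto the graphs without
  \<open>v\<close> whose right degrees are lowered on \<open>S\<close>. Legal switches there are
  exactly the legal switches avoiding \<open>v\<close>.\<close>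

lemma ent_above_remove:
  assumes S: "S \<in> rows {}"
    and IH: "\<And>r' g. (\<And>j. r' j \<le> d) \<Longrightarrow> (\<And>G. G \<in> graphs d (L - {v}) r' \<Longrightarrow> 0 < g G) \<Longrightarrow>
      ent (graphs d (L - {v}) r') g \<le> c * dirichlet (graphs d (L - {v}) r') g"
  shows "ent (above S) f \<le> c * (\<Sum>G\<in>above S. avoiding_dir v f G)"
proof -
  have SR: "S \<subseteq> R" "card S = d" using S by (auto simp: rows_def)
  have finS: "finite S" using SR finR finite_subset by blast
  define r' where "r' = (\<lambda>j. r j - (if j \<in> S then 1 else 0))"
  define Y where "Y = graphs d (L - {v}) r'"
  define ex where "ex = (\<lambda>G. G \<union> {v} \<times> S)"
  define cu where "cu = (\<lambda>G::bgraph. G - {v} \<times> UNIV)"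
  have YD: "finite G" "fst ` G \<subseteq> L - {v}" "row G v = {}" "(v, j) \<notin> G" if "G \<in> Y" for G j
    using that by (force simp: Y_def graphs_def row_def)+
  have row_ex: "row (ex G) i = (if i = v then S else row G i)" if "G \<in> Y" for G i
    using YD(4)[OF that] by (auto simp: ex_def row_def)
  have ex_in: "ex G \<in> above S" if G: "G \<in> Y" for G
  proof -
    have "card (col (ex G) j) = r j" for j
    proof (cases "j \<in> S")
      case True
      have "col (ex G) j = insert v (col G j)" using True by (auto simp: ex_def col_def)
      moreover have "card (col G j) = r j - 1" using G True by (simp add: Y_def graphs_def r'_def)
      moreover have "0 < r j" using SR True by (auto simp: R_def)
      ultimately show ?thesis using YD[OF G] finite_col[OF YD(1)[OF G]] by (simp add: col_iff)
    next
      case False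
      then have "col (ex G) j = col G j" by (auto simp: ex_def col_def)
      then show ?thesis using G False by (simp add: Y_def graphs_def r'_def)
    qed
    moreover have "card (row (ex G) i) = d" if "i \<in> L" for i
      using row_ex[OF G] G that SR by (simp add: Y_def graphs_def)
    moreover have "finite (ex G)" "fst ` ex G \<subseteq> L" using YD[OF G] finS vL by (auto simp: ex_def)
    ultimately have "ex G \<in> Om" by (simp add: graphs_def)
    then show ?thesis using row_ex[OF G] by (simp add: above_def)
  qed
  have OS: "row G v = S" "G \<in> Om" if "G \<in> above S" for G using above_full[OF S] that by auto
  have cu_in: "cu G \<in> Y" if G: "G \<in> above S" for G
  proof -
    have GO: "G \<in> Om" "row G v = S" using OS[OF G] by auto
    have "col (cu G) j = col G j - {v}" for j by (auto simp: cu_def col_def)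
    moreover have "v \<in> col G j \<longleftrightarrow> j \<in> S" for j using GO(2) by (auto simp: col_def row_def)
    ultimately have "card (col (cu G) j) = r' j" for j
      using card_col[OF GO(1)] fin_col[OF GO(1)] by (simp add: r'_def card_Diff_singleton_if)
    moreover have "card (row (cu G) i) = d" if "i \<in> L - {v}" for i
    proof -
      have "row (cu G) i = row G i" using that by (auto simp: cu_def row_def)
      then show ?thesis using card_row[OF GO(1)] that by simp
    qed
    moreover have "finite (cu G)" "fst ` cu G \<subseteq> L - {v}"
      using fin_graph[OF GO(1)] edge_L[OF GO(1)] by (auto simp: cu_def)
    ultimately show ?thesis by (simp add: Y_def graphs_def)
  qed
  have bij: "bij_betw ex Y (above S)"
  proof (rule bij_betw_byWitness[where f' = cu])
    show "\<forall>G\<in>Y. cu (ex G) = G" using YD(4) by (auto simp: ex_def cu_def)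
    show "\<forall>G\<in>above S. ex (cu G) = G" using OS(1) by (auto simp: ex_def cu_def row_def)
  qed (use ex_in cu_in in auto)
  have "ent Y (f \<circ> ex) \<le> c * dirichlet Y (f \<circ> ex)"
    unfolding Y_def
  proof (rule IH)
    show "r' j \<le> d" for j using r_le[of j] by (simp add: r'_def)
    show "0 < (f \<circ> ex) G" if "G \<in> graphs d (L - {v}) r'" for G
      using f_above[OF ex_in] that by (simp add: Y_def)
  qed
  moreover have "dirichlet Y (f \<circ> ex) = (\<Sum>G\<in>above S. avoiding_dir v f G)"
  proof -
    have "(\<Sum>(i, k, i', k')\<in>switches G. phi ((f \<circ> ex) G) ((f \<circ> ex) (switch G i k i' k'))) = avoiding_dir v f (ex G)"
      if G: "G \<in> Y" for G
    proof -
      have l: "legal (ex G) i k i' k' \<and> i \<noteq> v \<and> i' \<noteq> v \<longleftrightarrow> legal G i k i' k'" for i k i' k'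
        using YD(4)[OF G] by (auto simp: legal_def ex_def)
      have e: "ex (switch G i k i' k') = switch (ex G) i k i' k'" if "legal G i k i' k'" for i k i' k'
        using that YD(4)[OF G] by (auto simp: legal_def ex_def switch_def)
      have "finite (switches (ex G))" using finite_switches fin_graph OS(2)[OF ex_in[OF G]] by blast
      then have "avoiding_dir v f (ex G)
          = (\<Sum>(i, k, i', k')\<in>{t \<in> switches (ex G). fst t \<noteq> v \<and> fst (snd (snd t)) \<noteq> v}. phi (f (ex G)) (f (switch (ex G) i k i' k')))"
        unfolding avoiding_dir_def by (subst sum.inter_filter) (auto intro!: sum.cong)
      also have "{t \<in> switches (ex G). fst t \<noteq> v \<and> fst (snd (snd t)) \<noteq> v} = switches G"
        by (auto simp: switches_def l[symmetric])
      also have "(\<Sum>(i, k, i', k')\<in>switches G. phi (f (ex G)) (f (switch (ex G) i k i' k')))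
          = (\<Sum>(i, k, i', k')\<in>switches G. phi ((f \<circ> ex) G) ((f \<circ> ex) (switch G i k i' k')))"
        using e by (intro sum.cong) (auto simp: switches_def)
      finally show ?thesis by simp
    qed
    then have "dirichlet Y (f \<circ> ex) = (\<Sum>G\<in>Y. avoiding_dir v f (ex G))" by (simp add: dirichlet_def)
    then show ?thesis using sum.reindex_bij_betw[OF bij] by simp
  qed
  ultimately show ?thesis using ent_reindex[OF bij] by simp
qed

end

context degs
begin

text \<open>A switch avoids all but two left vertices, and has exactly one vertex in first position.
  For the third sum, a vertex reaches others through at most d^2 paths of length two, endpoints
  counted with multiplicity.\<close>

lemma sum_vertices:
  assumes G: "G \<in> Om" and f: "\<And>G. G \<in> Om \<Longrightarrow> 0 < f G"
  shows "(\<Sum>v\<in>L. avoiding_dir v f G) = (real (card L) - 2) * (\<Sum>(i, k, i', k')\<in>switches G. phi (f G) (f (switch G i k i' k')))"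
    and "(\<Sum>v\<in>L. vertex_dir v f G) = (\<Sum>(i, k, i', k')\<in>switches G. phi (f G) (f (switch G i k i' k')))"
    and "(\<Sum>v\<in>L. near_dir v f G) \<le> (real d)\<^sup>2 * (\<Sum>(i, k, i', k')\<in>switches G. phi (f G) (f (switch G i k i' k')))"
proof -
  have sL: "i \<in> L" "i' \<in> L" "i \<noteq> i'" if "(i, k, i', k') \<in> switches G" for i k i' k'
    using that edge_L[OF G] legal_neq by (auto simp: switches_def legal_def)
  have "(\<Sum>v\<in>L. avoiding_dir v f G)
      = (\<Sum>t\<in>switches G. \<Sum>v\<in>L. case t of (i, k, i', k') \<Rightarrow> if i \<noteq> v \<and> i' \<noteq> v then phi (f G) (f (switch G i k i' k')) else 0)"
    unfolding avoiding_dir_def by (rule sum.swap)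
  also have "\<dots> = (\<Sum>(i, k, i', k')\<in>switches G. (real (card L) - 2) * phi (f G) (f (switch G i k i' k')))"
  proof (intro sum.cong refl, clarify)
    fix i k i' k' assume t: "(i, k, i', k') \<in> switches G"
    have "2 \<le> card L" using sL[OF t] finL card_mono[of L "{i, i'}"] by auto
    moreover have "{v \<in> L. i \<noteq> v \<and> i' \<noteq> v} = L - {i, i'}" by auto
    moreover have "card (L - {i, i'}) = card L - 2" using sL[OF t] finL by (simp add: card_Diff_subset)
    ultimately have "real (card {v \<in> L. i \<noteq> v \<and> i' \<noteq> v}) = real (card L) - 2" by simp
    then show "(\<Sum>v\<in>L. if i \<noteq> v \<and> i' \<noteq> v then phi (f G) (f (switch G i k i' k')) else 0)
      = (real (card L) - 2) * phi (f G) (f (switch G i k i' k'))"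
      using finL by (simp flip: sum.inter_filter)
  qed
  finally show "(\<Sum>v\<in>L. avoiding_dir v f G) = (real (card L) - 2) * (\<Sum>(i, k, i', k')\<in>switches G. phi (f G) (f (switch G i k i' k')))"
    by (simp add: sum_distrib_left case_prod_beta)
  have "(\<Sum>v\<in>L. vertex_dir v f G)
      = (\<Sum>t\<in>switches G. \<Sum>v\<in>L. case t of (i, k, i', k') \<Rightarrow> if i = v then phi (f G) (f (switch G i k i' k')) else 0)"
    unfolding vertex_dir_def by (rule sum.swap)
  also have "\<dots> = (\<Sum>(i, k, i', k')\<in>switches G. phi (f G) (f (switch G i k i' k')))"
    using sL finL by (intro sum.cong refl) (auto simp: sum.delta')
  finally show "(\<Sum>v\<in>L. vertex_dir v f G) = (\<Sum>(i, k, i', k')\<in>switches G. phi (f G) (f (switch G i k i' k')))" .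
  have nb: "(\<Sum>v\<in>L. card (row G i \<inter> row G v)) \<le> d * d" for i
  proof -
    have "(\<Sum>v\<in>L. card (row G i \<inter> row G v)) = (\<Sum>v\<in>L. \<Sum>j\<in>{j \<in> row G i. (v, j) \<in> G}. 1)"
      by (intro sum.cong refl) (auto simp: row_def intro!: arg_cong[of _ _ card])
    also have "\<dots> = (\<Sum>j\<in>row G i. \<Sum>v\<in>{v \<in> L. (v, j) \<in> G}. 1)"
      using finL fin_row[OF G] by (intro sum.swap_restrict) auto
    also have "\<dots> \<le> (\<Sum>j\<in>row G i. d)"
    proof (intro sum_mono)
      fix j
      have "{v \<in> L. (v, j) \<in> G} = col G j" using edge_L[OF G] by (auto simp: col_def)
      then show "(\<Sum>v\<in>{v \<in> L. (v, j) \<in> G}. 1) \<le> d" using card_col_le[OF G, of j] by simp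
    qed
    also have "\<dots> \<le> d * d" using card_row_le[OF G, of i] by simp
    finally show ?thesis .
  qed
  have "(\<Sum>v\<in>L. near_dir v f G)
      = (\<Sum>t\<in>switches G. \<Sum>v\<in>L. case t of (i, k, i', k') \<Rightarrow> real (card (row G i \<inter> row G v)) * hel (f G) (f (switch G i k i' k')))"
    unfolding near_dir_def by (rule sum.swap)
  also have "\<dots> \<le> (\<Sum>(i, k, i', k')\<in>switches G. (real d)\<^sup>2 * phi (f G) (f (switch G i k i' k')))"
  proof (intro sum_mono, clarify)
    fix i k i' k' assume t: "(i, k, i', k') \<in> switches G"
    have H: "switch G i k i' k' \<in> Om" using t switch_in_graphs[OF G] by (simp add: switches_def)
    have "(\<Sum>v\<in>L. real (card (row G i \<inter> row G v)) * hel (f G) (f (switch G i k i' k')))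
        = real (\<Sum>v\<in>L. card (row G i \<inter> row G v)) * hel (f G) (f (switch G i k i' k'))"
      by (simp add: sum_distrib_right)
    also have "\<dots> \<le> real (d * d) * phi (f G) (f (switch G i k i' k'))"
      using nb[of i] f[OF G] f[OF H] by (intro mult_mono hel_le_phi of_nat_mono) auto
    finally show "(\<Sum>v\<in>L. real (card (row G i \<inter> row G v)) * hel (f G) (f (switch G i k i' k')))
        \<le> (real d)\<^sup>2 * phi (f G) (f (switch G i k i' k'))" by (simp add: power2_eq_square)
  qed
  finally show "(\<Sum>v\<in>L. near_dir v f G) \<le> (real d)\<^sup>2 * (\<Sum>(i, k, i', k')\<in>switches G. phi (f G) (f (switch G i k i' k')))"
    by (simp add: sum_distrib_left case_prod_beta)
qed

text \<open>The sum over \<open>v\<close> of the one-vertex bounds. The number 3520 is twice the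
  coefficient 1760 of the entropy in \<open>row_ent_le\<close>, so that this entropy contributes at
  most \<open>en / 2\<close> after summation.\<close>

lemma ent_le_dirichlet_step:
  assumes large: "2 ^ (d + 1) * 3520 * real d ^ 5 * (4 + ln (1 + real d * (real (card L))\<^sup>2)) \<le> real (card L)"
    and f: "\<And>G. G \<in> Om \<Longrightarrow> 0 < f G"
    and M: "2 * (2 ^ (d + 1) * (40 * real d + 320 * (real d)\<^sup>2)) \<le> M"
    and IH: "\<And>v r' g. v \<in> L \<Longrightarrow> (\<And>j. r' j \<le> d) \<Longrightarrow> (\<And>G. G \<in> graphs d (L - {v}) r' \<Longrightarrow> 0 < g G) \<Longrightarrow>
      ent (graphs d (L - {v}) r') g \<le> M / (real (card L) - 1) * dirichlet (graphs d (L - {v}) r') g"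
  shows "ent Om f \<le> M / card L * dirichlet Om f"
proof (cases "Om = {}")
  case True
  then show ?thesis by (simp add: ent_def mean_ent_def dirichlet_def)
next
  case ne: False
  define m where "m = real (card L)"
  define D where "D = real d"
  define lam where "lam = 4 + ln (1 + D * m\<^sup>2)"
  define c where "c = (2::real) ^ (d + 1)"
  define K where "K = c * (40 * D + 320 * D\<^sup>2)"
  have D: "1 \<le> D" using d_pos by (simp add: D_def)
  have c: "2 \<le> c" by (simp add: c_def)
  have lam4: "4 \<le> lam" using D by (simp add: lam_def)
  have lg: "c * 3520 * D ^ 5 * lam \<le> m" using large by (simp add: c_def D_def lam_def m_def)
  have lm: "lam \<le> m"
  proof -
    have "1 * 1 * lam \<le> (c * 3520) * D ^ 5 * lam" using c D lam4 by (intro mult_right_mono mult_mono) auto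
    then show ?thesis using lg by simp
  qed
  have m4: "4 \<le> m" using lm lam4 by simp
  define dr where "dr = dirichlet Om f"
  define en where "en = ent Om f"
  have dr0: "0 \<le> dr" unfolding dr_def using dirichlet_nonneg f by blast
  have en0: "0 \<le> en" unfolding en_def using ent_nonneg fin_Om f by blast
  have M0: "0 \<le> M" "2 * K \<le> M" 
  proof -
    show "2 * K \<le> M" using M by (simp add: K_def c_def D_def)
    moreover have "0 \<le> K" using c D by (simp add: K_def)
    ultimately show "0 \<le> M" by linarith
  qed
  have one: "en \<le> M / (m - 1) * (\<Sum>G\<in>Om. avoiding_dir v f G) + c * (40 * D / m * (\<Sum>G\<in>Om. vertex_dir v f G)
      + 320 * lam / m\<^sup>2 * (\<Sum>G\<in>Om. near_dir v f G) + 1760 * lam * D ^ 5 / m\<^sup>2 * en)" if v: "v \<in> L" for v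
  proof -
    interpret V: degs_fun d L r f v by unfold_locales (use f v ne in auto)
    have "(\<Sum>S\<in>V.rows {}. ent (V.above S) f) \<le> (\<Sum>S\<in>V.rows {}. M / (m - 1) * (\<Sum>G\<in>V.above S. avoiding_dir v f G))"
      using IH[OF v] unfolding m_def by (intro sum_mono V.ent_above_remove) auto
    also have "\<dots> = M / (m - 1) * (\<Sum>G\<in>Om. avoiding_dir v f G)"
      unfolding sum_distrib_left[symmetric] V.sum_rows by (simp add: V.above_empty)
    finally show ?thesis using V.ent_split V.row_ent_le[OF large] by (simp add: en_def m_def D_def lam_def c_def)
  qed
  have s1: "(\<Sum>v\<in>L. \<Sum>G\<in>Om. avoiding_dir v f G) = (m - 2) * dr"
    unfolding dr_def dirichlet_def m_def
    by (subst sum.swap, subst sum_distrib_left) (intro sum.cong refl sum_vertices(1) f)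
  have s2: "(\<Sum>v\<in>L. \<Sum>G\<in>Om. vertex_dir v f G) = dr"
    unfolding dr_def dirichlet_def by (subst sum.swap) (intro sum.cong refl sum_vertices(2) f)
  have s3: "(\<Sum>v\<in>L. \<Sum>G\<in>Om. near_dir v f G) \<le> D\<^sup>2 * dr"
    unfolding dr_def dirichlet_def D_def
    by (subst sum.swap, subst sum_distrib_left) (intro sum_mono sum_vertices(3) f)
  have lin: "(\<Sum>v\<in>L. a0 * S1 v + c * (a1 * S2 v + a2 * S3 v + a3))
      = a0 * sum S1 L + c * (a1 * sum S2 L + a2 * sum S3 L + real (card L) * a3)"
    for a0 a1 a2 a3 :: real and S1 S2 S3
    by (simp add: sum.distrib distrib_left flip: sum_distrib_left)
  have "m * en = (\<Sum>v\<in>L. en)" by (simp add: m_def)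
  also have "\<dots> \<le> (\<Sum>v\<in>L. M / (m - 1) * (\<Sum>G\<in>Om. avoiding_dir v f G) + c * (40 * D / m * (\<Sum>G\<in>Om. vertex_dir v f G)
      + 320 * lam / m\<^sup>2 * (\<Sum>G\<in>Om. near_dir v f G) + 1760 * lam * D ^ 5 / m\<^sup>2 * en))"
    by (intro sum_mono one)
  also have "\<dots> = M / (m - 1) * ((m - 2) * dr) + c * (40 * D / m * dr
      + 320 * lam / m\<^sup>2 * (\<Sum>v\<in>L. \<Sum>G\<in>Om. near_dir v f G) + m * (1760 * lam * D ^ 5 / m\<^sup>2 * en))"
    unfolding lin s1 s2 m_def[symmetric] ..
  also have "\<dots> \<le> M / (m - 1) * ((m - 2) * dr) + c * (40 * D / m * dr
      + 320 * lam / m\<^sup>2 * (D\<^sup>2 * dr) + m * (1760 * lam * D ^ 5 / m\<^sup>2 * en))"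
    using s3 lam4 c by (intro add_left_mono mult_left_mono add_right_mono) auto
  also have "\<dots> \<le> M / (m - 1) * ((m - 2) * dr) + K / m * dr + en / 2"
  proof -
    have "320 * lam / m\<^sup>2 * (D\<^sup>2 * dr) \<le> 320 * D\<^sup>2 / m * dr"
    proof -
      have "lam / m\<^sup>2 \<le> m / m\<^sup>2" using lm by (intro divide_right_mono) auto
      also have "\<dots> = 1 / m" by (simp add: power2_eq_square)
      finally have "(320 * D\<^sup>2 * dr) * (lam / m\<^sup>2) \<le> (320 * D\<^sup>2 * dr) * (1 / m)"
        using dr0 by (intro mult_left_mono) auto
      then show ?thesis by (simp add: ac_simps)
    qed
    then have "c * (40 * D / m * dr + 320 * lam / m\<^sup>2 * (D\<^sup>2 * dr)) \<le> c * (40 * D / m * dr + 320 * D\<^sup>2 / m * dr)"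
      using c by (intro mult_left_mono) auto
    also have "\<dots> = K / m * dr" by (simp add: K_def add_divide_distrib algebra_simps)
    finally have 1: "c * (40 * D / m * dr + 320 * lam / m\<^sup>2 * (D\<^sup>2 * dr)) \<le> K / m * dr" .
    have "c * (m * (1760 * lam * D ^ 5 / m\<^sup>2 * en)) = (c * 3520 * D ^ 5 * lam) / m * (en / 2)"
      using m4 by (simp add: power2_eq_square)
    also have "\<dots> \<le> 1 * (en / 2)"
      using lg m4 en0 by (intro mult_right_mono) (auto simp: pos_divide_le_eq)
    finally show ?thesis using 1 by (simp add: distrib_left)
  qed
  finally have A: "m * en \<le> M / (m - 1) * ((m - 2) * dr) + K / m * dr + en / 2" .
  \<comment> \<open>The deletion leaves slack M / (m - 1), which is at least M / m. One half pays
    for \<open>K / m\<close> because \<open>2 * K \<le> M\<close>, the other half compensates the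
    term \<open>en / 2\<close>.\<close>
  have "M / (m - 1) * (m - 2) + K / m \<le> M / m * (m - 1 / 2)"
  proof -
    define q q' where "q = M / m" and "q' = M / (m - 1)"
    have "q \<le> q'" unfolding q_def q'_def using M0 m4 by (intro divide_left_mono) auto
    moreover have e1: "q' * (m - 2) = M - q'" and e2: "q * (m - 1 / 2) = M - q / 2"
      using m4 by (simp_all add: q_def q'_def field_simps)
    moreover have "K / m \<le> q / 2" using M0 m4 by (simp add: q_def field_simps)
    ultimately have "q' * (m - 2) + K / m \<le> q * (m - 1 / 2)" unfolding e1 e2 by linarith
    then show ?thesis by (simp only: q_def q'_def)
  qed
  then have "(M / (m - 1) * (m - 2) + K / m) * dr \<le> M / m * (m - 1 / 2) * dr"
    using dr0 by (intro mult_right_mono)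
  moreover have "(M / (m - 1) * (m - 2) + K / m) * dr = M / (m - 1) * ((m - 2) * dr) + K / m * dr"
    by (simp only: distrib_right mult.assoc)
  moreover have "(m - 1 / 2) * en = m * en - en / 2" by (simp add: left_diff_distrib)
  moreover have "M / m * (m - 1 / 2) * dr = (m - 1 / 2) * (M / m * dr)"
    by (simp only: mult.assoc mult.commute mult.left_commute)
  ultimately have "(m - 1 / 2) * en \<le> (m - 1 / 2) * (M / m * dr)" using A by linarith
  then have "en \<le> M / m * dr" by (rule mult_left_le_imp_le) (use m4 in simp)
  then show ?thesis by (simp add: en_def dr_def m_def)
qed

end

section \<open>The switch chain\<close>

lemma eventually_large:
  fixes C D :: real
  assumes "0 < C" "0 \<le> D"
  shows "\<exists>n0::nat. \<forall>n\<ge>n0. C * (4 + ln (1 + D * (real n)\<^sup>2)) \<le> real n"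
proof -
  have "((\<lambda>x::real. ln x / x) \<longlongrightarrow> 0) at_top" by (rule ln_x_over_x_tendsto_0)
  then have "eventually (\<lambda>x::real. ln x / x < 1 / (4 * C)) at_top"
    using assms by (intro order_tendstoD) auto
  then have "eventually (\<lambda>n::nat. ln (real n) / real n < 1 / (4 * C)) sequentially"
    using filterlim_real_sequentially by (rule eventually_compose_filterlim)
  moreover have "eventually (\<lambda>n::nat. max 1 (2 * C * (4 + ln (1 + D))) \<le> real n) sequentially"
    using filterlim_real_sequentially unfolding filterlim_at_top by blast
  ultimately have "eventually (\<lambda>n::nat. C * (4 + ln (1 + D * (real n)\<^sup>2)) \<le> real n) sequentially"
  proof eventually_elim
    case (elim n)
    then have n: "1 \<le> real n" "2 * C * (4 + ln (1 + D)) \<le> real n" by auto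
    have "1 \<le> (real n)\<^sup>2" using n(1) by (rule one_le_power)
    then have "1 + D * (real n)\<^sup>2 \<le> (1 + D) * (real n)\<^sup>2" by (simp add: distrib_right)
    then have "ln (1 + D * (real n)\<^sup>2) \<le> ln ((1 + D) * (real n)\<^sup>2)"
      using assms by (intro ln_mono) (auto intro: add_pos_nonneg)
    also have "\<dots> = ln (1 + D) + 2 * ln (real n)"
      using assms n by (simp add: ln_mult ln_realpow)
    finally have "C * (4 + ln (1 + D * (real n)\<^sup>2)) \<le> C * (4 + (ln (1 + D) + 2 * ln (real n)))"
      using assms by (intro mult_left_mono) auto
    moreover have "4 * C * ln (real n) \<le> real n"
      using elim(1) n assms by (simp add: field_simps)
    ultimately show ?case using n(2) by (simp add: distrib_left)
  qed
  then show ?thesis by (simp add: eventually_sequentially)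
qed

theorem ent_le_dirichlet:
  assumes d: "1 \<le> d"
  shows "\<exists>M>0. \<forall>L r f. finite L \<longrightarrow> (\<forall>j. r j \<le> d) \<longrightarrow> (\<forall>G\<in>graphs d L r. 0 < f G)
    \<longrightarrow> ent (graphs d L r) f \<le> M / card L * dirichlet (graphs d L r) f"
proof -
  define C where "C = 2 ^ (d + 1) * 3520 * real d ^ 5"
  have "0 < C" using d by (simp add: C_def)
  then obtain n0 :: nat where n0: "\<forall>n\<ge>n0. C * (4 + ln (1 + real d * (real n)\<^sup>2)) \<le> real n"
    using eventually_large[of C "real d"] by auto
  define K where "K = 2 * (2 ^ (d + 1) * (40 * real d + 320 * (real d)\<^sup>2))"
  define B where "B = 4 * (2 ^ (n0 * (n0 * d)) :: real) ^ 6"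
  \<comment> \<open>\<open>K\<close> is what the induction step requires; the second entry covers
    the classes below the threshold, where the crude constant \<open>B\<close> must be at most
    \<open>M / card L\<close>.\<close>
  define M where "M = max K (max 2 (real n0) * B)"
  have M: "K \<le> M" "2 * B \<le> M" "real n0 * B \<le> M" "0 < M"
  proof -
    show "K \<le> M" "0 < M" by (auto simp: M_def B_def less_max_iff_disj)
    have "0 \<le> B" by (simp add: B_def)
    then have "2 * B \<le> max 2 (real n0) * B" "real n0 * B \<le> max 2 (real n0) * B"
      by (auto intro: mult_right_mono)
    then show "2 * B \<le> M" "real n0 * B \<le> M" by (auto simp: M_def)
  qed
  have "ent (graphs d L r) f \<le> M / card L * dirichlet (graphs d L r) f"
    if "finite L" "\<And>j. r j \<le> d" "\<And>G. G \<in> graphs d L r \<Longrightarrow> 0 < f G" for L r f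
    using that
  proof (induction "card L" arbitrary: L r f)
    \<comment> \<open>The quotient by \<open>card L = 0\<close> is 0, so the claim is that the
      entropy vanishes; there is at most one graph.\<close>
    case 0
    then have "L = {}" by simp
    then have "graphs d L r \<subseteq> {{}}" by (auto simp: graphs_def)
    then have "graphs d L r = {} \<or> graphs d L r = {{}}" by blast
    then show ?case using 0 by (auto simp: ent_def mean_ent_def)
  next
    case (Suc n)
    interpret degs d L r by unfold_locales (use Suc.prems d in auto)
    show ?case
    proof (cases "n0 \<le> card L")
      case True
      show ?thesis
      proof (rule ent_le_dirichlet_step)
        show "2 ^ (d + 1) * 3520 * real d ^ 5 * (4 + ln (1 + real d * (real (card L))\<^sup>2)) \<le> real (card L)"
          using n0 True by (simp add: C_def)
        show "2 * (2 ^ (d + 1) * (40 * real d + 320 * (real d)\<^sup>2)) \<le> M" using M by (simp add: K_def)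
        fix v r' and g :: "bgraph \<Rightarrow> real"
        assume v: "v \<in> L" and r': "\<And>j. r' j \<le> d" and g: "\<And>G. G \<in> graphs d (L - {v}) r' \<Longrightarrow> 0 < g G"
        have "n = card (L - {v})" "real (card L) - 1 = real (card (L - {v}))"
          using Suc.hyps(2) v finL by auto
        then show "ent (graphs d (L - {v}) r') g \<le> M / (real (card L) - 1) * dirichlet (graphs d (L - {v}) r') g"
          using Suc.hyps(1)[of "L - {v}" r' g] r' g finL by simp
      qed (use Suc.prems in auto)
    next
      case False
      have L0: "0 < card L" using Suc.hyps(2) by simp
      have "card L * (card L * d) \<le> n0 * (n0 * d)" using False by (intro mult_le_mono) auto
      then have "card Om \<le> 2 ^ (n0 * (n0 * d))"
        by (intro order_trans[OF card_Om_le power_increasing]) simp_all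
      then have "real (card Om) \<le> 2 ^ (n0 * (n0 * d))" by (metis of_nat_le_iff of_nat_numeral of_nat_power)
      then have "4 * real (card Om) ^ 6 \<le> B" unfolding B_def by (intro mult_left_mono power_mono) auto
      moreover have "B \<le> M / card L"
      proof -
        have "B * card L \<le> B * n0" using False by (intro mult_left_mono) (auto simp: B_def)
        then show ?thesis using M L0 by (simp add: pos_le_divide_eq mult.commute)
      qed
      ultimately have "4 * real (card Om) ^ 6 * dirichlet Om f \<le> M / card L * dirichlet Om f"
        using dirichlet_nonneg Suc.prems(3) by (intro mult_right_mono) auto
      then show ?thesis using ent_le_dirichlet_crude[of f] Suc.prems(3) by (auto intro: order_trans)
    qed
  qed
  then show ?thesis using M(4) by (intro exI[of _ M] conjI allI impI) simp_all
qed

section \<open>Translation to the normalised chain\<close>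

lemma bireg_eq_graphs:
  assumes "1 \<le> d"
  shows "bireg_graphs n d = graphs d {0..<n} (\<lambda>j. if j < n then d else 0)"
proof (intro equalityI subsetI)
  fix G assume G: "G \<in> bireg_graphs n d"
  then have sub: "G \<subseteq> {0..<n} \<times> {0..<n}" by (simp add: bireg_graphs_def)
  have "finite G" by (rule finite_subset[OF sub]) simp
  moreover have "col G j = {}" if "\<not> j < n" for j using sub that by (auto simp: col_def)
  moreover have "fst ` G \<subseteq> {0..<n}" using sub by auto
  ultimately show "G \<in> graphs d {0..<n} (\<lambda>j. if j < n then d else 0)"
    using G by (auto simp: graphs_def bireg_graphs_def row_def col_def)
next
  fix G assume G: "G \<in> graphs d {0..<n} (\<lambda>j. if j < n then d else 0)"
  have "j < n" if "(i, j) \<in> G" for i j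
  proof (rule ccontr)
    assume "\<not> j < n"
    then have "card (col G j) = 0" "finite (col G j)" using G finite_col by (auto simp: graphs_def)
    then show False using that by (auto simp: col_def)
  qed
  then show "G \<in> bireg_graphs n d" using G by (force simp: graphs_def bireg_graphs_def row_def col_def)
qed

lemma dirichlet_le_nbrs:
  assumes fin: "finite (bireg_graphs n d)" and f: "\<And>G. G \<in> bireg_graphs n d \<Longrightarrow> 0 < f G"
    and switch: "\<And>G i k i' k'. G \<in> bireg_graphs n d \<Longrightarrow> legal G i k i' k' \<Longrightarrow> switch G i k i' k' \<in> bireg_graphs n d"
    and finG: "\<And>G. G \<in> bireg_graphs n d \<Longrightarrow> finite G"
  shows "dirichlet (bireg_graphs n d) f \<le> 4 * (\<Sum>G\<in>bireg_graphs n d. \<Sum>H\<in>switch_nbrs n d G. phi (f G) (f H))"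
  unfolding dirichlet_def sum_distrib_left
proof (rule sum_mono)
  fix G assume G: "G \<in> bireg_graphs n d"
  let ?g = "\<lambda>(i, k, i', k'). switch G i k i' k'"
  have nb: "?g t \<in> switch_nbrs n d G" if "t \<in> switches G" for t
  proof -
    obtain i k i' k' where t: "t = (i, k, i', k')" by (cases t)
    have l: "legal G i k i' k'" using that by (simp add: t switches_def)
    have "\<exists>i1 j1 i2 j2. (i1, j1) \<in> G \<and> (i2, j2) \<in> G \<and> i1 \<noteq> i2 \<and> j1 \<noteq> j2
         \<and> switch G i k i' k' = (G - {(i1, j1), (i2, j2)}) \<union> {(i1, j2), (i2, j1)}"
      using l legal_neq[OF l] by (intro exI[of _ i] exI[of _ k] exI[of _ i'] exI[of _ k']) (auto simp: legal_def switch_def)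
    then show ?thesis using switch[OF G l] by (simp add: t switch_nbrs_def)
  qed
  have finN: "finite (switch_nbrs n d G)" by (rule finite_subset[OF _ fin]) (auto simp: switch_nbrs_def)
  \<comment> \<open>The set of the two removed edges is determined by \<open>G\<close> and
    \<open>H\<close>, so each position of the quadruple has at most two choices.\<close>
  have fib: "card {t \<in> switches G. ?g t = H} \<le> 4" for H
  proof (cases "{t \<in> switches G. ?g t = H} = {}")
    case False
    then obtain i k i' k' where l: "legal G i k i' k'" and H: "switch G i k i' k' = H"
      by (auto simp: switches_def)
    define P where "P = {(i, k), (i', k')}"
    have GH: "G - H \<subseteq> P" unfolding P_def H[symmetric] by (auto simp: switch_def)
    have "{t \<in> switches G. ?g t = H} \<subseteq> (\<lambda>((i, k), (i', k')). (i, k, i', k')) ` (P \<times> P)"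
    proof
      fix t assume t: "t \<in> {t \<in> switches G. ?g t = H}"
      obtain a b a' b' where ab: "t = (a, b, a', b')" by (cases t)
      have l': "legal G a b a' b'" "switch G a b a' b' = H" using t by (auto simp: ab switches_def)
      have "(a, b) \<in> G - H" "(a', b') \<in> G - H" using l'(1) legal_neq[OF l'(1)]
        unfolding l'(2)[symmetric] by (auto simp: legal_def switch_def)
      then show "t \<in> (\<lambda>((i, k), (i', k')). (i, k, i', k')) ` (P \<times> P)" using GH by (force simp: ab)
    qed
    then have "card {t \<in> switches G. ?g t = H} \<le> card (P \<times> P)"
      by (rule surj_card_le[rotated]) (simp add: P_def)
    also have "\<dots> \<le> 2 * 2"
      unfolding card_cartesian_product P_def by (intro mult_le_mono) (auto simp: card_insert_if)
    finally show ?thesis by simp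
  next
    case True
    then have "card {t \<in> switches G. ?g t = H} = 0" by (simp only: card.empty)
    then show ?thesis by linarith
  qed
  have "(\<Sum>(i, k, i', k')\<in>switches G. phi (f G) (f (switch G i k i' k'))) = (\<Sum>t\<in>switches G. phi (f G) (f (?g t)))"
    by (simp add: case_prod_beta)
  also have "\<dots> = (\<Sum>H\<in>switch_nbrs n d G. \<Sum>t\<in>{t \<in> switches G. ?g t = H}. phi (f G) (f (?g t)))"
    using finite_switches[OF finG[OF G]] finN nb by (intro sum.group[symmetric]) auto
  also have "\<dots> \<le> (\<Sum>H\<in>switch_nbrs n d G. 4 * phi (f G) (f H))"
  proof (rule sum_mono)
    fix H assume "H \<in> switch_nbrs n d G"
    then have H: "H \<in> bireg_graphs n d" by (simp add: switch_nbrs_def)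
    have "(\<Sum>t\<in>{t \<in> switches G. ?g t = H}. phi (f G) (f (?g t))) = card {t \<in> switches G. ?g t = H} * phi (f G) (f H)"
      by simp
    also have "\<dots> \<le> 4 * phi (f G) (f H)"
      using fib[of H] phi_nonneg[OF f[OF G] f[OF H]] by (intro mult_right_mono) auto
    finally show "(\<Sum>t\<in>{t \<in> switches G. ?g t = H}. phi (f G) (f (?g t))) \<le> 4 * phi (f G) (f H)" .
  qed
  finally show "(\<Sum>(i, k, i', k')\<in>switches G. phi (f G) (f (switch G i k i' k'))) \<le> (\<Sum>H\<in>switch_nbrs n d G. 4 * phi (f G) (f H))" .
qed

text \<open>The diagonal of the generator drops out because \<open>phi\<close> vanishes there, and
  the factor 2 in the jump rate cancels the 1/2 of the form.\<close>

lemma Dirichlet_u_eq: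
  assumes fin: "finite (bireg_graphs n d)" and f: "\<And>G. G \<in> bireg_graphs n d \<Longrightarrow> 0 < f G"
  shows "real (n * d) * (real (n * d) - 1) * card (bireg_graphs n d) * Dirichlet_u n d f
    = (if real (n * d) * (real (n * d) - 1) = 0 \<or> bireg_graphs n d = {} then 0
       else \<Sum>G\<in>bireg_graphs n d. \<Sum>H\<in>switch_nbrs n d G. phi (f G) (f H))"
proof -
  let ?X = "bireg_graphs n d"
  define b where "b = real (n * d) * (real (n * d) - 1)"
  define N where "N = real (card ?X)"
  have "(\<Sum>H\<in>?X. pi_u n d G * Q_u n d G H * (f G - f H) * ln (f G / f H))
      = 2 / (N * b) * (\<Sum>H\<in>switch_nbrs n d G. phi (f G) (f H))" if G: "G \<in> ?X" for G
  proof -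
    have "(\<Sum>H\<in>?X. pi_u n d G * Q_u n d G H * (f G - f H) * ln (f G / f H))
      = (\<Sum>H\<in>?X. if H \<in> switch_nbrs n d G then 2 / (N * b) * phi (f G) (f H) else 0)"
    proof (intro sum.cong refl)
      fix H assume H: "H \<in> ?X"
      have "(f G - f H) * ln (f G / f H) = phi (f G) (f H)"
        using f[OF G] f[OF H] by (simp add: phi_def ln_div)
      moreover have "pi_u n d G = 1 / N" using G by (simp add: pi_u_def N_def)
      ultimately show "pi_u n d G * Q_u n d G H * (f G - f H) * ln (f G / f H)
          = (if H \<in> switch_nbrs n d G then 2 / (N * b) * phi (f G) (f H) else 0)"
        by (auto simp: Q_u_def b_def mult.assoc)
    qed
    also have "\<dots> = (\<Sum>H\<in>{H \<in> ?X. H \<in> switch_nbrs n d G}. 2 / (N * b) * phi (f G) (f H))"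
      using fin by (rule sum.inter_filter[symmetric])
    also have "{H \<in> ?X. H \<in> switch_nbrs n d G} = switch_nbrs n d G" by (auto simp: switch_nbrs_def)
    finally show ?thesis by (simp add: sum_distrib_left)
  qed
  then have "Dirichlet_u n d f = 1 / 2 * (\<Sum>G\<in>?X. 2 / (N * b) * (\<Sum>H\<in>switch_nbrs n d G. phi (f G) (f H)))"
    unfolding Dirichlet_u_def by (intro arg_cong2[of _ _ _ _ "(*)"] refl sum.cong) auto
  then have "Dirichlet_u n d f = 1 / (N * b) * (\<Sum>G\<in>?X. \<Sum>H\<in>switch_nbrs n d G. phi (f G) (f H))"
    unfolding sum_distrib_left[symmetric] by simp
  moreover have "N = 0 \<longleftrightarrow> ?X = {}" using fin by (simp add: N_def)
  ultimately show ?thesis unfolding b_def[symmetric] N_def[symmetric] by auto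
qed

lemma Ent_u_eq:
  assumes "finite (bireg_graphs n d)"
  shows "card (bireg_graphs n d) * Ent_u n d f = ent (bireg_graphs n d) f"
proof -
  let ?X = "bireg_graphs n d"
  define N where "N = real (card ?X)"
  have e: "expect_u n d h = sum h ?X / N" for h
    by (simp add: expect_u_def pi_u_def N_def sum_divide_distrib)
  show ?thesis
  proof (cases "?X = {}")
    case False
    then have "N \<noteq> 0" using assms by (simp add: N_def)
    then have "N * Ent_u n d f = (\<Sum>G\<in>?X. f G * (ln (f G) - ln (sum f ?X / N)))"
      by (simp add: Ent_u_def e)
    then show ?thesis
      by (simp add: ent_def mean_ent_def N_def right_diff_distrib sum_subtractf flip: sum_distrib_right)
  qed (simp add: ent_def mean_ent_def)
qed

theorem theorem3:
  "\<forall>d::nat. d \<ge> 2 \<longrightarrow> (\<exists>C::real. C > 0 \<and>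
     (\<forall>n::nat. n \<ge> 2 * d \<longrightarrow>
       (\<forall>f :: bgraph \<Rightarrow> real. (\<forall>G\<in>bireg_graphs n d. f G > 0) \<longrightarrow>
          Ent_u n d f \<le> C * real n * Dirichlet_u n d f)))"
proof (intro allI impI)
  fix d :: nat assume d: "2 \<le> d"
  then obtain M where M: "0 < M" and mlsi: "\<And>L r f. finite L \<Longrightarrow> (\<And>j. r j \<le> d) \<Longrightarrow>
      (\<And>G. G \<in> graphs d L r \<Longrightarrow> 0 < f G) \<Longrightarrow> ent (graphs d L r) f \<le> M / card L * dirichlet (graphs d L r) f"
    using ent_le_dirichlet[of d] by auto
  show "\<exists>C>0. \<forall>n\<ge>2 * d. \<forall>f. (\<forall>G\<in>bireg_graphs n d. 0 < f G) \<longrightarrow> Ent_u n d f \<le> C * real n * Dirichlet_u n d f"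
  \<comment> \<open>The inequality for sums has constant \<open>M / n\<close>; counting quadruples
    costs 4, and the normalisation of the generator contributes \<open>n * d * (n * d - 1)\<close>,
    which is below \<open>n^2 * d^2\<close>.\<close>
  proof (intro exI[of _ "4 * M * (real d)\<^sup>2"] conjI allI impI)
    show "0 < 4 * M * (real d)\<^sup>2" using M d by simp
    fix n :: nat and f :: "bgraph \<Rightarrow> real"
    assume n: "2 * d \<le> n" and f': "\<forall>G\<in>bireg_graphs n d. 0 < f G"
    then have f: "\<And>G. G \<in> bireg_graphs n d \<Longrightarrow> 0 < f G" by simp
    define r where "r = (\<lambda>j. if j < n then d else 0)"
    interpret degs d "{0..<n}" r by unfold_locales (use d in \<open>auto simp: r_def\<close>)
    have X: "bireg_graphs n d = Om" using bireg_eq_graphs[of d n] d by (simp add: r_def)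
    define N where "N = real (card (bireg_graphs n d))"
    define T where "T = (\<Sum>G\<in>bireg_graphs n d. \<Sum>H\<in>switch_nbrs n d G. phi (f G) (f H))"
    have fin: "finite (bireg_graphs n d)" using fin_Om X by simp
    show "Ent_u n d f \<le> 4 * M * (real d)\<^sup>2 * real n * Dirichlet_u n d f"
    proof (cases "bireg_graphs n d = {}")
      case True
      then show ?thesis by (simp add: Ent_u_def expect_u_def Dirichlet_u_def)
    next
      case False
      have N: "0 < N" using False fin by (simp add: N_def card_gt_0_iff)
      have nd: "2 \<le> real n" "1 \<le> real d" "1 < real (n * d)"
      proof -
        have "4 \<le> n" using n d by simp
        then show "2 \<le> real n" "1 \<le> real d" using d by auto
        have "4 * 2 \<le> n * d" using \<open>4 \<le> n\<close> d by (rule mult_le_mono)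
        then have "1 < n * d" by linarith
        then show "1 < real (n * d)" by (metis of_nat_1 of_nat_less_iff)
      qed
      have "N * Ent_u n d f = ent Om f" using Ent_u_eq[OF fin] X by (simp add: N_def)
      also have "\<dots> \<le> M / n * dirichlet Om f" using mlsi[of "{0..<n}" r f] r_le f X by simp
      also have "\<dots> \<le> M / n * (4 * T)"
        unfolding T_def using dirichlet_le_nbrs[OF fin f] switch_in_graphs fin_graph M X
        by (intro mult_left_mono) auto
      also have "4 * T = 4 * (real (n * d) * (real (n * d) - 1) * N * Dirichlet_u n d f)"
        using Dirichlet_u_eq[OF fin f] False nd by (simp add: T_def N_def)
      also have "M / n * \<dots> = N * (4 * M * real d * (real (n * d) - 1) * Dirichlet_u n d f)"
        using nd by simp
      finally have 1: "Ent_u n d f \<le> 4 * M * real d * (real (n * d) - 1) * Dirichlet_u n d f"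
        using N by (simp add: mult_le_cancel_left)
      have D0: "0 \<le> Dirichlet_u n d f"
      proof -
        have "0 \<le> T" unfolding T_def using f
          by (intro sum_nonneg phi_nonneg) (auto simp: switch_nbrs_def)
        then have "0 \<le> (real (n * d) * (real (n * d) - 1) * N) * Dirichlet_u n d f"
          using Dirichlet_u_eq[OF fin f] False nd by (simp add: T_def N_def)
        moreover have "0 < real (n * d) * (real (n * d) - 1) * N" using nd N by (intro mult_pos_pos) auto
        ultimately show ?thesis by (simp add: zero_le_mult_iff)
      qed
      have "4 * M * real d * (real (n * d) - 1) \<le> 4 * M * real d * (real n * real d)"
        using M by (intro mult_left_mono) auto
      also have "\<dots> = 4 * M * (real d)\<^sup>2 * real n" by (simp add: power2_eq_square)
      finally show ?thesis using 1 D0 by (meson mult_right_mono order_trans)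
    qed
  qed
qed

end
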